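(* Assume that the real-valued function $b\in C(\mathbb{R}^N)$ has a limit at infinity and that $0<b_\infty:=\lim_{|x|\to\infty}b(x)<b(x)$ for all $x\in\mathbb{R}^N$. Let $\alpha>0$ and $q\in(2,2_\alpha^* )$. Let $\|\cdot\|_{H^\alpha(\mathbb{R}^N)}$ be the norm $$\|f\|_{H^\alpha}=\left(\int_{\mathbb{R}^N}(1+|\xi|^2)^\alpha|\widehat f(\xi)|^2\,d\xi\right)^{1/2}$$ or any other equivalent Hilbert norm on $H^\alpha(\mathbb{R}^N)$ which is invariant under lattice translations $u\mapsto u(\cdot-y)$, $y\in\mathbb{Z}^N$. Then the infimum $$\tilde\kappa:=\inf_{\int_{\mathbb{R}^N}b(x)|u|^q\,dx=1}\|u\|_{H^\alpha(\mathbb{R}^N)},$$ taken over $u\in H^\alpha(\mathbb{R}^N)$, is attained.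
   Context: $H^\alpha(\mathbb{R}^N)=W^{\alpha,2}(\mathbb{R}^N)$ is the Hilbert space of $f\in L^2(\mathbb{R}^N)$ for which $(1+|\xi|^2)^{\alpha/2}\widehat f(\xi)\in L^2(\mathbb{R}^N)$. The critical exponent is $2_\alpha^*=\frac{2N}{N-2\alpha}$ if $N>2\alpha$ and $2_\alpha^*=\infty$ if $N\le2\alpha$. $H^\alpha(\mathbb{R}^N)$ is continuously imbedded in $L^q(\mathbb{R}^N)$ for the $q$ considered. A Hilbert norm is a norm induced by an inner product. *)

theory Defs
  imports "HOL-Analysis.Analysis"
begin

text \<open>
  \<open>L\<^sup>2\<close> and \<open>H\<^sup>\<alpha>\<close> are represented by their Borel measurable representatives; two
  representatives that agree almost everywhere denote the same element.
\<close>

definition L2 :: "('a::euclidean_space \<Rightarrow> complex) set" where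
  "L2 = {f \<in> borel_measurable lborel. integrable lborel (\<lambda>x. (cmod (f x))\<^sup>2)}"

definition fourier_L1 :: "(real ^ 'n \<Rightarrow> complex) \<Rightarrow> real ^ 'n \<Rightarrow> complex" where
  "fourier_L1 f \<xi> =
     of_real ((2 * pi) powr (- real CARD('n) / 2)) * (LINT x|lborel. cis (- (x \<bullet> \<xi>)) * f x)"

text \<open>
  The Plancherel extension of the Fourier transform to \<open>L\<^sup>2\<close>: the limit in \<open>L\<^sup>2\<close> of the
  integral transforms of the truncations of \<open>f\<close> to the balls of radius \<open>n\<close>, which lie in
  \<open>L\<^sup>1 \<inter> L\<^sup>2\<close>. The limit is determined up to a null set, whence the choice of a
  representative. The \<open>L\<^sup>2\<close> distance is a nonnegative integral, so that it is \<open>\<infinity>\<close>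
  (and not 0) for a difference that fails to be square integrable.
\<close>

definition is_fourier_L2 :: "(real ^ 'n \<Rightarrow> complex) \<Rightarrow> (real ^ 'n \<Rightarrow> complex) \<Rightarrow> bool" where
  "is_fourier_L2 f g \<longleftrightarrow> g \<in> L2 \<and>
     (\<lambda>n::nat. \<integral>\<^sup>+ \<xi>. ennreal ((cmod (fourier_L1 (\<lambda>x. indicator (cball 0 (real n)) x * f x) \<xi> - g \<xi>))\<^sup>2) \<partial>lborel)
       \<longlonglongrightarrow> 0"

definition fourier_L2 :: "(real ^ 'n \<Rightarrow> complex) \<Rightarrow> real ^ 'n \<Rightarrow> complex" where
  "fourier_L2 f = (SOME g. is_fourier_L2 f g)"

text \<open>
  \<open>K\<close> is the scalar field, either \<open>\<real>\<close> or all of the complex numbers: it selects the space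
  of real-valued or of complex-valued functions.
\<close>

definition sobolev :: "complex set \<Rightarrow> real \<Rightarrow> (real ^ 'n \<Rightarrow> complex) set" where
  "sobolev K \<alpha> = {f \<in> L2. range f \<subseteq> K \<and>
     (\<lambda>\<xi>. of_real ((1 + (norm \<xi>)\<^sup>2) powr (\<alpha> / 2)) * fourier_L2 f \<xi>) \<in> L2}"

definition sobolev_norm :: "real \<Rightarrow> (real ^ 'n \<Rightarrow> complex) \<Rightarrow> real" where
  "sobolev_norm \<alpha> f =
     sqrt (LINT \<xi>|lborel. (1 + (norm \<xi>)\<^sup>2) powr \<alpha> * (cmod (fourier_L2 f \<xi>))\<^sup>2)"

definition critical_exponent :: "nat \<Rightarrow> real \<Rightarrow> ereal" where
  "critical_exponent N \<alpha> =
     (if real N > 2 * \<alpha> then ereal (2 * real N / (real N - 2 * \<alpha>)) else \<infinity>)"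

text \<open>
  Inner products over \<open>K\<close> on a space \<open>V\<close> of representatives. Definiteness is up to null
  sets; by the Cauchy-Schwarz inequality such a form is well defined on equivalence classes.
\<close>

definition inner_product_on ::
    "complex set \<Rightarrow> ('a::euclidean_space \<Rightarrow> complex) set
      \<Rightarrow> (('a \<Rightarrow> complex) \<Rightarrow> ('a \<Rightarrow> complex) \<Rightarrow> complex) \<Rightarrow> bool" where
  "inner_product_on K V ip \<longleftrightarrow>
     (\<forall>f\<in>V. \<forall>g\<in>V. ip f g \<in> K) \<and>
     (\<forall>f\<in>V. \<forall>g\<in>V. \<forall>h\<in>V. ip (\<lambda>x. f x + g x) h = ip f h + ip g h) \<and>
     (\<forall>c\<in>K. \<forall>f\<in>V. \<forall>g\<in>V. ip (\<lambda>x. c * f x) g = c * ip f g) \<and>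
     (\<forall>f\<in>V. \<forall>g\<in>V. ip g f = cnj (ip f g)) \<and>
     (\<forall>f\<in>V. 0 \<le> Re (ip f f)) \<and>
     (\<forall>f\<in>V. ip f f = 0 \<longleftrightarrow> (AE x in lborel. f x = 0))"

definition hilbert_norm_on ::
    "complex set \<Rightarrow> ('a::euclidean_space \<Rightarrow> complex) set \<Rightarrow> (('a \<Rightarrow> complex) \<Rightarrow> real) \<Rightarrow> bool" where
  "hilbert_norm_on K V nrm \<longleftrightarrow>
     (\<exists>ip. inner_product_on K V ip \<and> (\<forall>f\<in>V. nrm f = sqrt (Re (ip f f))))"

definition equivalent_norms_on ::
    "'b set \<Rightarrow> ('b \<Rightarrow> real) \<Rightarrow> ('b \<Rightarrow> real) \<Rightarrow> bool" where
  "equivalent_norms_on V nrm nrm' \<longleftrightarrow>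
     (\<exists>c>0. \<exists>C>0. \<forall>f\<in>V. c * nrm' f \<le> nrm f \<and> nrm f \<le> C * nrm' f)"

definition integer_lattice :: "(real ^ 'n) set" where
  "integer_lattice = {y. \<forall>i. y $ i \<in> \<int>}"

definition lattice_invariant ::
    "(real ^ 'n \<Rightarrow> complex) set \<Rightarrow> ((real ^ 'n \<Rightarrow> complex) \<Rightarrow> real) \<Rightarrow> bool" where
  "lattice_invariant V nrm \<longleftrightarrow>
     (\<forall>f\<in>V. \<forall>y\<in>integer_lattice. nrm (\<lambda>x. f (x - y)) = nrm f)"

definition constraint_set ::
    "complex set \<Rightarrow> real \<Rightarrow> real \<Rightarrow> (real ^ 'n \<Rightarrow> real) \<Rightarrow> (real ^ 'n \<Rightarrow> complex) set" where
  "constraint_set K \<alpha> q b =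
     {u \<in> sobolev K \<alpha>. has_bochner_integral lborel (\<lambda>x. b x * cmod (u x) powr q) 1}"

end

theory Submission
  imports Defs "HOL-Library.Diagonal_Subsequence" "HOL-Probability.Characteristic_Functions"
begin

text \<open>
  Let \<open>\<kappa>\<close> be the infimum and \<open>u\<^sub>k\<close> a minimizing sequence. The frequencies of \<open>u\<^sub>k\<close> above \<open>2\<^sup>J\<close>
  are uniformly small in \<open>L\<^sup>q\<close> (Bernstein's inequality on dyadic blocks, where subcriticality of
  \<open>q\<close> makes the blocks decay geometrically), so the low-frequency part of \<open>u\<^sub>k\<close> is bounded away
  from 0 at some point \<open>x\<^sub>k\<close>, and the translates by the lattice points \<open>y\<^sub>k\<close> next to \<open>x\<^sub>k\<close>
  converge weakly along a subsequence to some \<open>w \<noteq> 0\<close>. The low-frequency parts converge pointwise,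
  which yields convergence almost everywhere, and the Brezis-Lieb lemma splits the constraint as
  \<open>1 = t + (1 - t)\<close> while the squared norm splits as \<open>\<parallel>w\<parallel>\<^sup>2 + \<parallel>u\<^sub>k(\<cdot> + y\<^sub>k) - w\<parallel>\<^sup>2\<close>. By homogeneity
  \<open>\<kappa>\<^sup>2 \<ge> \<parallel>w\<parallel>\<^sup>2 + \<kappa>\<^sup>2 (1 - t) powr (2 / q)\<close>. If the \<open>y\<^sub>k\<close> converge to \<open>y\<close>, then
  \<open>\<parallel>w\<parallel>\<^sup>2 \<ge> \<kappa>\<^sup>2 t powr (2 / q)\<close>, and strict concavity forces \<open>t = 1\<close>: the translate of \<open>w\<close> by
  \<open>y\<close> is a minimizer. If they diverge, then \<open>t\<close> is computed with \<open>b_inf\<close> in place of \<open>b > b_inf\<close>,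
  so that \<open>\<parallel>w\<parallel>\<^sup>2 > \<kappa>\<^sup>2 t powr (2 / q)\<close>, a contradiction.
\<close>

section \<open>Real semi-inner products on function spaces\<close>

text \<open>The value of a low-frequency part at a point is a bounded linear functional, so a lower
  bound on it survives weak limits; this takes the place of a vanishing lemma for local masses and
  of local compactness of the embedding. Only lattice translations preserve the norm, so
  \<open>x k\<close> is split as \<open>z k + y k\<close> with \<open>y k\<close> in the lattice and
  \<open>z k\<close> bounded; the low-frequency parts are uniformly Lipschitz, so \<open>z k\<close>
  may be replaced by the limit of a subsequence. The norm is any equivalent Hilbert norm, so its
  square has to be split by its own inner product \<open>B\<close>: weak compactness is proved
  abstractly, in the form \<open>B (u k) w\<close> tends to \<open>B w w\<close>, and not on the
  Fourier side. The filters are inversion integrals over a ball, hence defined at every point and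
  not just almost everywhere; this rests on Plancherel's theorem, whose proof regularizes by
  Gaussians. Concavity of \<open>s powr (2 / q)\<close> is strict because
  \<open>q > 2\<close>.\<close>

text \<open>Only the real part of an inner product enters the argument, so the scalars are real even
  for spaces of complex-valued functions.\<close>

locale semi_inner =
  fixes V :: "('a \<Rightarrow> complex) set" and B :: "('a \<Rightarrow> complex) \<Rightarrow> ('a \<Rightarrow> complex) \<Rightarrow> real"
  assumes add_mem: "f \<in> V \<Longrightarrow> g \<in> V \<Longrightarrow> (\<lambda>x. f x + g x) \<in> V"
    and scale_mem: "f \<in> V \<Longrightarrow> (\<lambda>x. of_real c * f x) \<in> V"
    and sym: "f \<in> V \<Longrightarrow> g \<in> V \<Longrightarrow> B f g = B g f"
    and add_left: "f \<in> V \<Longrightarrow> g \<in> V \<Longrightarrow> h \<in> V \<Longrightarrow> B (\<lambda>x. f x + g x) h = B f h + B g h"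
    and scale_left: "f \<in> V \<Longrightarrow> g \<in> V \<Longrightarrow> B (\<lambda>x. of_real c * f x) g = c * B f g"
    and nonneg: "f \<in> V \<Longrightarrow> 0 \<le> B f f"
begin

definition N :: "('a \<Rightarrow> complex) \<Rightarrow> real" where
  "N f = sqrt (B f f)"

lemma N_sq: "f \<in> V \<Longrightarrow> (N f)\<^sup>2 = B f f"
  by (simp add: N_def nonneg)

lemma N_nonneg: "f \<in> V \<Longrightarrow> 0 \<le> N f"
  by (simp add: N_def nonneg)

lemma add_right: "f \<in> V \<Longrightarrow> g \<in> V \<Longrightarrow> h \<in> V \<Longrightarrow> B h (\<lambda>x. f x + g x) = B h f + B h g"
  using sym[of h "\<lambda>x. f x + g x"] add_left[of f g h] by (simp add: add_mem sym[of _ h])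

lemma scale_right: "f \<in> V \<Longrightarrow> g \<in> V \<Longrightarrow> B g (\<lambda>x. of_real c * f x) = c * B g f"
  using sym[of g "\<lambda>x. of_real c * f x"] scale_left[of f g c] by (simp add: scale_mem sym[of _ g])

lemma diff_eq: "(\<lambda>x. f x - g x) = (\<lambda>x. f x + of_real (-1) * g x)" for f g :: "'a \<Rightarrow> complex"
  by simp

lemma diff_mem: "f \<in> V \<Longrightarrow> g \<in> V \<Longrightarrow> (\<lambda>x. f x - g x) \<in> V"
  unfolding diff_eq by (intro add_mem scale_mem)

lemma diff_left: "f \<in> V \<Longrightarrow> g \<in> V \<Longrightarrow> h \<in> V \<Longrightarrow> B (\<lambda>x. f x - g x) h = B f h - B g h"
  unfolding diff_eq by (subst add_left) (simp_all add: scale_left scale_mem del: of_real_minus of_real_1)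

lemma diff_right: "f \<in> V \<Longrightarrow> g \<in> V \<Longrightarrow> h \<in> V \<Longrightarrow> B h (\<lambda>x. f x - g x) = B h f - B h g"
  using sym[of h "\<lambda>x. f x - g x"] diff_left[of f g h] by (simp add: diff_mem sym[of _ h])

lemma N_scale: "f \<in> V \<Longrightarrow> N (\<lambda>x. of_real c * f x) = \<bar>c\<bar> * N f"
  using scale_left[of f "\<lambda>x. of_real c * f x" c] scale_right[of f f c]
  by (simp add: N_def scale_mem real_sqrt_mult)

lemma N_diff_sq:
  assumes "f \<in> V" "g \<in> V"
  shows "(N (\<lambda>x. f x - g x))\<^sup>2 = (N f)\<^sup>2 - 2 * B f g + (N g)\<^sup>2"
  using assms by (simp add: N_sq diff_mem diff_left diff_right sym[of g f])

lemma N_add_sq: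
  assumes "f \<in> V" "g \<in> V"
  shows "(N (\<lambda>x. f x + g x))\<^sup>2 = (N f)\<^sup>2 + 2 * B f g + (N g)\<^sup>2"
  using assms by (simp add: N_sq add_mem add_left add_right sym[of g f])

lemma cauchy_schwarz:
  assumes f: "f \<in> V" and g: "g \<in> V"
  shows "\<bar>B f g\<bar> \<le> N f * N g"
proof -
  define a b c where "a = B f f" and "b = B f g" and "c = B g g"
  have quad: "0 \<le> a * s\<^sup>2 - 2 * (b * s * t) + c * t\<^sup>2" for s t
    using nonneg[OF diff_mem[OF scale_mem[OF f, of s] scale_mem[OF g, of t]]]
    by (simp add: diff_left diff_right scale_left scale_right diff_mem scale_mem f g sym[OF g f]
        a_def b_def c_def power2_eq_square algebra_simps)
  have a0: "0 \<le> a" and c0: "0 \<le> c"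
    by (simp_all add: a_def c_def nonneg f g)
  have "b\<^sup>2 \<le> a * c"
  proof (cases "c = 0")
    case True
    show ?thesis
    proof (cases "b = 0")
      case False
      \<comment> \<open>With \<open>c = 0\<close> the form is affine in \<open>t\<close>; at
        \<open>s = 1\<close>, \<open>t = (a + 1) / b\<close> it equals \<open>- a - 2\<close>, which
        is negative.\<close>
      have "0 \<le> a * 1 - 2 * (b * 1 * ((a + 1) / b)) + c * ((a + 1) / b)\<^sup>2"
        using quad[of 1 "(a + 1) / b"] by simp
      then show ?thesis using True False a0 by simp
    qed (simp add: a0 c0)
  next
    case False
    \<comment> \<open>The choice \<open>s = c\<close>, \<open>t = b\<close> minimizes the form up to
      scaling and leaves \<open>c\<close> times the discriminant.\<close>
    have "0 \<le> a * c\<^sup>2 - 2 * (b * c * b) + c * b\<^sup>2"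
      by (rule quad)
    also have "\<dots> = c * (a * c - b\<^sup>2)"
      by (simp add: power2_eq_square algebra_simps)
    finally show ?thesis
      using False c0 by (simp add: zero_le_mult_iff)
  qed
  then have "sqrt (b\<^sup>2) \<le> sqrt (a * c)"
    by (rule real_sqrt_le_mono)
  then show ?thesis
    by (simp add: N_def a_def b_def c_def real_sqrt_mult)
qed

lemma N_triangle:
  assumes f: "f \<in> V" and g: "g \<in> V"
  shows "N (\<lambda>x. f x + g x) \<le> N f + N g"
proof (rule power2_le_imp_le)
  show "(N (\<lambda>x. f x + g x))\<^sup>2 \<le> (N f + N g)\<^sup>2"
    using cauchy_schwarz[OF f g] by (simp add: N_add_sq f g power2_sum)
qed (simp add: N_nonneg f g)

lemma N_minus_commute: "f \<in> V \<Longrightarrow> g \<in> V \<Longrightarrow> N (\<lambda>x. f x - g x) = N (\<lambda>x. g x - f x)"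
  using N_scale[OF diff_mem, of f g "-1"] by (simp add: algebra_simps)

lemma N_diff_triangle:
  assumes "f \<in> V" "g \<in> V" "h \<in> V"
  shows "N (\<lambda>x. f x - h x) \<le> N (\<lambda>x. f x - g x) + N (\<lambda>x. g x - h x)"
  using N_triangle[OF diff_mem[OF assms(1,2)] diff_mem[OF assms(2,3)]] by simp

lemma N_triangle_diff:
  assumes f: "f \<in> V" and g: "g \<in> V"
  shows "N (\<lambda>x. f x - g x) \<le> N f + N g"
  using N_triangle[OF f scale_mem[OF g, of "-1"]] N_scale[OF g, of "-1"] by simp

lemma N_diff_bound:
  assumes f: "f \<in> V" and g: "g \<in> V"
  shows "\<bar>N f - N g\<bar> \<le> N (\<lambda>x. f x - g x)"
  using N_triangle[OF diff_mem[OF f g] g] N_triangle[OF diff_mem[OF g f] f]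
    N_minus_commute[OF f g] by simp

end

section \<open>Diagonal subsequences and weak limits\<close>

lemma diagonal_convergent_subseq:
  fixes X :: "nat \<Rightarrow> nat \<Rightarrow> real"
  assumes bdd: "\<And>i k. \<bar>X i k\<bar> \<le> C i"
  shows "\<exists>r. strict_mono r \<and> (\<forall>i. convergent (\<lambda>k. X i (r k)))"
proof -
  interpret subseqs "\<lambda>i r. convergent (\<lambda>k. X i (r k))"
  proof
    fix i and s :: "nat \<Rightarrow> nat"
    have "seq_compact {- C i..C i}"
      by (simp add: compact_imp_seq_compact)
    moreover have "\<forall>k. X i (s k) \<in> {- C i..C i}"
      using bdd[of i] by (simp add: abs_le_iff minus_le_iff)
    ultimately obtain l r where "strict_mono r" "((\<lambda>k. X i (s k)) \<circ> r) \<longlonglongrightarrow> l"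
      using seq_compactE by metis
    then show "\<exists>r'. strict_mono r' \<and> convergent (\<lambda>k. X i ((s \<circ> r') k))"
      unfolding convergent_def o_def by blast
  qed
  have "convergent (\<lambda>k. X i (diagseq k))" for i
  proof -
    have "convergent (\<lambda>k. X i ((diagseq \<circ> (+) (Suc i)) k))"
    proof (rule diagseq_holds)
      fix r s :: "nat \<Rightarrow> nat" and n
      assume "strict_mono r" "convergent (\<lambda>k. X n (s k))"
      then show "convergent (\<lambda>k. X n ((s \<circ> r) k))"
        using convergent_subseq_convergent[of "\<lambda>k. X n (s k)" r] by (simp add: o_def)
    qed
    \<comment> \<open>The diagonal sequence refines the \<open>i\<close>-th extraction only from
      index \<open>Suc i\<close> on; finitely many initial terms do not affect convergence.\<close>
    then have "convergent (\<lambda>k. X i (diagseq (k + Suc i)))"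
      by (simp add: o_def add.commute)
    then show ?thesis
      by (rule convergent_ignore_initial_segment[where f = "\<lambda>k. X i (diagseq k)", THEN iffD1])
  qed
  then show ?thesis
    using subseq_diagseq by blast
qed

text \<open>A substitute for the convex hull. The parallelogram law only asks for midpoints, so no
  convex combinations with general coefficients have to be handled.\<close>

inductive_set midpoint_hull :: "('a \<Rightarrow> complex) set \<Rightarrow> ('a \<Rightarrow> complex) set"
  for W :: "('a \<Rightarrow> complex) set" where
  base: "w \<in> W \<Longrightarrow> w \<in> midpoint_hull W"
| midpoint: "p \<in> midpoint_hull W \<Longrightarrow> q \<in> midpoint_hull W \<Longrightarrow>
    (\<lambda>x. of_real (1/2) * (p x + q x)) \<in> midpoint_hull W"

lemma midpoint_hull_mono: "W \<subseteq> W' \<Longrightarrow> midpoint_hull W \<subseteq> midpoint_hull W'"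
proof
  fix x assume W: "W \<subseteq> W'" and "x \<in> midpoint_hull W"
  from this(2) show "x \<in> midpoint_hull W'"
    by induction (use W in \<open>blast intro: midpoint_hull.intros\<close>)+
qed

context semi_inner
begin

definition bounded_functional :: "(('a \<Rightarrow> complex) \<Rightarrow> real) \<Rightarrow> bool" where
  "bounded_functional l \<longleftrightarrow>
     (\<forall>f\<in>V. \<forall>g\<in>V. l (\<lambda>x. f x + g x) = l f + l g) \<and>
     (\<forall>f\<in>V. \<forall>c. l (\<lambda>x. of_real c * f x) = c * l f) \<and>
     (\<exists>C. \<forall>f\<in>V. \<bar>l f\<bar> \<le> C * N f)"

lemma bounded_functional_add:
  "bounded_functional l \<Longrightarrow> f \<in> V \<Longrightarrow> g \<in> V \<Longrightarrow> l (\<lambda>x. f x + g x) = l f + l g"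
  by (simp add: bounded_functional_def)

lemma bounded_functional_scale:
  "bounded_functional l \<Longrightarrow> f \<in> V \<Longrightarrow> l (\<lambda>x. of_real c * f x) = c * l f"
  by (simp add: bounded_functional_def)

lemma bounded_functional_diff:
  assumes "bounded_functional l" "f \<in> V" "g \<in> V"
  shows "l (\<lambda>x. f x - g x) = l f - l g"
proof -
  have "l (\<lambda>x. f x + of_real (-1) * g x) = l f + (-1) * l g"
    using assms scale_mem[OF assms(3), of "-1"] unfolding bounded_functional_def
    by (simp del: of_real_minus of_real_1)
  then show ?thesis by simp
qed

lemma bounded_functional_B:
  assumes g: "g \<in> V" shows "bounded_functional (\<lambda>f. B f g)"
  unfolding bounded_functional_def
proof (intro conjI ballI allI exI[of _ "N g"])
  show "\<bar>B f g\<bar> \<le> N g * N f" if "f \<in> V" for f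
    using cauchy_schwarz[OF that g] by (simp add: mult.commute)
qed (simp_all add: add_left scale_left g)

lemma bounded_functional_tendsto:
  assumes l: "bounded_functional l" and s: "\<And>n. s n \<in> V" and w: "w \<in> V"
    and lim: "(\<lambda>n. N (\<lambda>x. s n x - w x)) \<longlonglongrightarrow> 0"
  shows "(\<lambda>n. l (s n)) \<longlonglongrightarrow> l w"
proof -
  obtain C where C: "\<And>f. f \<in> V \<Longrightarrow> \<bar>l f\<bar> \<le> C * N f"
    using l unfolding bounded_functional_def by blast
  have "(\<lambda>n. l (s n) - l w) \<longlonglongrightarrow> 0"
  proof (rule tendsto_0_le)
    show "(\<lambda>n. C * N (\<lambda>x. s n x - w x)) \<longlonglongrightarrow> 0"
      using tendsto_mult_right_zero[OF lim] by simp
    show "\<forall>\<^sub>F n in sequentially. norm (l (s n) - l w) \<le> norm (C * N (\<lambda>x. s n x - w x)) * 1"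
    proof (rule always_eventually, rule allI)
      fix n
      have "\<bar>l (s n) - l w\<bar> \<le> C * N (\<lambda>x. s n x - w x)"
        using C[OF diff_mem[OF s w]] by (simp add: bounded_functional_diff[OF l s w])
      then show "norm (l (s n) - l w) \<le> norm (C * N (\<lambda>x. s n x - w x)) * 1"
        by simp
    qed
  qed
  then show ?thesis
    by (simp add: LIM_zero_iff)
qed

lemma midpoint_hull_subset: "W \<subseteq> V \<Longrightarrow> midpoint_hull W \<subseteq> V"
proof
  fix x assume W: "W \<subseteq> V" and "x \<in> midpoint_hull W"
  from this(2) show "x \<in> V"
    proof induction
    case (midpoint p q)
    then show ?case by (intro scale_mem add_mem)
  qed (use W in blast)
qed

text \<open>The condition \<open>\<bar>l p - L\<bar> \<le> e\<close> describes a convex set, which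
  is closed under midpoints. It transfers limits along a sequence to the hulls of its tails, as in
  Mazur's lemma.\<close>

lemma midpoint_hull_functional:
  assumes l: "bounded_functional l" and W: "W \<subseteq> V"
    and b: "\<And>w. w \<in> W \<Longrightarrow> \<bar>l w - L\<bar> \<le> e" and p: "p \<in> midpoint_hull W"
  shows "\<bar>l p - L\<bar> \<le> e"
  using p
proof induction
  case (midpoint p q)
  have pq: "p \<in> V" "q \<in> V"
    using midpoint midpoint_hull_subset[OF W] by auto
  have "l (\<lambda>x. of_real (1/2) * (p x + q x)) = 1/2 * (l p + l q)"
    by (simp add: bounded_functional_add[OF l pq] bounded_functional_scale[OF l add_mem[OF pq]]
        del: of_real_divide)
  then show ?case
    using midpoint.IH by (simp add: abs_le_iff field_simps)
qed (rule b)

text \<open>Nearly norm-minimal elements of the midpoint hulls of the tails form a Cauchy sequence by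
  the parallelogram law; its limit is the weak limit. This replaces the Riesz representation
  theorem and separability.\<close>

lemma weak_subsequence:
  fixes l :: "nat \<Rightarrow> ('a \<Rightarrow> complex) \<Rightarrow> real" and u :: "nat \<Rightarrow> 'a \<Rightarrow> complex"
  assumes complete: "\<And>s. (\<And>n. s n \<in> V) \<Longrightarrow>
      (\<And>e. e > 0 \<Longrightarrow> \<exists>n0. \<forall>m\<ge>n0. \<forall>n\<ge>n0. N (\<lambda>x. s m x - s n x) < e) \<Longrightarrow>
      \<exists>w\<in>V. (\<lambda>n. N (\<lambda>x. s n x - w x)) \<longlonglongrightarrow> 0"
    and u: "\<And>k. u k \<in> V" and bdd: "\<And>k. N (u k) \<le> M"
    and l: "\<And>i. bounded_functional (l i)"
  shows "\<exists>r w. strict_mono r \<and> w \<in> V \<and> (\<forall>i. (\<lambda>k. l i (u (r k))) \<longlonglongrightarrow> l i w) \<and>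
    (\<lambda>k. B (u (r k)) w) \<longlonglongrightarrow> (N w)\<^sup>2"
proof -
  have bddf: "\<exists>C. \<forall>k. \<bar>f (u k)\<bar> \<le> C" if f: "bounded_functional f" for f
  proof -
    obtain C where C: "\<And>g. g \<in> V \<Longrightarrow> \<bar>f g\<bar> \<le> C * N g"
      using f unfolding bounded_functional_def by blast
    have "\<bar>f (u k)\<bar> \<le> \<bar>C\<bar> * M" for k
    proof -
      have "\<bar>f (u k)\<bar> \<le> \<bar>C\<bar> * N (u k)"
        by (rule order_trans[OF C[OF u] mult_right_mono]) (simp_all add: N_nonneg u)
      also have "\<dots> \<le> \<bar>C\<bar> * M"
        by (intro mult_left_mono bdd) simp
      finally show ?thesis .
    qed
    then show ?thesis by blast
  qed
  \<comment> \<open>One diagonal argument serves two families: the given functionals at even indices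
    and the inner products with the members of the sequence at odd ones.\<close>
  define F :: "nat \<Rightarrow> ('a \<Rightarrow> complex) \<Rightarrow> real" where
    "F j = (if even j then l (j div 2) else (\<lambda>f. B f (u (j div 2))))" for j
  have F: "bounded_functional (F j)" for j
    by (simp add: F_def l bounded_functional_B u)
  obtain C where C: "\<And>j k. \<bar>F j (u k)\<bar> \<le> C j"
    using bddf[OF F] by metis
  obtain r where r: "strict_mono r" and conv: "\<And>j. convergent (\<lambda>k. F j (u (r k)))"
    using diagonal_convergent_subseq[of "\<lambda>j k. F j (u k)" C] C by auto
  define v where "v k = u (r k)" for k
  have v: "v k \<in> V" for k by (simp add: v_def u)
  have conv_l: "convergent (\<lambda>k. l i (v k))" for i
    using conv[of "2 * i"] by (simp add: F_def v_def)
  have conv_B: "convergent (\<lambda>k. B (v k) (v m))" for m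
    using conv[of "Suc (2 * r m)"] by (simp add: F_def v_def)
  define T where "T n = midpoint_hull (v ` {n..})" for n
  have TV: "T n \<subseteq> V" for n
    unfolding T_def by (rule midpoint_hull_subset) (use v in auto)
  have T_mono: "T m \<subseteq> T n" if "n \<le> m" for m n
    unfolding T_def by (rule midpoint_hull_mono) (use that in auto)
  have T_ne: "v n \<in> T n" for n
    unfolding T_def by (rule midpoint_hull.base) auto
  \<comment> \<open>The squared distance of the hull of the \<open>n\<close>-th tail from 0. It
    grows with \<open>n\<close>, since the hulls shrink, and is bounded by \<open>M\<close> squared,
    so it converges.\<close>
  define \<mu> where "\<mu> n = (INF p\<in>T n. (N p)\<^sup>2)" for n
  have bb: "bdd_below ((\<lambda>p. (N p)\<^sup>2) ` T n)" for n
    by (rule bdd_belowI[of _ 0]) auto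
  have \<mu>_le: "\<mu> n \<le> (N p)\<^sup>2" if "p \<in> T n" for n p
    unfolding \<mu>_def by (rule cINF_lower[OF bb that])
  have \<mu>_mono: "\<mu> n \<le> \<mu> m" if "n \<le> m" for m n
    unfolding \<mu>_def[of m]
  proof (rule cINF_greatest)
    show "T m \<noteq> {}" using T_ne by blast
    show "\<mu> n \<le> (N p)\<^sup>2" if "p \<in> T m" for p
      using that T_mono[OF \<open>n \<le> m\<close>] by (intro \<mu>_le) blast
  qed
  have \<mu>_bdd: "\<mu> n \<le> M\<^sup>2" for n
    by (rule order_trans[OF \<mu>_le[OF T_ne]]) (simp add: v_def bdd power_mono N_nonneg u)
  \<comment> \<open>The infimum may not be attained; the slack \<open>1 / Suc n\<close> vanishes in
    the limit.\<close>
  define \<nu> where "\<nu> n = \<mu> n + 1 / Suc n" for n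
  have "\<exists>p. p \<in> T n \<and> (N p)\<^sup>2 < \<nu> n" for n
    using cINF_less_iff[OF _ bb, of n "\<nu> n"] T_ne[of n] by (auto simp: \<mu>_def \<nu>_def)
  then obtain p where pT: "\<And>n. p n \<in> T n" and p_lt: "\<And>n. (N (p n))\<^sup>2 < \<nu> n"
    by metis
  have pV: "p n \<in> V" for n using pT TV by blast
  have \<mu>_conv: "convergent \<mu>"
  proof (rule Bseq_monoseq_convergent)
    have "norm (\<mu> n) \<le> \<bar>\<mu> 0\<bar> + M\<^sup>2" for n
      using \<mu>_bdd[of n] \<mu>_mono[of 0 n] zero_le_power2[of M] unfolding real_norm_def by linarith
    then show "Bseq \<mu>" by (rule BseqI')
    show "monoseq \<mu>" by (intro monoI1 allI impI \<mu>_mono)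
  qed
  \<comment> \<open>By the parallelogram law the squared distance is twice the sum of the squared
    norms minus the squared norm of the sum. The midpoint lies in \<open>T k\<close>, which bounds
    the last term below by \<open>4 * \<mu> k\<close>.\<close>
  have key: "(N (\<lambda>x. p m x - p n x))\<^sup>2 \<le> 2 * \<nu> m + 2 * \<nu> n - 4 * \<mu> k"
    if "k \<le> m" "k \<le> n" for k m n
  proof -
    have "p m \<in> T k" "p n \<in> T k" using pT T_mono that by blast+
    then have mid: "(\<lambda>x. of_real (1/2) * (p m x + p n x)) \<in> T k"
      unfolding T_def by (rule midpoint_hull.midpoint)
    have "\<mu> k \<le> (1/2 * N (\<lambda>x. p m x + p n x))\<^sup>2"
      using \<mu>_le[OF mid] unfolding N_scale[OF add_mem[OF pV pV]] by simp
    then have "4 * \<mu> k \<le> (N (\<lambda>x. p m x + p n x))\<^sup>2"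
      by (simp add: power_mult_distrib power2_eq_square)
    then show ?thesis
      using p_lt[of m] p_lt[of n] by (simp add: N_add_sq N_diff_sq pV)
  qed
  obtain w where w: "w \<in> V" and pw: "(\<lambda>n. N (\<lambda>x. p n x - w x)) \<longlonglongrightarrow> 0"
  proof -
    have "\<exists>n0. \<forall>m\<ge>n0. \<forall>n\<ge>n0. N (\<lambda>x. p m x - p n x) < e" if e: "e > 0" for e
    proof -
      have "\<nu> \<longlonglongrightarrow> lim \<mu> + 0"
        unfolding \<nu>_def
        using \<mu>_conv lim_1_over_n[THEN LIMSEQ_Suc] by (intro tendsto_add) (auto simp: convergent_LIMSEQ_iff)
      moreover have "e\<^sup>2 / 8 > 0" using e by simp
      ultimately have "\<forall>\<^sub>F n in sequentially. dist (\<nu> n) (lim \<mu>) < e\<^sup>2 / 8"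
        by (intro tendstoD) simp_all
      moreover have "\<forall>\<^sub>F n in sequentially. dist (\<mu> n) (lim \<mu>) < e\<^sup>2 / 8"
        using \<mu>_conv \<open>e\<^sup>2 / 8 > 0\<close> by (intro tendstoD) (simp_all add: convergent_LIMSEQ_iff)
      ultimately have "\<forall>\<^sub>F n in sequentially. dist (\<nu> n) (lim \<mu>) < e\<^sup>2 / 8 \<and> dist (\<mu> n) (lim \<mu>) < e\<^sup>2 / 8"
        by (rule eventually_conj)
      then obtain k where k: "\<And>n. n \<ge> k \<Longrightarrow> dist (\<nu> n) (lim \<mu>) < e\<^sup>2 / 8 \<and> dist (\<mu> n) (lim \<mu>) < e\<^sup>2 / 8"
        by (auto simp: eventually_sequentially)
      have "N (\<lambda>x. p m x - p n x) < e" if "m \<ge> k" "n \<ge> k" for m n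
      proof (rule power2_less_imp_less)
        show "(N (\<lambda>x. p m x - p n x))\<^sup>2 < e\<^sup>2"
        proof -
          \<comment> \<open>The limits of \<open>\<mu>\<close> and \<open>\<nu>\<close> agree and
            cancel; the total slack is eight times \<open>e\<^sup>2 / 8\<close>.\<close>
          have "2 * a + 2 * b - 4 * c < e\<^sup>2"
            if "a < lim \<mu> + e\<^sup>2 / 8" "b < lim \<mu> + e\<^sup>2 / 8" "lim \<mu> - e\<^sup>2 / 8 < c" for a b c
            using that by (simp add: field_simps)
          moreover have "\<nu> m < lim \<mu> + e\<^sup>2 / 8"
            using k[OF that(1), THEN conjunct1] unfolding dist_real_def by linarith
          moreover have "\<nu> n < lim \<mu> + e\<^sup>2 / 8"
            using k[OF that(2), THEN conjunct1] unfolding dist_real_def by linarith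
          moreover have "lim \<mu> - e\<^sup>2 / 8 < \<mu> k"
            using k[OF order_refl, THEN conjunct2] unfolding dist_real_def by linarith
          ultimately show ?thesis
            using key[OF that] by (meson le_less_trans)
        qed
      qed (use e in simp)
      then show ?thesis by blast
    qed
    from complete[OF pV this] show ?thesis using that by blast
  qed
  \<comment> \<open>\<open>p n\<close> is a repeated midpoint of far members of the sequence, so
    \<open>f (p n)\<close> has the same limit as \<open>f (v k)\<close>; on the other hand
    \<open>p n\<close> converges to \<open>w\<close> in norm.\<close>
  have mazur: "L = f w" if f: "bounded_functional f" and lim: "(\<lambda>k. f (v k)) \<longlonglongrightarrow> L" for f L
  proof -
    have "(\<lambda>n. f (p n)) \<longlonglongrightarrow> L"
    proof (rule LIMSEQ_I)
      fix e :: real assume e: "e > 0"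
      then obtain n0 where n0: "\<And>n. n \<ge> n0 \<Longrightarrow> \<bar>f (v n) - L\<bar> < e / 2"
        using LIMSEQ_D[OF lim, of "e / 2"] by auto
      have "norm (f (p n) - L) < e" if "n \<ge> n0" for n
      proof -
        have "p n \<in> midpoint_hull (v ` {n0..})"
          using pT[of n] T_mono[OF that] by (auto simp: T_def)
        then have "\<bar>f (p n) - L\<bar> \<le> e / 2"
        proof (rule midpoint_hull_functional[OF f, rotated 2])
          show "v ` {n0..} \<subseteq> V" using v by auto
          show "\<bar>f x - L\<bar> \<le> e / 2" if "x \<in> v ` {n0..}" for x
            using that n0 less_imp_le by auto
        qed
        then show ?thesis using e by simp
      qed
      then show "\<exists>no. \<forall>n\<ge>no. norm (f (p n) - L) < e" by blast
    qed
    then show ?thesis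
      using bounded_functional_tendsto[OF f pV w pw] LIMSEQ_unique by blast
  qed
  \<comment> \<open>The limit \<open>w\<close> is not one of the vectors treated by the diagonal
    argument. Convergence of the inner products extends from the \<open>v m\<close> to their
    midpoint hull, and from there to \<open>w\<close> by approximation.\<close>
  have convBp: "convergent (\<lambda>k. B (v k) q)" if "q \<in> midpoint_hull (range v)" for q
    using that
  proof induction
    case (base q)
    then show ?case using conv_B by auto
  next
    case (midpoint q q')
    have "range v \<subseteq> V" using v by auto
    then have qV: "q \<in> V" "q' \<in> V"
      using midpoint.hyps midpoint_hull_subset by blast+
    have "(\<lambda>k. B (v k) (\<lambda>x. of_real (1/2) * (q x + q' x))) = (\<lambda>k. 1/2 * (B (v k) q + B (v k) q'))"
      unfolding scale_right[OF add_mem[OF qV] v] add_right[OF qV v] ..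
    then show ?case
      using midpoint.IH by (simp only: convergent_mult_const_iff convergent_add)
  qed
  have "Cauchy (\<lambda>k. B (v k) w)"
  proof (rule metric_CauchyI)
    fix e :: real assume e: "e > 0"
    define M' where "M' = \<bar>M\<bar> + 1"
    have M': "M' > 0" "N (v k) \<le> M'" for k
      using bdd[of "r k"] by (auto simp: M'_def v_def)
    obtain n where n: "N (\<lambda>x. p n x - w x) < e / (4 * M')"
      using LIMSEQ_D[OF pw, of "e / (4 * M')"] e M' by (auto simp: abs_less_iff)
    have near: "\<bar>B (v k) (p n) - B (v k) w\<bar> \<le> e / 4" for k
    proof -
      have "\<bar>B (v k) (p n) - B (v k) w\<bar> = \<bar>B (v k) (\<lambda>x. p n x - w x)\<bar>"
        by (simp add: diff_right pV w v)
      also have "\<dots> \<le> N (v k) * N (\<lambda>x. p n x - w x)"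
        by (rule cauchy_schwarz[OF v diff_mem[OF pV w]])
      also have "\<dots> \<le> M' * (e / (4 * M'))"
        using M' n by (intro mult_mono) (auto simp: N_nonneg diff_mem pV w v)
      finally show ?thesis using M' by simp
    qed
    have "p n \<in> midpoint_hull (range v)"
      using pT[of n] midpoint_hull_mono[of "v ` {n..}" "range v"] by (auto simp: T_def)
    then have "Cauchy (\<lambda>k. B (v k) (p n))"
      by (intro convergent_Cauchy convBp)
    then obtain k0 where k0: "\<And>i j. i \<ge> k0 \<Longrightarrow> j \<ge> k0 \<Longrightarrow> \<bar>B (v i) (p n) - B (v j) (p n)\<bar> < e / 4"
      using metric_CauchyD[of "\<lambda>k. B (v k) (p n)" "e / 4"] e unfolding dist_real_def by auto
    have "dist (B (v i) w) (B (v j) w) < e" if "i \<ge> k0" "j \<ge> k0" for i j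
      using k0[OF that] near[of i] near[of j] e unfolding dist_real_def by linarith
    then show "\<exists>k0. \<forall>i\<ge>k0. \<forall>j\<ge>k0. dist (B (v i) w) (B (v j) w) < e" by blast
  qed
  then obtain L where L: "(\<lambda>k. B (v k) w) \<longlonglongrightarrow> L"
    using Cauchy_convergent convergent_def by blast
  have "L = B w w" by (rule mazur[OF bounded_functional_B[OF w] L])
  moreover have "(\<lambda>k. l i (v k)) \<longlonglongrightarrow> l i w" for i
    using mazur[OF l] conv_l[of i] by (auto simp: convergent_def)
  ultimately show ?thesis
    using L r w by (auto simp: v_def N_sq intro!: exI[of _ r] exI[of _ w])
qed

end

section \<open>The space of square integrable functions\<close>

lemma integrable_scaleR_iff:
  fixes g :: "'a \<Rightarrow> 'b :: {banach, second_countable_topology}"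
  assumes "c \<noteq> 0"
  shows "integrable M (\<lambda>x. c *\<^sub>R g x) \<longleftrightarrow> integrable M g"
  using assms integrable_scaleR_right[of "inverse c" M "\<lambda>x. c *\<^sub>R g x"]
    integrable_scaleR_right[of c M g] by auto

lemma borel_measurable_cnj [measurable (raw)]:
  "f \<in> borel_measurable M \<Longrightarrow> (\<lambda>x. cnj (f x)) \<in> borel_measurable M"
  by (rule borel_measurable_continuous_on[of cnj]) (intro continuous_intros)

text \<open>Lebesgue measure is the image of itself under \<open>t + c *\<^sub>R x\<close>, times
  the Jacobian. The integrability claim is an equivalence, so it can be used in both directions of a
  substitution.\<close>

lemma
  fixes t :: "'a::euclidean_space" and c :: real
    and g :: "'a \<Rightarrow> 'b :: {banach, second_countable_topology}"
  assumes c: "c \<noteq> 0"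
  shows integrable_lborel_shift_scale: "g \<in> borel_measurable borel \<Longrightarrow>
      integrable lborel (\<lambda>x. g (t + c *\<^sub>R x)) \<longleftrightarrow> integrable lborel g"
    and integral_lborel_shift_scale: "g \<in> borel_measurable borel \<Longrightarrow>
      (LINT x|lborel. g x) = (\<bar>c\<bar> ^ DIM('a)) *\<^sub>R (LINT x|lborel. g (t + c *\<^sub>R x))"
proof -
  let ?D = "density (distr lborel borel (\<lambda>x. t + c *\<^sub>R x)) (\<lambda>_. \<bar>c\<bar> ^ DIM('a))"
  have eq: "lborel = ?D"
    by (rule lborel_affine[OF c])
  have [measurable]: "(\<lambda>x. t + c *\<^sub>R x) \<in> borel_measurable borel"
    by measurable
  assume [measurable]: "g \<in> borel_measurable borel"
  have "integrable lborel g \<longleftrightarrow> integrable ?D g"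
    using eq by metis
  also have "\<dots> \<longleftrightarrow> integrable (distr lborel borel (\<lambda>x. t + c *\<^sub>R x)) (\<lambda>x. (\<bar>c\<bar> ^ DIM('a)) *\<^sub>R g x)"
    by (rule integrable_density) auto
  also have "\<dots> \<longleftrightarrow> integrable lborel (\<lambda>x. (\<bar>c\<bar> ^ DIM('a)) *\<^sub>R g (t + c *\<^sub>R x))"
    by (rule integrable_distr_eq) auto
  also have "\<dots> \<longleftrightarrow> integrable lborel (\<lambda>x. g (t + c *\<^sub>R x))"
    by (rule integrable_scaleR_iff) (use c in simp)
  finally show "integrable lborel (\<lambda>x. g (t + c *\<^sub>R x)) \<longleftrightarrow> integrable lborel g" ..
  have "(LINT x|lborel. g x) = (LINT x|?D. g x)"
    using eq by metis
  also have "\<dots> = (LINT x|distr lborel borel (\<lambda>x. t + c *\<^sub>R x). (\<bar>c\<bar> ^ DIM('a)) *\<^sub>R g x)"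
    by (rule integral_density) auto
  also have "\<dots> = (LINT x|lborel. (\<bar>c\<bar> ^ DIM('a)) *\<^sub>R g (t + c *\<^sub>R x))"
    by (rule integral_distr) auto
  finally show "(LINT x|lborel. g x) = (\<bar>c\<bar> ^ DIM('a)) *\<^sub>R (LINT x|lborel. g (t + c *\<^sub>R x))"
    by simp
qed

lemma integrable_lborel_shift:
  fixes g :: "'a::euclidean_space \<Rightarrow> 'b :: {banach, second_countable_topology}"
  assumes "g \<in> borel_measurable borel"
  shows "integrable lborel (\<lambda>x. g (x + t)) \<longleftrightarrow> integrable lborel g"
    and "(LINT x|lborel. g (x + t)) = (LINT x|lborel. g x)"
    and "integrable lborel (\<lambda>x. g (x - t)) \<longleftrightarrow> integrable lborel g"
    and "(LINT x|lborel. g (x - t)) = (LINT x|lborel. g x)"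
    and "integrable lborel (\<lambda>x. g (t - x)) \<longleftrightarrow> integrable lborel g"
    and "(LINT x|lborel. g (t - x)) = (LINT x|lborel. g x)"
  using integrable_lborel_shift_scale[of 1 g t] integral_lborel_shift_scale[of 1 g t]
    integrable_lborel_shift_scale[of 1 g "-t"] integral_lborel_shift_scale[of 1 g "-t"]
    integrable_lborel_shift_scale[of "-1" g t] integral_lborel_shift_scale[of "-1" g t] assms
  by (simp_all add: add.commute)

text \<open>As a Bochner integral this is 0, not infinite, when the square is not integrable; hence
  membership in \<open>L2\<close> accompanies every estimate.\<close>

definition l2 :: "('a::euclidean_space \<Rightarrow> complex) \<Rightarrow> real" where
  "l2 f = sqrt (LINT x|lborel. (cmod (f x))\<^sup>2)"

section \<open>Membership, norm and inner product\<close>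

lemma L2_measurable [measurable_dest]: "f \<in> L2 \<Longrightarrow> f \<in> borel_measurable borel"
  by (simp add: L2_def)

lemma L2_integrable: "f \<in> L2 \<Longrightarrow> integrable lborel (\<lambda>x. (cmod (f x))\<^sup>2)"
  by (simp add: L2_def)

lemma L2I:
  "f \<in> borel_measurable borel \<Longrightarrow> integrable lborel (\<lambda>x. (cmod (f x))\<^sup>2) \<Longrightarrow> f \<in> L2"
  by (simp add: L2_def)

lemma l2_nonneg [simp]: "0 \<le> l2 f"
  by (simp add: l2_def)

lemma l2_sq: "(l2 f)\<^sup>2 = (LINT x|lborel. (cmod (f x))\<^sup>2)"
  by (simp add: l2_def)

lemma l2_cong_AE:
  assumes "f \<in> borel_measurable borel" "g \<in> borel_measurable borel" "AE x in lborel. f x = g x"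
  shows "l2 f = l2 g"
  unfolding l2_def using assms by (intro arg_cong[where f = sqrt] integral_cong_AE) auto

lemma L2_cong_AE:
  assumes "f \<in> L2" "g \<in> borel_measurable borel" "AE x in lborel. f x = g x"
  shows "g \<in> L2"
proof (rule L2I)
  have [measurable]: "f \<in> borel_measurable borel" "g \<in> borel_measurable borel"
    using assms L2_measurable by auto
  show "integrable lborel (\<lambda>x. (cmod (g x))\<^sup>2)"
    by (rule integrable_cong_AE_imp[OF L2_integrable[OF assms(1)]]) (use assms in auto)
qed fact

lemma nn_integral_l2: "f \<in> L2 \<Longrightarrow> (\<integral>\<^sup>+x. ennreal ((cmod (f x))\<^sup>2) \<partial>lborel) = ennreal ((l2 f)\<^sup>2)"
  by (simp add: l2_sq nn_integral_eq_integral L2_integrable)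

text \<open>The nonnegative integral is infinite if the square is not integrable, so a finite bound
  gives membership as well as the norm estimate. Fatou's lemma delivers bounds of this form.\<close>

lemma L2_nn_bound:
  assumes [measurable]: "f \<in> borel_measurable borel"
    and le: "(\<integral>\<^sup>+x. ennreal ((cmod (f x))\<^sup>2) \<partial>lborel) \<le> ennreal (c\<^sup>2)" and "0 \<le> c"
  shows "f \<in> L2" and "l2 f \<le> c"
proof -
  show f: "f \<in> L2"
  proof (rule L2I)
    show "integrable lborel (\<lambda>x. (cmod (f x))\<^sup>2)"
      using le by (intro integrableI_bounded) (auto simp: order_le_less_trans[OF _ ennreal_less_top])
  qed measurable
  have "(l2 f)\<^sup>2 \<le> c\<^sup>2"
    using le by (simp add: nn_integral_l2[OF f])
  then show "l2 f \<le> c"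
    using \<open>0 \<le> c\<close> by (rule power2_le_imp_le)
qed

lemma cmod_add_sq_le: "(cmod (a + b))\<^sup>2 \<le> 2 * (cmod a)\<^sup>2 + 2 * (cmod b)\<^sup>2"
proof -
  have "(cmod (a + b))\<^sup>2 \<le> (cmod a + cmod b)\<^sup>2"
    by (intro power_mono norm_triangle_ineq) simp
  also have "\<dots> \<le> 2 * (cmod a)\<^sup>2 + 2 * (cmod b)\<^sup>2"
    using sum_squares_bound[of "cmod a" "cmod b"] by (simp add: power2_sum)
  finally show ?thesis .
qed

lemma L2_add: 
  assumes f: "f \<in> L2" and g: "g \<in> L2" shows "(\<lambda>x. f x + g x) \<in> L2"
proof (rule L2I)
  note [measurable] = L2_measurable[OF f] L2_measurable[OF g]
  show "(\<lambda>x. f x + g x) \<in> borel_measurable borel" by measurable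
  show "integrable lborel (\<lambda>x. (cmod (f x + g x))\<^sup>2)"
    by (rule Bochner_Integration.integrable_bound[of _ "\<lambda>x. 2 * (cmod (f x))\<^sup>2 + 2 * (cmod (g x))\<^sup>2"])
      (use cmod_add_sq_le in \<open>auto intro!: Bochner_Integration.integrable_add integrable_mult_right L2_integrable f g\<close>)
qed

lemma L2_bounded_mult:
  assumes f: "f \<in> L2" and [measurable]: "h \<in> borel_measurable borel" and b: "\<And>x. cmod (h x) \<le> C"
  shows "(\<lambda>x. h x * f x) \<in> L2" and "l2 (\<lambda>x. h x * f x) \<le> C * l2 f"
proof -
  note [measurable] = L2_measurable[OF f]
  have C: "0 \<le> C" using b order_trans[OF norm_ge_zero] by blast
  have le: "(cmod (h x * f x))\<^sup>2 \<le> C\<^sup>2 * (cmod (f x))\<^sup>2" for x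
    unfolding norm_mult power_mult_distrib by (intro mult_right_mono power_mono b) auto
  have int: "integrable lborel (\<lambda>x. C\<^sup>2 * (cmod (f x))\<^sup>2)"
    by (intro integrable_mult_right L2_integrable f)
  show 1: "(\<lambda>x. h x * f x) \<in> L2"
  proof (rule L2I)
    show "integrable lborel (\<lambda>x. (cmod (h x * f x))\<^sup>2)"
      by (rule Bochner_Integration.integrable_bound[OF int]) (use le in auto)
  qed measurable
  have "(l2 (\<lambda>x. h x * f x))\<^sup>2 \<le> (C * l2 f)\<^sup>2"
    unfolding power_mult_distrib l2_sq Bochner_Integration.integral_mult_right_zero[symmetric]
    by (intro integral_mono int L2_integrable[OF 1] le)
  then show "l2 (\<lambda>x. h x * f x) \<le> C * l2 f"
    by (rule power2_le_imp_le) (simp add: C)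
qed

lemma L2_cmult: "f \<in> L2 \<Longrightarrow> (\<lambda>x. c * f x) \<in> L2"
  by (rule L2_bounded_mult[where C = "cmod c"]) auto

lemma l2_cmult: "l2 (\<lambda>x. c * f x) = cmod c * l2 f"
  by (simp add: l2_def norm_mult power_mult_distrib real_sqrt_mult)

lemma L2_diff: "f \<in> L2 \<Longrightarrow> g \<in> L2 \<Longrightarrow> (\<lambda>x. f x - g x) \<in> L2"
  using L2_add[of f "\<lambda>x. (-1) * g x"] L2_cmult[of g "-1"] by simp

lemma L2_cnj: "f \<in> L2 \<Longrightarrow> (\<lambda>x. cnj (f x)) \<in> L2"
  and l2_cnj: "l2 (\<lambda>x. cnj (f x)) = l2 f"
  by (auto intro!: L2I simp: L2_integrable L2_measurable l2_def)

lemma L2_mult_integrable: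
  assumes f: "f \<in> L2" and g: "g \<in> L2"
  shows "integrable lborel (\<lambda>x. f x * g x)"
proof -
  note [measurable] = L2_measurable[OF f] L2_measurable[OF g]
  have "cmod (f x) * cmod (g x) \<le> (cmod (f x))\<^sup>2 + (cmod (g x))\<^sup>2" for x
    using sum_squares_bound[of "cmod (f x)" "cmod (g x)"] zero_le_power2[of "cmod (f x)"]
      zero_le_power2[of "cmod (g x)"] mult_nonneg_nonneg[OF norm_ge_zero norm_ge_zero, of "f x" "g x"]
    by linarith
  then show ?thesis
    by (intro Bochner_Integration.integrable_bound[OF Bochner_Integration.integrable_add[OF L2_integrable[OF f] L2_integrable[OF g]]])
      (auto simp: norm_mult)
qed

interpretation L2: semi_inner L2 "\<lambda>f g. Re (LINT x|lborel. f x * cnj (g x))"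
proof (unfold_locales, goal_cases)
  case (3 f g)
  have "(LINT x|lborel. g x * cnj (f x)) = cnj (LINT x|lborel. f x * cnj (g x))"
    by (subst Bochner_Integration.integral_cnj[symmetric]) (simp add: mult.commute)
  then show ?case by simp
next
  case (4 f g h)
  then show ?case
    by (simp add: ring_distribs L2_mult_integrable L2_cnj)
next
  case (5 f g c)
  have "(LINT x|lborel. of_real c * f x * cnj (g x)) = of_real c * (LINT x|lborel. f x * cnj (g x))"
    by (simp add: mult.assoc)
  then show ?case by simp
next
  case (6 f)
  have "(LINT x|lborel. f x * cnj (f x)) = of_real (LINT x|lborel. (cmod (f x))\<^sup>2)"
    unfolding integral_complex_of_real[symmetric] complex_norm_square ..
  then show ?case by simp
qed (auto intro: L2_add L2_cmult)

lemma L2_N: "L2.N f = l2 f"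
proof -
  have "(LINT x|lborel. f x * cnj (f x)) = of_real (LINT x|lborel. (cmod (f x))\<^sup>2)"
    unfolding integral_complex_of_real[symmetric] complex_norm_square ..
  then show ?thesis by (simp add: L2.N_def l2_def)
qed

lemmas l2_triangle = L2.N_triangle[unfolded L2_N]
lemmas l2_diff_triangle = L2.N_diff_triangle[unfolded L2_N]
lemmas l2_minus_commute = L2.N_minus_commute[unfolded L2_N]
lemmas l2_diff_bound = L2.N_diff_bound[unfolded L2_N]

text \<open>Applying the abstract inequality to the moduli puts the absolute values inside the
  integral; the bound for the product follows.\<close>

lemma L2_cauchy_schwarz:
  assumes f: "f \<in> L2" and g: "g \<in> L2"
  shows "(LINT x|lborel. cmod (f x) * cmod (g x)) \<le> l2 f * l2 g"
    and "cmod (LINT x|lborel. f x * g x) \<le> l2 f * l2 g"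
proof -
  note [measurable] = L2_measurable[OF f] L2_measurable[OF g]
  let ?f = "\<lambda>x. complex_of_real (cmod (f x))" and ?g = "\<lambda>x. complex_of_real (cmod (g x))"
  have "?f \<in> L2" "?g \<in> L2"
    using f g by (simp_all add: L2_def)
  from L2.cauchy_schwarz[OF this]
  have "\<bar>Re (LINT x|lborel. of_real (cmod (f x) * cmod (g x)))\<bar> \<le> l2 f * l2 g"
    by (simp add: L2_N l2_def)
  then show 1: "(LINT x|lborel. cmod (f x) * cmod (g x)) \<le> l2 f * l2 g"
    unfolding integral_complex_of_real by simp
  have "cmod (LINT x|lborel. f x * g x) \<le> (LINT x|lborel. cmod (f x * g x))"
    by (rule integral_norm_bound)
  then show "cmod (LINT x|lborel. f x * g x) \<le> l2 f * l2 g"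
    using 1 by (simp add: norm_mult)
qed

lemma L2_eq_0_AE:
  assumes f: "f \<in> L2" and "l2 f = 0" shows "AE x in lborel. f x = 0"
proof -
  have "(LINT x|lborel. (cmod (f x))\<^sup>2) = 0"
    using assms(2) by (simp add: l2_def)
  then show ?thesis
    by (subst (asm) integral_nonneg_eq_0_iff_AE[OF L2_integrable[OF f]]) auto
qed

section \<open>Limits and completeness\<close>

lemma L2_limit_AE_unique:
  assumes s: "\<And>n. s n \<in> L2" and f: "f \<in> L2" and g: "g \<in> L2"
    and sf: "(\<lambda>n. l2 (\<lambda>x. s n x - f x)) \<longlonglongrightarrow> 0" and sg: "(\<lambda>n. l2 (\<lambda>x. s n x - g x)) \<longlonglongrightarrow> 0"
  shows "AE x in lborel. f x = g x"
proof -
  have "l2 (\<lambda>x. f x - g x) \<le> 0"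
  proof (rule LIMSEQ_le_const)
    show "(\<lambda>n. l2 (\<lambda>x. s n x - f x) + l2 (\<lambda>x. s n x - g x)) \<longlonglongrightarrow> 0"
      using tendsto_add[OF sf sg] by simp
    show "\<exists>N. \<forall>n\<ge>N. l2 (\<lambda>x. f x - g x) \<le> l2 (\<lambda>x. s n x - f x) + l2 (\<lambda>x. s n x - g x)"
      using l2_diff_triangle[OF f s g] by (simp add: l2_minus_commute[OF s f])
  qed
  then have "l2 (\<lambda>x. f x - g x) = 0"
    using l2_nonneg[of "\<lambda>x. f x - g x"] by linarith
  then show ?thesis
    using L2_eq_0_AE[OF L2_diff[OF f g]] by simp
qed

lemma L2_tendsto_AE_subseq:
  assumes s: "\<And>n. s n \<in> L2" and f: "f \<in> L2" and sf: "(\<lambda>n. l2 (\<lambda>x. s n x - f x)) \<longlonglongrightarrow> 0"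
  shows "\<exists>r::nat\<Rightarrow>nat. strict_mono r \<and> (AE x in lborel. (\<lambda>n. s (r n) x) \<longlonglongrightarrow> f x)"
proof -
  have "(\<lambda>n. (l2 (\<lambda>x. s n x - f x))\<^sup>2) \<longlonglongrightarrow> 0"
    using tendsto_power[OF sf, of 2] by simp
  then have "(\<lambda>n. LINT x|lborel. norm ((cmod (s n x - f x))\<^sup>2)) \<longlonglongrightarrow> 0"
    by (simp add: l2_sq)
  from tendsto_L1_AE_subseq[OF L2_integrable[OF L2_diff[OF s f]] this]
  obtain r :: "nat \<Rightarrow> nat" where r: "strict_mono r" and ae: "AE x in lborel. (\<lambda>n. (cmod (s (r n) x - f x))\<^sup>2) \<longlonglongrightarrow> 0"
    by blast
  have imp: "(\<lambda>n. s (r n) x) \<longlonglongrightarrow> f x" if "(\<lambda>n. (cmod (s (r n) x - f x))\<^sup>2) \<longlonglongrightarrow> 0" for x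
  proof -
    have "(\<lambda>n. sqrt ((cmod (s (r n) x - f x))\<^sup>2)) \<longlonglongrightarrow> sqrt 0"
      using that by (rule tendsto_real_sqrt)
    then have "(\<lambda>n. s (r n) x - f x) \<longlonglongrightarrow> 0"
      by (simp add: tendsto_norm_zero_iff)
    then show ?thesis by (simp add: LIM_zero_iff)
  qed
  have "AE x in lborel. (\<lambda>n. s (r n) x) \<longlonglongrightarrow> f x"
    by (rule eventually_mono[OF ae imp])
  with r show ?thesis by blast
qed

text \<open>A subsequence with rapidly decreasing increments converges almost everywhere, since
  the series of \<open>2\<^sup>k\<close> times its squared increments is integrable; Fatou's lemma then gives
  convergence in norm.\<close>

lemma L2_complete:
  fixes s :: "nat \<Rightarrow> 'a::euclidean_space \<Rightarrow> complex"
  assumes s: "\<And>n. s n \<in> L2"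
    and cauchy: "\<And>e. e > 0 \<Longrightarrow> \<exists>n0. \<forall>m\<ge>n0. \<forall>n\<ge>n0. l2 (\<lambda>x. s m x - s n x) < e"
  shows "\<exists>f\<in>L2. (\<lambda>n. l2 (\<lambda>x. s n x - f x)) \<longlonglongrightarrow> 0"
proof -
  note [measurable] = L2_measurable[OF s]
  obtain n0 where n0: "\<And>k m n. m \<ge> n0 k \<Longrightarrow> n \<ge> n0 k \<Longrightarrow> l2 (\<lambda>x. s m x - s n x) < (1/2) ^ k"
    using cauchy[of "(1/2) ^ k" for k] by (metis zero_less_power half_gt_zero_iff zero_less_one)
  \<comment> \<open>Each index exceeds the previous one and also the Cauchy threshold
    \<open>n0\<close> for the accuracy \<open>(1/2) ^ k\<close>.\<close>
  define r where "r = rec_nat (n0 0) (\<lambda>k m. max (Suc m) (n0 (Suc k)))"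
  have r_Suc: "r (Suc k) = max (Suc (r k)) (n0 (Suc k))" and r_0: "r 0 = n0 0" for k
    by (simp_all add: r_def)
  have r_mono: "strict_mono r"
    by (simp add: strict_mono_Suc_iff r_Suc less_max_iff_disj)
  have r_ge: "n0 k \<le> r k" for k
    by (cases k) (simp_all add: r_Suc r_0)
  define d where "d k x = s (r (Suc k)) x - s (r k) x" for k x
  have d: "d k \<in> L2" for k
    unfolding d_def by (intro L2_diff s)
  note [measurable] = L2_measurable[OF d]
  have d_le: "l2 (d k) \<le> (1/2) ^ k" for k
    unfolding d_def using r_mono[THEN strict_mono_mono, THEN monoD, of k "Suc k"] r_ge[of k]
    by (auto intro!: less_imp_le[OF n0])
  have "(\<integral>\<^sup>+x. (\<Sum>k. ennreal (2 ^ k * (cmod (d k x))\<^sup>2)) \<partial>lborel) = (\<Sum>k. \<integral>\<^sup>+x. ennreal (2 ^ k * (cmod (d k x))\<^sup>2) \<partial>lborel)"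
    by (rule nn_integral_suminf) auto
  also have "\<dots> = (\<Sum>k. ennreal (2 ^ k * (l2 (d k))\<^sup>2))"
    by (simp add: ennreal_mult nn_integral_cmult nn_integral_l2 d)
  also have "\<dots> \<le> (\<Sum>k. ennreal ((1/2) ^ k))"
  proof (intro suminf_le ennreal_leI summableI)
    fix k
    \<comment> \<open>The weight \<open>2 ^ k\<close> costs only one of the two factors
      \<open>(1/2) ^ k\<close> in the squared increment.\<close>
    have "2 ^ k * (l2 (d k))\<^sup>2 \<le> 2 ^ k * ((1/2) ^ k)\<^sup>2"
      by (intro mult_left_mono power_mono d_le) auto
    also have "\<dots> = (1/2::real) ^ k"
      by (simp add: power2_eq_square power_one_over)
    finally show "2 ^ k * (l2 (d k))\<^sup>2 \<le> (1/2) ^ k" .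
  qed
  also have "\<dots> < \<infinity>"
    by (subst suminf_ennreal2) (auto simp: summable_geometric)
  finally have ae: "AE x in lborel. (\<Sum>k. ennreal (2 ^ k * (cmod (d k x))\<^sup>2)) \<noteq> \<infinity>"
    by (intro nn_integral_PInf_AE) auto
  have imp: "convergent (\<lambda>k. s (r k) x)" if fin: "(\<Sum>k. ennreal (2 ^ k * (cmod (d k x))\<^sup>2)) \<noteq> \<infinity>" for x
  proof -
    have "summable (\<lambda>k. 2 ^ k * (cmod (d k x))\<^sup>2)"
      using fin by (intro summable_suminf_not_top) auto
    then have "bounded (range (\<lambda>k. 2 ^ k * (cmod (d k x))\<^sup>2))"
      using summable_LIMSEQ_zero convergent_imp_bounded by blast
    then obtain C where C: "\<And>k. 2 ^ k * (cmod (d k x))\<^sup>2 \<le> C"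
      unfolding bounded_iff by (auto simp: abs_le_iff)
    \<comment> \<open>A bounded weighted square makes the increment itself decay geometrically with
      ratio \<open>sqrt (1/2)\<close>, so the telescoping series converges absolutely.\<close>
    have d_bound: "norm (d k x) \<le> sqrt C * sqrt (1/2) ^ k" for k
    proof -
      have "(cmod (d k x))\<^sup>2 \<le> C * (1/2) ^ k"
        using C[of k] by (simp add: field_simps)
      then have "sqrt ((cmod (d k x))\<^sup>2) \<le> sqrt (C * (1/2) ^ k)"
        by (rule real_sqrt_le_mono)
      then show ?thesis by (simp add: real_sqrt_mult real_sqrt_power)
    qed
    have "summable (\<lambda>k. sqrt C * sqrt (1/2) ^ k)"
      by (intro summable_mult summable_geometric) (simp add: real_sqrt_lt_1_iff)
    then have "summable (\<lambda>k. d k x)"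
      by (rule summable_comparison_test') (rule d_bound)
    then have "convergent (\<lambda>n. \<Sum>k<n. d k x)"
      by (simp add: summable_iff_convergent)
    moreover have "(\<Sum>k<n. d k x) = s (r n) x - s (r 0) x" for n
      unfolding d_def by (rule sum_lessThan_telescope)
    ultimately have "convergent (\<lambda>n. s (r n) x - s (r 0) x + s (r 0) x)"
      by (intro convergent_add convergent_const) simp
    then show ?thesis by simp
  qed
  have ae: "AE x in lborel. convergent (\<lambda>k. s (r k) x)"
    by (rule eventually_mono[OF ae imp])
  define f where "f x = lim (\<lambda>k. s (r k) x)" for x
  have [measurable]: "f \<in> borel_measurable borel"
    unfolding f_def by (rule borel_measurable_lim_metric) measurable
  have lim: "AE x in lborel. (\<lambda>k. s (r k) x) \<longlonglongrightarrow> f x"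
    using ae by eventually_elim (simp add: f_def convergent_LIMSEQ_iff)
  have bound: "(\<integral>\<^sup>+x. ennreal ((cmod (s n x - f x))\<^sup>2) \<partial>lborel) \<le> ennreal (((1/2) ^ j)\<^sup>2)" if n: "n \<ge> n0 j" for n j
  proof -
    have "(\<integral>\<^sup>+x. ennreal ((cmod (s n x - f x))\<^sup>2) \<partial>lborel)
      = (\<integral>\<^sup>+x. liminf (\<lambda>k. ennreal ((cmod (s n x - s (r k) x))\<^sup>2)) \<partial>lborel)"
    proof (rule nn_integral_cong_AE)
      show "AE x in lborel. ennreal ((cmod (s n x - f x))\<^sup>2) = liminf (\<lambda>k. ennreal ((cmod (s n x - s (r k) x))\<^sup>2))"
        using lim
      proof eventually_elim
        case (elim x)
        then have "(\<lambda>k. ennreal ((cmod (s n x - s (r k) x))\<^sup>2)) \<longlonglongrightarrow> ennreal ((cmod (s n x - f x))\<^sup>2)"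
          by (intro tendsto_ennrealI tendsto_intros)
        then show ?case
          by (intro lim_imp_Liminf[symmetric]) auto
      qed
    qed
    also have "\<dots> \<le> liminf (\<lambda>k. \<integral>\<^sup>+x. ennreal ((cmod (s n x - s (r k) x))\<^sup>2) \<partial>lborel)"
      by (rule nn_integral_liminf) auto
    also have "\<dots> \<le> limsup (\<lambda>k. \<integral>\<^sup>+x. ennreal ((cmod (s n x - s (r k) x))\<^sup>2) \<partial>lborel)"
      by (rule Liminf_le_Limsup) simp
    also have "\<dots> \<le> ennreal (((1/2) ^ j)\<^sup>2)"
    proof (rule Limsup_bounded)
      show "\<forall>\<^sub>F k in sequentially. (\<integral>\<^sup>+x. ennreal ((cmod (s n x - s (r k) x))\<^sup>2) \<partial>lborel) \<le> ennreal (((1/2) ^ j)\<^sup>2)"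
        using eventually_ge_at_top[of "n0 j"]
      proof eventually_elim
        case (elim k)
        then have "n0 j \<le> r k"
          using strict_mono_imp_increasing[OF r_mono, of k] by simp
        then have "l2 (\<lambda>x. s n x - s (r k) x) \<le> (1/2) ^ j"
          using n n0[of j n "r k"] by simp
        then show ?case
          by (simp only: nn_integral_l2[OF L2_diff[OF s s]]) (intro ennreal_leI power_mono, auto)
      qed
    qed
    finally show ?thesis .
  qed
  have diff: "(\<lambda>x. s n x - f x) \<in> L2" "l2 (\<lambda>x. s n x - f x) \<le> (1/2) ^ j" if n: "n \<ge> n0 j" for n j
    using L2_nn_bound[OF _ bound[OF n]] by auto
  \<comment> \<open>Fatou's lemma controls only the differences; the limit is recovered by
    subtracting such a difference from a member of the sequence.\<close>
  have "(\<lambda>x. s (n0 0) x - (s (n0 0) x - f x)) \<in> L2"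
    by (intro L2_diff s diff(1)[of 0]) simp
  then have f: "f \<in> L2" by simp
  have "(\<lambda>n. l2 (\<lambda>x. s n x - f x)) \<longlonglongrightarrow> 0"
  proof (rule LIMSEQ_I)
    fix e :: real assume "e > 0"
    then obtain j where j: "(1/2::real) ^ j < e"
      using real_arch_pow_inv[of e "1/2"] by auto
    have "norm (l2 (\<lambda>x. s n x - f x) - 0) < e" if "n \<ge> n0 j" for n
      using diff(2)[OF that] j by simp
    then show "\<exists>no. \<forall>n\<ge>no. norm (l2 (\<lambda>x. s n x - f x) - 0) < e" by blast
  qed
  with f show ?thesis by blast
qed

section \<open>Translations, truncations and products\<close>

lemma L2_shift:
  assumes f: "f \<in> L2"
  shows "(\<lambda>x. f (x - y)) \<in> L2" and "l2 (\<lambda>x. f (x - y)) = l2 f"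
    and "(\<lambda>x. f (x + y)) \<in> L2" and "l2 (\<lambda>x. f (x + y)) = l2 f"
proof -
  note [measurable] = L2_measurable[OF f]
  note shift = integrable_lborel_shift[of "\<lambda>x. (cmod (f x))\<^sup>2" y]
  show "(\<lambda>x. f (x - y)) \<in> L2" "(\<lambda>x. f (x + y)) \<in> L2"
    by (auto intro!: L2I simp: shift L2_integrable[OF f])
  show "l2 (\<lambda>x. f (x - y)) = l2 f" "l2 (\<lambda>x. f (x + y)) = l2 f"
    by (simp_all add: l2_def shift)
qed

text \<open>A truncation is the product of two square integrable functions, hence integrable; the
  convergence is dominated by the square of \<open>f\<close>. These are the approximants in the
  definition of the Fourier transform.\<close>

lemma L2_truncation:
  assumes f: "f \<in> L2"
  defines "t \<equiv> \<lambda>(n::nat) x. indicator (cball 0 (real n)) x * f x"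
  shows "t n \<in> L2" and "integrable lborel (t n)" and "(\<lambda>n. l2 (\<lambda>x. t n x - f x)) \<longlonglongrightarrow> 0"
proof -
  note [measurable] = L2_measurable[OF f]
  show t: "t n \<in> L2" for n
    unfolding t_def by (rule L2_bounded_mult[OF f, where C = 1]) (auto simp: indicator_def)
  have ind: "(indicator (cball 0 (real n)) :: 'a \<Rightarrow> complex) \<in> L2" for n
  proof (rule L2I)
    have "emeasure lborel (cball (0::'a) (real n)) < \<infinity>"
      by (rule emeasure_lborel_cball_finite)
    then have "integrable lborel (indicator (cball 0 (real n)) :: 'a \<Rightarrow> real)"
      by (intro integrable_real_indicator) auto
    moreover have "(cmod (indicator (cball 0 (real n)) x))\<^sup>2 = indicator (cball 0 (real n)) x" for x :: 'a
      by (simp add: indicator_def)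
    ultimately show "integrable lborel (\<lambda>x::'a. (cmod (indicator (cball 0 (real n)) x))\<^sup>2)"
      by simp
  qed (intro borel_measurable_indicator, simp)
  show "integrable lborel (t n)" for n
    unfolding t_def by (rule L2_mult_integrable[OF ind f])
  have "(\<lambda>n. LINT x|lborel. (cmod (t n x - f x))\<^sup>2) \<longlonglongrightarrow> (LINT x::'a|lborel. 0 :: real)"
  proof (intro integral_dominated_convergence)
    show "integrable lborel (\<lambda>x. (cmod (f x))\<^sup>2)"
      by (rule L2_integrable[OF f])
    show "AE x in lborel. (\<lambda>n. (cmod (t n x - f x))\<^sup>2) \<longlonglongrightarrow> 0"
    proof (rule AE_I2)
      fix x :: 'a
      obtain k :: nat where k: "norm x \<le> real k" using real_arch_simple by blast
      have "\<forall>\<^sub>F n in sequentially. (cmod (t n x - f x))\<^sup>2 = 0"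
        using eventually_ge_at_top[of k] by eventually_elim (use k in \<open>auto simp: t_def indicator_def\<close>)
      then show "(\<lambda>n. (cmod (t n x - f x))\<^sup>2) \<longlonglongrightarrow> 0"
        by (rule tendsto_eventually)
    qed
  qed (auto simp: t_def indicator_def L2_integrable[OF f])
  then have "(\<lambda>n. sqrt (LINT x|lborel. (cmod (t n x - f x))\<^sup>2)) \<longlonglongrightarrow> sqrt 0"
    by (intro tendsto_real_sqrt) simp
  then show "(\<lambda>n. l2 (\<lambda>x. t n x - f x)) \<longlonglongrightarrow> 0"
    by (simp add: l2_def)
qed

lemma borel_measurable_cis [measurable (raw)]:
  "f \<in> borel_measurable M \<Longrightarrow> (\<lambda>x. cis (f x)) \<in> borel_measurable M"
  by (rule borel_measurable_continuous_on[of cis]) (intro continuous_intros)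

lemma l2_tendsto_0I:
  assumes "(\<lambda>n. (l2 (f n))\<^sup>2) \<longlonglongrightarrow> 0" shows "(\<lambda>n. l2 (f n)) \<longlonglongrightarrow> 0"
  using tendsto_real_sqrt[OF assms] by simp

text \<open>The difference of the products is \<open>(u n - f) * v n + f * (v n - g)\<close>, to
  which Cauchy-Schwarz applies.\<close>

lemma L2_mult_tendsto:
  fixes f g :: "'a::euclidean_space \<Rightarrow> complex"
  assumes u: "\<And>n. u n \<in> L2" and v: "\<And>n. v n \<in> L2" and f: "f \<in> L2" and g: "g \<in> L2"
    and uf: "(\<lambda>n. l2 (\<lambda>x. u n x - f x)) \<longlonglongrightarrow> 0" and vg: "(\<lambda>n. l2 (\<lambda>x. v n x - g x)) \<longlonglongrightarrow> 0"
  shows "(\<lambda>n. LINT x|lborel. u n x * v n x) \<longlonglongrightarrow> (LINT x|lborel. f x * g x)"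
proof -
  have "(\<lambda>n. (LINT x|lborel. u n x * v n x) - (LINT x|lborel. f x * g x)) \<longlonglongrightarrow> 0"
  proof (rule Lim_null_comparison)
    show "(\<lambda>n. l2 (\<lambda>x. u n x - f x) * (l2 (\<lambda>x. v n x - g x) + l2 g) + l2 f * l2 (\<lambda>x. v n x - g x)) \<longlonglongrightarrow> 0"
      using tendsto_add[OF tendsto_mult[OF uf tendsto_add[OF vg tendsto_const[of "l2 g"]]]
        tendsto_mult[OF tendsto_const[of "l2 f"] vg]] by simp
    have "norm ((LINT x|lborel. u n x * v n x) - (LINT x|lborel. f x * g x))
        \<le> l2 (\<lambda>x. u n x - f x) * (l2 (\<lambda>x. v n x - g x) + l2 g) + l2 f * l2 (\<lambda>x. v n x - g x)" for n
    proof -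
      have "(LINT x|lborel. u n x * v n x) - (LINT x|lborel. f x * g x)
        = (LINT x|lborel. (u n x - f x) * v n x) + (LINT x|lborel. f x * (v n x - g x))"
        by (simp add: left_diff_distrib right_diff_distrib L2_mult_integrable u v f g)
      also have "norm \<dots> \<le> l2 (\<lambda>x. u n x - f x) * l2 (v n) + l2 f * l2 (\<lambda>x. v n x - g x)"
        by (rule norm_triangle_le[OF add_mono[OF L2_cauchy_schwarz(2) L2_cauchy_schwarz(2)]])
          (intro L2_diff u v f g)+
      also have "l2 (v n) \<le> l2 (\<lambda>x. v n x - g x) + l2 g"
        using l2_triangle[OF L2_diff[OF v g] g] by simp
      finally show ?thesis
        by (simp add: mult_left_mono)
    qed
    then show "\<forall>\<^sub>F n in sequentially. norm ((LINT x|lborel. u n x * v n x) - (LINT x|lborel. f x * g x))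
        \<le> l2 (\<lambda>x. u n x - f x) * (l2 (\<lambda>x. v n x - g x) + l2 g) + l2 f * l2 (\<lambda>x. v n x - g x)"
      by simp
  qed
  then show ?thesis by (simp add: LIM_zero_iff)
qed

section \<open>Continuity of translations\<close>

text \<open>Membership in \<open>L2\<close> is included so that the class can be built up from
  indicators by linear combinations and limits.\<close>

definition shift_continuous :: "('a::euclidean_space \<Rightarrow> complex) \<Rightarrow> bool" where
  "shift_continuous f \<longleftrightarrow> f \<in> L2 \<and>
     (\<forall>z. z \<longlonglongrightarrow> 0 \<longrightarrow> (\<lambda>k::nat. l2 (\<lambda>x. f (x - z k) - f x)) \<longlonglongrightarrow> 0)"

text \<open>A three-epsilon argument: translation is an isometry, so the two approximation errors
  are equal and do not depend on the translation.\<close>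

lemma shift_continuous_limit:
  assumes s: "\<And>n. shift_continuous (s n)" and f: "f \<in> L2"
    and lim: "(\<lambda>n::nat. l2 (\<lambda>x. s n x - f x)) \<longlonglongrightarrow> 0"
  shows "shift_continuous f"
  unfolding shift_continuous_def
proof (intro conjI allI impI f)
  fix z :: "nat \<Rightarrow> 'a" assume z: "z \<longlonglongrightarrow> 0"
  have sL: "s n \<in> L2" for n using s by (auto simp: shift_continuous_def)
  show "(\<lambda>k. l2 (\<lambda>x. f (x - z k) - f x)) \<longlonglongrightarrow> 0"
  proof (rule LIMSEQ_I)
    fix e :: real assume e: "e > 0"
    then obtain n where n: "l2 (\<lambda>x. s n x - f x) < e / 3"
      using LIMSEQ_D[OF lim, of "e / 3"] by auto
    have "(\<lambda>k. l2 (\<lambda>x. s n (x - z k) - s n x)) \<longlonglongrightarrow> 0"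
      using s[of n] z by (auto simp: shift_continuous_def)
    then obtain k0 where k0: "\<And>k. k \<ge> k0 \<Longrightarrow> l2 (\<lambda>x. s n (x - z k) - s n x) < e / 3"
      using LIMSEQ_D[of _ 0 "e / 3"] e by fastforce
    have "norm (l2 (\<lambda>x. f (x - z k) - f x) - 0) < e" if "k \<ge> k0" for k
    proof -
      note sh = L2_shift(1)[OF f, of "z k"] L2_shift(1)[OF sL[of n], of "z k"]
      have "l2 (\<lambda>x. f (x - z k) - f x) \<le> l2 (\<lambda>x. f (x - z k) - s n (x - z k)) + l2 (\<lambda>x. s n (x - z k) - f x)"
        by (rule l2_diff_triangle[OF sh f])
      also have "l2 (\<lambda>x. s n (x - z k) - f x) \<le> l2 (\<lambda>x. s n (x - z k) - s n x) + l2 (\<lambda>x. s n x - f x)"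
        by (rule l2_diff_triangle[OF sh(2) sL f])
      also have "l2 (\<lambda>x. f (x - z k) - s n (x - z k)) = l2 (\<lambda>x. s n x - f x)"
        using L2_shift(2)[OF L2_diff[OF f sL[of n]], of "z k"] l2_minus_commute[OF f sL] by simp
      finally show ?thesis
        using n k0[OF that] by simp
    qed
    then show "\<exists>no. \<forall>k\<ge>no. norm (l2 (\<lambda>x. f (x - z k) - f x) - 0) < e" by blast
  qed
qed

lemma shift_continuous_add:
  assumes f: "shift_continuous f" and g: "shift_continuous g"
  shows "shift_continuous (\<lambda>x. f x + g x)"
  unfolding shift_continuous_def
proof (intro conjI allI impI)
  have fL: "f \<in> L2" and gL: "g \<in> L2" using f g by (auto simp: shift_continuous_def)
  then show "(\<lambda>x. f x + g x) \<in> L2" by (rule L2_add)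
  fix z :: "nat \<Rightarrow> 'a" assume z: "z \<longlonglongrightarrow> 0"
  show "(\<lambda>k. l2 (\<lambda>x. f (x - z k) + g (x - z k) - (f x + g x))) \<longlonglongrightarrow> 0"
  proof (rule Lim_null_comparison)
    show "(\<lambda>k. l2 (\<lambda>x. f (x - z k) - f x) + l2 (\<lambda>x. g (x - z k) - g x)) \<longlonglongrightarrow> 0"
      using f g z tendsto_add[of "\<lambda>k. l2 (\<lambda>x. f (x - z k) - f x)" 0 sequentially "\<lambda>k. l2 (\<lambda>x. g (x - z k) - g x)" 0]
      by (simp add: shift_continuous_def)
    have "l2 (\<lambda>x. f (x - z k) + g (x - z k) - (f x + g x)) \<le> l2 (\<lambda>x. f (x - z k) - f x) + l2 (\<lambda>x. g (x - z k) - g x)" for k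
      using l2_triangle[OF L2_diff[OF L2_shift(1)[OF fL] fL] L2_diff[OF L2_shift(1)[OF gL] gL], of "z k" "z k"]
      by (simp add: algebra_simps)
    then show "\<forall>\<^sub>F k in sequentially. norm (l2 (\<lambda>x. f (x - z k) + g (x - z k) - (f x + g x)))
      \<le> l2 (\<lambda>x. f (x - z k) - f x) + l2 (\<lambda>x. g (x - z k) - g x)" by simp
  qed
qed

lemma shift_continuous_cmult:
  assumes f: "shift_continuous f" shows "shift_continuous (\<lambda>x. c * f x)"
  using f l2_cmult[of c "\<lambda>x. f (x - z) - f x" for z]
  by (auto simp: shift_continuous_def L2_cmult intro!: tendsto_mult_right_zero simp flip: right_diff_distrib)

lemma shift_continuous_sum:
  assumes "finite I" "\<And>i. i \<in> I \<Longrightarrow> shift_continuous (f i)"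
  shows "shift_continuous (\<lambda>x. \<Sum>i\<in>I. f i x)"
  using assms
proof (induction I rule: finite_induct)
  case empty
  have "(\<lambda>x. 0) \<in> L2" by (rule L2I) auto
  then show ?case by (simp add: shift_continuous_def l2_def)
qed (simp add: shift_continuous_add)

lemma indicator_L2:
  assumes "B \<in> sets borel" "emeasure lborel B < \<infinity>"
  shows "(indicator B :: 'a::euclidean_space \<Rightarrow> complex) \<in> L2"
    and "(l2 (indicator B :: 'a \<Rightarrow> complex))\<^sup>2 = measure lborel B"
proof -
  have eq: "(\<lambda>x. (cmod (indicator B x))\<^sup>2) = indicator B"
    by (auto simp: indicator_def)
  show "(indicator B :: 'a \<Rightarrow> complex) \<in> L2"
  proof (rule L2I)
    show "integrable lborel (\<lambda>x. (cmod (indicator B x))\<^sup>2)"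
      unfolding eq using assms by (intro integrable_real_indicator) auto
  qed (intro borel_measurable_indicator assms)
  show "(l2 (indicator B :: 'a \<Rightarrow> complex))\<^sup>2 = measure lborel B"
    unfolding l2_sq eq using assms by simp
qed

text \<open>Expanding the square reduces the claim to convergence of the inner product of the
  indicator with its translate. That product lives on \<open>U\<close>, where openness gives
  pointwise convergence; the boundary, possibly of positive measure, never enters.\<close>

lemma shift_continuous_indicator_open:
  assumes U: "open U" and fin: "emeasure lborel U < \<infinity>"
  shows "shift_continuous (indicator U :: 'a::euclidean_space \<Rightarrow> complex)"
  unfolding shift_continuous_def
proof (intro conjI allI impI)
  let ?f = "indicator U :: 'a \<Rightarrow> complex"
  have [measurable]: "U \<in> sets borel" using U by simp
  show f: "?f \<in> L2" by (rule indicator_L2) (use fin in auto)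
  fix z :: "nat \<Rightarrow> 'a" assume z: "z \<longlonglongrightarrow> 0"
  have "(\<lambda>k. LINT x|lborel. ?f (x - z k) * cnj (?f x)) \<longlonglongrightarrow> (LINT x|lborel. ?f x)"
  proof (rule integral_dominated_convergence)
    show "integrable lborel (indicator U :: 'a \<Rightarrow> real)"
      by (intro integrable_real_indicator) (use fin in auto)
    show "AE x in lborel. (\<lambda>k. ?f (x - z k) * cnj (?f x)) \<longlonglongrightarrow> ?f x"
    proof (rule AE_I2)
      fix x :: 'a
      show "(\<lambda>k. ?f (x - z k) * cnj (?f x)) \<longlonglongrightarrow> ?f x"
      proof (cases "x \<in> U")
        case True
        have "(\<lambda>k. x - z k) \<longlonglongrightarrow> x - 0"
          by (intro tendsto_intros z)
        then have "\<forall>\<^sub>F k in sequentially. x - z k \<in> U"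
          using topological_tendstoD[OF _ U] True by simp
        then have "\<forall>\<^sub>F k in sequentially. ?f (x - z k) * cnj (?f x) = ?f x"
          by eventually_elim (simp add: True)
        then show ?thesis by (rule tendsto_eventually)
      qed simp
    qed
  qed (auto simp: indicator_def)
  then have "(\<lambda>k. Re (LINT x|lborel. ?f (x - z k) * cnj (?f x))) \<longlonglongrightarrow> Re (LINT x|lborel. ?f x)"
    by (rule tendsto_Re)
  moreover have "Re (LINT x|lborel. ?f x) = (l2 ?f)\<^sup>2"
  proof -
    have "?f = (\<lambda>x. complex_of_real (indicator U x))" by (auto simp: indicator_def)
    then show ?thesis
      using indicator_L2(2)[of U] fin by simp
  qed
  ultimately have "(\<lambda>k. (l2 ?f)\<^sup>2 - 2 * Re (LINT x|lborel. ?f (x - z k) * cnj (?f x)) + (l2 ?f)\<^sup>2)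
      \<longlonglongrightarrow> (l2 ?f)\<^sup>2 - 2 * (l2 ?f)\<^sup>2 + (l2 ?f)\<^sup>2"
    by (intro tendsto_intros) simp
  moreover have "(l2 (\<lambda>x. ?f (x - z k) - ?f x))\<^sup>2 = (l2 ?f)\<^sup>2 - 2 * Re (LINT x|lborel. ?f (x - z k) * cnj (?f x)) + (l2 ?f)\<^sup>2" for k
    using L2.N_diff_sq[OF L2_shift(1)[OF f, of "z k"] f] L2_shift(2)[OF f, of "z k"] by (simp only: L2_N)
  ultimately have "(\<lambda>k. (l2 (\<lambda>x. ?f (x - z k) - ?f x))\<^sup>2) \<longlonglongrightarrow> 0"
    by simp
  then show "(\<lambda>k. l2 (\<lambda>x. ?f (x - z k) - ?f x)) \<longlonglongrightarrow> 0"
    by (rule l2_tendsto_0I)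
qed

text \<open>Outer regularity approximates the set by open sets, whose measure stays finite.\<close>

lemma shift_continuous_indicator:
  assumes B: "B \<in> sets borel" and fin: "emeasure lborel B < \<infinity>"
  shows "shift_continuous (indicator B :: 'a::euclidean_space \<Rightarrow> complex)"
proof -
  have "\<exists>U. open U \<and> B \<subseteq> U \<and> emeasure lborel (U - B) < ennreal (1 / Suc n)" for n
  proof -
    have "0 < 1 / real (Suc n)" by simp
    then obtain U where "open U" "B \<subseteq> U" "emeasure lborel (U - B) < ennreal (1 / real (Suc n))"
      by (rule outer_regular_lborel[OF B])
    then show ?thesis by blast
  qed
  then obtain U where U: "\<And>n. open (U n)" "\<And>n. B \<subseteq> U n"
      "\<And>n. emeasure lborel (U n - B) < ennreal (1 / Suc n)"
    by metis
  have [measurable]: "U n \<in> sets borel" "B \<in> sets borel" for n using U B by simp_all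
  have finD: "emeasure lborel (U n - B) < \<infinity>" for n
    using U(3)[of n] by (rule order_less_trans) simp
  have finU: "emeasure lborel (U n) < \<infinity>" for n
  proof -
    have "emeasure lborel (U n) = emeasure lborel (B \<union> (U n - B))"
      using U(2)[of n] by (simp add: Un_absorb1)
    also have "\<dots> \<le> emeasure lborel B + emeasure lborel (U n - B)"
      by (rule emeasure_subadditive) auto
    also have "\<dots> < \<infinity>"
      using fin finD[of n] by simp
    finally show ?thesis .
  qed
  show ?thesis
  proof (rule shift_continuous_limit)
    show "shift_continuous (indicator (U n) :: 'a \<Rightarrow> complex)" for n
      by (rule shift_continuous_indicator_open[OF U(1) finU])
    show "(indicator B :: 'a \<Rightarrow> complex) \<in> L2" by (rule indicator_L2[OF B fin])
    have "l2 (\<lambda>x. indicator (U n) x - indicator B x) \<le> sqrt (1 / Suc n)" for n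
    proof -
      have "(\<lambda>x. indicator (U n) x - indicator B x :: complex) = indicator (U n - B)"
        using U(2)[of n] by (auto simp: indicator_def fun_eq_iff)
      moreover have "measure lborel (U n - B) \<le> 1 / Suc n"
        unfolding measure_def using U(3)[of n] by (intro enn2real_leI) auto
      ultimately have "(l2 (\<lambda>x. indicator (U n) x - indicator B x))\<^sup>2 \<le> 1 / Suc n"
        using indicator_L2(2)[OF _ finD, of n] by simp
      then show ?thesis
        using real_le_rsqrt by blast
    qed
    then have le: "norm (l2 (\<lambda>x. indicator (U n) x - indicator B x)) \<le> sqrt (1 / Suc n)" for n
      by simp
    have "(\<lambda>n. sqrt (1 / Suc n)) \<longlonglongrightarrow> sqrt 0"
      using lim_1_over_n[THEN LIMSEQ_Suc] by (intro tendsto_real_sqrt) auto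
    then have lim: "(\<lambda>n. sqrt (1 / Suc n)) \<longlonglongrightarrow> 0" by simp
    show "(\<lambda>n. l2 (\<lambda>x. indicator (U n) x - indicator B x)) \<longlonglongrightarrow> 0"
      by (rule Lim_null_comparison[OF always_eventually[OF allI] lim]) (rule le)
  qed
qed

lemma L2_shift_continuous:
  fixes f :: "'a::euclidean_space \<Rightarrow> complex"
  assumes f: "f \<in> L2" shows "shift_continuous f"
proof -
  note [measurable] = L2_measurable[OF f]
  obtain s where s: "\<And>i. simple_function borel (s i)" and lim: "\<And>x. (\<lambda>i. s i x) \<longlonglongrightarrow> f x"
      and bd: "\<And>i x. dist (s i x) 0 \<le> 2 * dist (f x) 0"
    using borel_measurable_implies_sequence_metric[OF L2_measurable[OF f], of 0] by (metis UNIV_I space_borel)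
  have [measurable]: "s i \<in> borel_measurable borel" for i
    using s by (rule borel_measurable_simple_function)
  have le: "cmod (s i x) \<le> 2 * cmod (f x)" for i x
    using bd[of i x] by simp
  \<comment> \<open>The constants are the squares in
    \<open>cmod (s i x) \<le> 2 * cmod (f x)\<close> and
    \<open>cmod (s i x - f x) \<le> 3 * cmod (f x)\<close>.\<close>
  have int: "integrable lborel (\<lambda>x. 4 * (cmod (f x))\<^sup>2)" "integrable lborel (\<lambda>x. 9 * (cmod (f x))\<^sup>2)"
    by (intro integrable_mult_right L2_integrable f)+
  have sL: "s i \<in> L2" for i
  proof (rule L2I)
    have "(cmod (s i x))\<^sup>2 \<le> 4 * (cmod (f x))\<^sup>2" for x
      using power_mono[OF le[of i x], of 2] by (simp add: power_mult_distrib)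
    then show "integrable lborel (\<lambda>x. (cmod (s i x))\<^sup>2)"
      by (intro Bochner_Integration.integrable_bound[OF int(1)]) auto
  qed simp
  show ?thesis
  proof (rule shift_continuous_limit[OF _ f])
    fix i
    \<comment> \<open>The value 0 is left out because its level set may have infinite
      measure.\<close>
    have rep: "s i x = (\<Sum>y\<in>s i ` UNIV - {0}. y * indicator (s i -` {y}) x)" for x
    proof -
      have fin: "finite (s i ` UNIV)"
        using s[of i] by (simp add: simple_function_def)
      have "(\<Sum>y\<in>s i ` UNIV - {0}. y * indicator (s i -` {y}) x) = (\<Sum>y\<in>s i ` UNIV. y * indicator (s i -` {y}) x)"
        using fin by (intro sum.mono_neutral_left) auto
      also have "\<dots> = (\<Sum>y\<in>s i ` UNIV. if y = s i x then y else 0)"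
        by (intro sum.cong) (auto simp: indicator_def)
      finally show ?thesis using fin by simp
    qed
    have "shift_continuous (\<lambda>x. \<Sum>y\<in>s i ` UNIV - {0}. y * indicator (s i -` {y}) x)"
    proof (intro shift_continuous_sum shift_continuous_cmult shift_continuous_indicator)
      show "finite (s i ` UNIV - {0})"
        using s[of i] by (simp add: simple_function_def)
      fix y assume y: "y \<in> s i ` UNIV - {0}"
      show B: "s i -` {y} \<in> sets borel"
        using measurable_sets[of "s i" borel borel "{y}"] by simp
      have "integrable lborel (\<lambda>x. indicator (s i -` {y}) x :: real)"
      proof (rule Bochner_Integration.integrable_bound)
        show "integrable lborel (\<lambda>x. (cmod (s i x))\<^sup>2 / (cmod y)\<^sup>2)"
          by (intro integrable_divide L2_integrable sL)
        show "AE x in lborel. norm (indicator (s i -` {y}) x :: real) \<le> norm ((cmod (s i x))\<^sup>2 / (cmod y)\<^sup>2)"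
          using y by (intro AE_I2) (auto simp: indicator_def)
      qed (use B in simp)
      then show "emeasure lborel (s i -` {y}) < \<infinity>"
        using integrable_indicator_iff[of lborel "s i -` {y}"] by simp
    qed
    then show "shift_continuous (s i)"
      unfolding rep[symmetric] .
  next
    have "(\<lambda>i. LINT x|lborel. (cmod (s i x - f x))\<^sup>2) \<longlonglongrightarrow> (LINT x::'a|lborel. 0 :: real)"
    proof (rule integral_dominated_convergence[OF _ _ int(2)])
      show "AE x in lborel. (\<lambda>i. (cmod (s i x - f x))\<^sup>2) \<longlonglongrightarrow> 0"
      proof (rule AE_I2)
        fix x
        have "(\<lambda>i. (cmod (s i x - f x))\<^sup>2) \<longlonglongrightarrow> (cmod (f x - f x))\<^sup>2"
          by (intro tendsto_intros lim)
        then show "(\<lambda>i. (cmod (s i x - f x))\<^sup>2) \<longlonglongrightarrow> 0" by simp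
      qed
      have "cmod (s i x - f x) \<le> 3 * cmod (f x)" for i x
        using norm_triangle_ineq4[of "s i x" "f x"] le[of i x] by simp
      then have "(cmod (s i x - f x))\<^sup>2 \<le> 9 * (cmod (f x))\<^sup>2" for i x
        using power_mono[of "cmod (s i x - f x)" "3 * cmod (f x)" 2] by (simp add: power_mult_distrib)
      then show "AE x in lborel. norm ((cmod (s i x - f x))\<^sup>2) \<le> 9 * (cmod (f x))\<^sup>2" for i
        by simp
    qed auto
    then have "(\<lambda>i. sqrt (LINT x|lborel. (cmod (s i x - f x))\<^sup>2)) \<longlonglongrightarrow> sqrt 0"
      by (intro tendsto_real_sqrt) simp
    then show "(\<lambda>i. l2 (\<lambda>x. s i x - f x)) \<longlonglongrightarrow> 0"
      by (simp add: l2_def)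
  qed
qed

section \<open>The Fourier transform of the Gaussian\<close>

lemma
  fixes g :: "'a::euclidean_space \<Rightarrow> real \<Rightarrow> complex"
  assumes g: "\<And>b. b \<in> Basis \<Longrightarrow> integrable lborel (g b)"
  shows integrable_lborel_prod: "integrable lborel (\<lambda>x. \<Prod>b\<in>Basis. g b (x \<bullet> b))"
    and integral_lborel_prod: "(LINT x|lborel. (\<Prod>b\<in>Basis. g b (x \<bullet> b))) = (\<Prod>b\<in>Basis. (LINT t|lborel. g b t))"
proof -
  interpret product_sigma_finite "\<lambda>b::'a. lborel :: real measure" ..
  have [measurable]: "g b \<in> borel_measurable borel" if "b \<in> Basis" for b
    using g[OF that] by auto
  have [measurable]: "(\<lambda>x. \<Prod>b\<in>Basis. g b (x \<bullet> b)) \<in> borel_measurable borel"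
    by measurable
  have T: "(\<lambda>f. \<Sum>b\<in>Basis. f b *\<^sub>R b) \<in> (\<Pi>\<^sub>M b\<in>(Basis::'a set). lborel) \<rightarrow>\<^sub>M borel"
    by measurable
  have eq: "(\<Prod>b\<in>Basis. g b ((\<Sum>b\<in>Basis. f b *\<^sub>R b) \<bullet> b)) = (\<Prod>b\<in>Basis. g b (f b))" for f
    by (intro prod.cong) auto
  show "integrable lborel (\<lambda>x. \<Prod>b\<in>Basis. g b (x \<bullet> b))"
    by (subst lborel_eq) (simp add: integrable_distr_eq[OF T] eq product_integrable_prod g)
  show "(LINT x|lborel. (\<Prod>b\<in>Basis. g b (x \<bullet> b))) = (\<Prod>b\<in>Basis. (LINT t|lborel. g b t))"
    by (subst lborel_eq) (simp add: integral_distr[OF T] eq product_integral_prod g)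
qed

text \<open>This is the characteristic function of the standard normal distribution, freed of the
  density's normalization.\<close>

lemma gaussian_real:
  fixes s :: real
  shows "integrable lborel (\<lambda>t. cis (- (t * s)) * of_real (exp (- t\<^sup>2 / 2)))"
    and "(LINT t|lborel. cis (- (t * s)) * of_real (exp (- t\<^sup>2 / 2))) = of_real (sqrt (2 * pi) * exp (- s\<^sup>2 / 2))"
proof -
  have dens: "exp (- t\<^sup>2 / 2) = sqrt (2 * pi) * std_normal_density t" for t :: real
    by (simp add: std_normal_density_def)
  have "integrable lborel (\<lambda>t. exp (- t\<^sup>2 / 2) :: real)"
    unfolding dens by (intro integrable_mult_right integrable_normal_density) simp
  then show "integrable lborel (\<lambda>t. cis (- (t * s)) * of_real (exp (- t\<^sup>2 / 2)))"
    by (rule Bochner_Integration.integrable_bound) (auto simp: norm_mult)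
  have "of_real (exp (- (- s)\<^sup>2 / 2)) = char std_normal_distribution (- s)"
    by (simp add: char_std_normal_distribution)
  also have "\<dots> = (LINT t|lborel. std_normal_density t *\<^sub>R iexp (- s * t))"
    unfolding char_def by (subst integral_density) auto
  also have "\<dots> = (LINT t|lborel. of_real (1 / sqrt (2 * pi)) * (cis (- (t * s)) * of_real (exp (- t\<^sup>2 / 2))))"
    by (intro Bochner_Integration.integral_cong)
      (auto simp: std_normal_density_def scaleR_conv_of_real cis_conv_exp mult_ac)
  finally show "(LINT t|lborel. cis (- (t * s)) * of_real (exp (- t\<^sup>2 / 2))) = of_real (sqrt (2 * pi) * exp (- s\<^sup>2 / 2))"
    by (simp add: field_simps del: of_real_exp)
qed

text \<open>Unnormalized, so that it is a fixed point of the unitary Fourier transform.\<close>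

definition gauss :: "'a::euclidean_space \<Rightarrow> real" where
  "gauss x = exp (- (norm x)\<^sup>2 / 2)"

lemma gauss_pos [simp]: "0 < gauss x" and gauss_nonneg [simp]: "0 \<le> gauss x"
  and gauss_le_1 [simp]: "gauss x \<le> 1"
  by (simp_all add: gauss_def)

lemma gauss_measurable [measurable]: "gauss \<in> borel_measurable borel"
  unfolding gauss_def by measurable

text \<open>Both the character and the Gaussian factor over the coordinates, which reduces the
  integral to the one-dimensional one.\<close>

lemma gauss_fourier:
  fixes \<xi> :: "'a::euclidean_space"
  shows "integrable lborel (\<lambda>x::'a. cis (- (x \<bullet> \<xi>)) * of_real (gauss x))"
    and "(LINT x|lborel. cis (- (x \<bullet> \<xi>)) * of_real (gauss x)) = of_real (sqrt (2 * pi) ^ DIM('a) * gauss \<xi>)"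
proof -
  have gauss: "of_real (gauss x) = (\<Prod>b\<in>Basis. complex_of_real (exp (- (x \<bullet> b)\<^sup>2 / 2)))" for x :: 'a
    unfolding gauss_def of_real_prod[symmetric]
    by (subst exp_sum[symmetric])
      (auto simp: norm_eq_sqrt_inner euclidean_inner[of x x] sum_nonneg power2_eq_square sum_negf sum_divide_distrib)
  have cis: "cis (- (x \<bullet> \<xi>)) = (\<Prod>b\<in>Basis. cis (- ((x \<bullet> b) * (\<xi> \<bullet> b))))" for x :: 'a
    by (simp add: cis_conv_exp euclidean_inner[of x \<xi>] exp_sum[symmetric] sum_negf sum_distrib_left)
  have eq: "cis (- (x \<bullet> \<xi>)) * of_real (gauss x)
      = (\<Prod>b\<in>Basis. cis (- ((x \<bullet> b) * (\<xi> \<bullet> b))) * of_real (exp (- (x \<bullet> b)\<^sup>2 / 2)))" for x :: 'a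
    unfolding gauss cis prod.distrib ..
  show "integrable lborel (\<lambda>x::'a. cis (- (x \<bullet> \<xi>)) * of_real (gauss x))"
    unfolding eq by (rule integrable_lborel_prod[OF gaussian_real(1)])
  have "(LINT x|lborel. cis (- (x \<bullet> \<xi>)) * of_real (gauss x))
      = (\<Prod>b\<in>Basis. (LINT t|lborel. cis (- (t * (\<xi> \<bullet> b))) * of_real (exp (- t\<^sup>2 / 2))))"
    unfolding eq by (rule integral_lborel_prod[OF gaussian_real(1)])
  also have "\<dots> = of_real (sqrt (2 * pi) ^ DIM('a) * gauss \<xi>)"
    unfolding gaussian_real of_real_mult gauss prod.distrib by simp
  finally show "(LINT x|lborel. cis (- (x \<bullet> \<xi>)) * of_real (gauss x)) = of_real (sqrt (2 * pi) ^ DIM('a) * gauss \<xi>)" .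
qed

lemma gauss_integrable: "integrable lborel (gauss :: 'a::euclidean_space \<Rightarrow> real)"
proof -
  have "integrable lborel (\<lambda>x::'a. norm (cis (- (x \<bullet> 0)) * complex_of_real (gauss x)))"
    by (intro integrable_norm gauss_fourier)
  then show ?thesis by (simp add: norm_mult)
qed

lemma gauss_integral: "(LINT x|lborel. gauss (x::'a::euclidean_space)) = sqrt (2 * pi) ^ DIM('a)"
proof -
  have "complex_of_real (LINT x|lborel. gauss (x::'a)) = of_real (sqrt (2 * pi) ^ DIM('a))"
    using gauss_fourier(2)[of "0::'a"] by (simp add: gauss_def[of "0::'a"])
  then show ?thesis by (simp only: of_real_eq_iff)
qed

section \<open>Plancherel's theorem\<close>

lemma fourier_const: "(2 * pi) powr (- real n / 2) * sqrt (2 * pi) ^ n = 1"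
proof -
  have "sqrt (2 * pi) ^ n = (2 * pi) powr (real n / 2)"
    by (simp add: powr_half_sqrt[symmetric] powr_realpow[symmetric] powr_powr)
  then show ?thesis by (simp add: powr_minus)
qed

section \<open>Rules for the integral transform\<close>

lemma fourier_L1_measurable [measurable]:
  assumes [measurable]: "f \<in> borel_measurable borel"
  shows "fourier_L1 f \<in> borel_measurable borel"
  unfolding fourier_L1_def[abs_def]
  by (intro borel_measurable_times borel_measurable_const lborel.borel_measurable_lebesgue_integral) measurable

lemma fourier_integrable:
  fixes f :: "'a::euclidean_space \<Rightarrow> complex"
  assumes "integrable lborel f"
  shows "integrable lborel (\<lambda>x. cis (- (x \<bullet> \<xi>)) * f x)"
proof -
  have [measurable]: "f \<in> borel_measurable borel" using assms by simp
  show ?thesis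
    by (rule Bochner_Integration.integrable_bound[OF assms]) (auto simp: norm_mult)
qed

lemma fourier_L1_add:
  "integrable lborel f \<Longrightarrow> integrable lborel g \<Longrightarrow> fourier_L1 (\<lambda>x. f x + g x) \<xi> = fourier_L1 f \<xi> + fourier_L1 g \<xi>"
  by (simp add: fourier_L1_def ring_distribs fourier_integrable)

lemma fourier_L1_cmult: "fourier_L1 (\<lambda>x. c * f x) \<xi> = c * fourier_L1 f \<xi>"
  by (simp add: fourier_L1_def mult.left_commute[of _ c])

lemma fourier_L1_diff:
  assumes "integrable lborel f" "integrable lborel g"
  shows "fourier_L1 (\<lambda>x. f x - g x) \<xi> = fourier_L1 f \<xi> - fourier_L1 g \<xi>"
  using assms by (simp add: fourier_L1_def right_diff_distrib fourier_integrable)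

lemma fourier_L1_bound:
  fixes f :: "real ^ 'n \<Rightarrow> complex"
  shows "cmod (fourier_L1 f \<xi>) \<le> (2 * pi) powr (- real CARD('n) / 2) * (LINT x|lborel. cmod (f x))"
proof -
  have "cmod (LINT x|lborel. cis (- (x \<bullet> \<xi>)) * f x) \<le> (LINT x|lborel. cmod (cis (- (x \<bullet> \<xi>)) * f x))"
    by (rule integral_norm_bound)
  then show ?thesis
    by (simp add: fourier_L1_def norm_mult mult_left_mono)
qed

lemma fourier_L1_shift:
  assumes [measurable]: "f \<in> borel_measurable borel"
  shows "fourier_L1 (\<lambda>x. f (x - y)) \<xi> = cis (- (y \<bullet> \<xi>)) * fourier_L1 f \<xi>"
proof -
  have "(LINT x|lborel. cis (- (x \<bullet> \<xi>)) * f (x - y)) = (LINT x|lborel. cis (- ((x - y + y) \<bullet> \<xi>)) * f (x - y))"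
    by simp
  also have "\<dots> = (LINT x|lborel. cis (- ((x + y) \<bullet> \<xi>)) * f x)"
    by (rule integrable_lborel_shift(4)[of "\<lambda>x. cis (- ((x + y) \<bullet> \<xi>)) * f x"]) measurable
  also have "\<dots> = (LINT x|lborel. cis (- (y \<bullet> \<xi>)) * (cis (- (x \<bullet> \<xi>)) * f x))"
    by (simp add: inner_add_left cis_mult add.commute flip: mult.assoc)
  also have "\<dots> = cis (- (y \<bullet> \<xi>)) * (LINT x|lborel. cis (- (x \<bullet> \<xi>)) * f x)"
    by (rule integral_mult_right_zero)
  finally show ?thesis
    by (simp only: fourier_L1_def mult.left_commute)
qed

text \<open>For large \<open>k\<close> the wide Gaussian tends to 1, while its transform
  concentrates at 0 with constant mass: an approximate identity.\<close>

lemma fourier_L1_gauss_scaled: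
  fixes \<xi> :: "real ^ 'n"
  assumes k: "0 < k"
  shows "fourier_L1 (\<lambda>x. of_real (gauss (x /\<^sub>R k))) \<xi> = of_real (k ^ CARD('n) * gauss (k *\<^sub>R \<xi>))"
proof -
  have "(LINT x|lborel. cis (- (x \<bullet> \<xi>)) * of_real (gauss (x /\<^sub>R k)))
      = \<bar>k\<bar> ^ DIM(real ^ 'n) *\<^sub>R (LINT x|lborel. cis (- ((0 + k *\<^sub>R x) \<bullet> \<xi>)) * of_real (gauss ((0 + k *\<^sub>R x) /\<^sub>R k)))"
    by (rule integral_lborel_shift_scale) (use k in \<open>simp_all\<close>)
  also have "(\<lambda>x. cis (- ((0 + k *\<^sub>R x) \<bullet> \<xi>)) * of_real (gauss ((0 + k *\<^sub>R x) /\<^sub>R k)))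
      = (\<lambda>x. cis (- (x \<bullet> (k *\<^sub>R \<xi>))) * complex_of_real (gauss x))"
    using k by simp
  also have "(LINT x|lborel. cis (- (x \<bullet> (k *\<^sub>R \<xi>))) * complex_of_real (gauss x))
      = of_real (sqrt (2 * pi) ^ CARD('n) * gauss (k *\<^sub>R \<xi>))"
    using gauss_fourier(2)[of "k *\<^sub>R \<xi>"] by simp
  finally have eq: "(LINT x|lborel. cis (- (x \<bullet> \<xi>)) * of_real (gauss (x /\<^sub>R k)))
      = of_real (k ^ CARD('n) * (sqrt (2 * pi) ^ CARD('n) * gauss (k *\<^sub>R \<xi>)))"
    using k by (simp add: scaleR_conv_of_real)
  have "(2 * pi) powr (- real CARD('n) / 2) * (k ^ CARD('n) * (sqrt (2 * pi) ^ CARD('n) * gauss (k *\<^sub>R \<xi>)))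
      = ((2 * pi) powr (- real CARD('n) / 2) * sqrt (2 * pi) ^ CARD('n)) * (k ^ CARD('n) * gauss (k *\<^sub>R \<xi>))"
    by (simp only: mult_ac)
  also have "\<dots> = k ^ CARD('n) * gauss (k *\<^sub>R \<xi>)"
    by (simp only: fourier_const mult_1)
  finally show ?thesis
    unfolding fourier_L1_def eq of_real_mult[symmetric] by (rule arg_cong)
qed

section \<open>Multiplication formula and autocorrelation\<close>

lemma integrable_pair_product:
  fixes f g :: "'a::euclidean_space \<Rightarrow> complex"
  assumes f: "integrable lborel f" and g: "integrable lborel g"
    and [measurable]: "case_prod h \<in> borel_measurable (borel \<Otimes>\<^sub>M borel)"
    and h: "\<And>x y. cmod (h x y) \<le> 1"
  shows "integrable (lborel \<Otimes>\<^sub>M lborel) (\<lambda>(x, y). h x y * (f x * g y))"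
proof -
  have [measurable]: "f \<in> borel_measurable borel" "g \<in> borel_measurable borel"
    using f g by simp_all
  have "integrable (lborel \<Otimes>\<^sub>M lborel) (\<lambda>(x, y). f x * g y)"
  proof (rule lborel_pair.Fubini_integrable)
    show "integrable lborel (\<lambda>x. LINT y|lborel. norm (case (x, y) of (x, y) \<Rightarrow> f x * g y))"
      using f by (simp add: norm_mult)
    show "AE x in lborel. integrable lborel (\<lambda>y. case (x, y) of (x, y) \<Rightarrow> f x * g y)"
      using g by simp
  qed measurable
  then show ?thesis
  proof (rule Bochner_Integration.integrable_bound)
    show "(\<lambda>(x, y). h x y * (f x * g y)) \<in> borel_measurable (lborel \<Otimes>\<^sub>M lborel)"
      by measurable
    show "AE z in lborel \<Otimes>\<^sub>M lborel. norm (case z of (x, y) \<Rightarrow> h x y * (f x * g y)) \<le> norm (case z of (x, y) \<Rightarrow> f x * g y)"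
      by (rule AE_I2) (auto simp: norm_mult intro!: mult_left_le_one_le h)
  qed
qed

text \<open>Fubini: both sides are the double integral of \<open>f x * g \<xi>\<close> against the
  symmetric kernel \<open>cis (- (x \<bullet> \<xi>))\<close>.\<close>

lemma fourier_L1_multiplication:
  fixes f g :: "real ^ 'n \<Rightarrow> complex"
  assumes f: "integrable lborel f" and g: "integrable lborel g"
  shows "(LINT \<xi>|lborel. fourier_L1 f \<xi> * g \<xi>) = (LINT x|lborel. f x * fourier_L1 g x)"
proof -
  let ?c = "complex_of_real ((2 * pi) powr (- real CARD('n) / 2))"
  have int: "integrable (lborel \<Otimes>\<^sub>M lborel) (\<lambda>(x, \<xi>). cis (- (x \<bullet> \<xi>)) * (f x * g \<xi>))"
    by (rule integrable_pair_product[OF f g]) auto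
  have "(LINT \<xi>|lborel. fourier_L1 f \<xi> * g \<xi>) = ?c * (LINT \<xi>|lborel. LINT x|lborel. cis (- (x \<bullet> \<xi>)) * (f x * g \<xi>))"
    by (simp add: fourier_L1_def mult.assoc flip: integral_mult_left_zero integral_mult_right_zero)
  also have "\<dots> = ?c * (LINT x|lborel. LINT \<xi>|lborel. cis (- (x \<bullet> \<xi>)) * (f x * g \<xi>))"
    using lborel_pair.Fubini_integral[OF int] by simp
  also have "\<dots> = ?c * (LINT x|lborel. f x * (LINT \<xi>|lborel. cis (- (x \<bullet> \<xi>)) * g \<xi>))"
    by (simp only: mult.left_commute[of _ "f _"] integral_mult_right_zero)
  also have "\<dots> = (LINT x|lborel. ?c * (f x * (LINT \<xi>|lborel. cis (- (x \<bullet> \<xi>)) * g \<xi>)))"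
    by (rule integral_mult_right_zero[symmetric])
  also have "\<dots> = (LINT x|lborel. f x * fourier_L1 g x)"
    by (simp only: fourier_L1_def inner_commute mult.left_commute)
  finally show ?thesis .
qed

text \<open>The convolution of \<open>f\<close> with \<open>\<lambda>x. cnj (f (- x))\<close>. Its
  transform is, up to normalization, the squared modulus of that of \<open>f\<close>, and its value
  at 0 is the squared norm.\<close>

definition autocorr :: "('a::euclidean_space \<Rightarrow> complex) \<Rightarrow> 'a \<Rightarrow> complex" where
  "autocorr f z = (LINT x|lborel. f x * cnj (f (x - z)))"

lemma autocorr_pair_integrable:
  fixes f :: "'a::euclidean_space \<Rightarrow> complex"
  assumes f: "integrable lborel f"
  shows "integrable (lborel \<Otimes>\<^sub>M lborel) (\<lambda>(x, z). cis (- (z \<bullet> \<xi>)) * (f x * cnj (f (x - z))))"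
proof -
  have [measurable]: "f \<in> borel_measurable borel" using f by simp
  show ?thesis
  proof (rule lborel_pair.Fubini_integrable)
    have "(LINT z|lborel. cmod (f (x - z))) = (LINT z|lborel. cmod (f z))" for x
      by (rule integrable_lborel_shift(6)[of "\<lambda>z. cmod (f z)"]) measurable
    then show "integrable lborel (\<lambda>x. LINT z|lborel. norm (case (x, z) of (x, z) \<Rightarrow> cis (- (z \<bullet> \<xi>)) * (f x * cnj (f (x - z)))))"
      using f by (simp add: norm_mult)
    have "integrable lborel (\<lambda>z. cnj (f (x - z)))" for x
      using f integrable_lborel_shift(5)[of "\<lambda>z. cnj (f z)" x] by simp
    then show "AE x in lborel. integrable lborel (\<lambda>z. case (x, z) of (x, z) \<Rightarrow> cis (- (z \<bullet> \<xi>)) * (f x * cnj (f (x - z))))"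
      by (simp add: fourier_integrable)
  qed measurable
qed

lemma autocorr_integrable:
  fixes f :: "'a::euclidean_space \<Rightarrow> complex"
  assumes f: "integrable lborel f"
  shows "integrable lborel (autocorr f)"
proof -
  show ?thesis
    using lborel_pair.integrable_snd[OF autocorr_pair_integrable[OF f, of 0]] by (simp add: autocorr_def[abs_def])
qed

lemma fourier_autocorr:
  fixes f :: "real ^ 'n \<Rightarrow> complex"
  assumes f: "integrable lborel f"
  shows "of_real ((2 * pi) powr (- real CARD('n) / 2)) * fourier_L1 (autocorr f) \<xi> = of_real ((cmod (fourier_L1 f \<xi>))\<^sup>2)"
proof -
  have [measurable]: "f \<in> borel_measurable borel" using f by simp
  let ?c = "complex_of_real ((2 * pi) powr (- real CARD('n) / 2))"
  define I where "I = (LINT x|lborel. cis (- (x \<bullet> \<xi>)) * f x)"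
  have inner: "(LINT z|lborel. cis (- (z \<bullet> \<xi>)) * cnj (f (x - z))) = cis (- (x \<bullet> \<xi>)) * cnj I" for x
  proof -
    have "(LINT z|lborel. cis (- (z \<bullet> \<xi>)) * cnj (f (x - z))) = (LINT z|lborel. cis (- ((x - (x - z)) \<bullet> \<xi>)) * cnj (f (x - z)))"
      by simp
    also have "\<dots> = (LINT w|lborel. cis (- ((x - w) \<bullet> \<xi>)) * cnj (f w))"
      by (rule integrable_lborel_shift(6)[of "\<lambda>w. cis (- ((x - w) \<bullet> \<xi>)) * cnj (f w)"]) measurable
    also have "\<dots> = (LINT w|lborel. cis (- (x \<bullet> \<xi>)) * cnj (cis (- (w \<bullet> \<xi>)) * f w))"
      by (intro Bochner_Integration.integral_cong) (auto simp: inner_diff_left cis_cnj cis_mult simp flip: mult.assoc)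
    also have "\<dots> = cis (- (x \<bullet> \<xi>)) * cnj I"
      unfolding I_def by (subst integral_mult_right_zero) (simp only: Bochner_Integration.integral_cnj)
    finally show ?thesis .
  qed
  have "(LINT z|lborel. cis (- (z \<bullet> \<xi>)) * autocorr f z) = (LINT z|lborel. LINT x|lborel. cis (- (z \<bullet> \<xi>)) * (f x * cnj (f (x - z))))"
    by (simp add: autocorr_def)
  also have "\<dots> = (LINT x|lborel. LINT z|lborel. cis (- (z \<bullet> \<xi>)) * (f x * cnj (f (x - z))))"
    using lborel_pair.Fubini_integral[OF autocorr_pair_integrable[OF f, of \<xi>]] by simp
  also have "\<dots> = (LINT x|lborel. f x * (LINT z|lborel. cis (- (z \<bullet> \<xi>)) * cnj (f (x - z))))"
    by (simp only: mult.left_commute[of _ "f _"] integral_mult_right_zero)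
  also have "\<dots> = (LINT x|lborel. cis (- (x \<bullet> \<xi>)) * f x * cnj I)"
    unfolding inner by (simp only: mult_ac)
  also have "\<dots> = I * cnj I"
    unfolding I_def by (rule integral_mult_left_zero)
  finally have "?c * fourier_L1 (autocorr f) \<xi> = (?c * I) * cnj (?c * I)"
    by (simp add: fourier_L1_def)
  also have "?c * I = fourier_L1 f \<xi>"
    by (simp add: fourier_L1_def I_def)
  finally show ?thesis
    by (simp only: complex_norm_square)
qed

text \<open>Boundedness supplies a dominating function, and the last estimate turns continuity of
  translations into continuity at 0.\<close>

lemma autocorr_bounds:
  assumes f: "f \<in> L2"
  shows "cmod (autocorr f z) \<le> (l2 f)\<^sup>2" and "autocorr f 0 = of_real ((l2 f)\<^sup>2)"
    and "cmod (autocorr f z - autocorr f 0) \<le> l2 f * l2 (\<lambda>x. f (x - z) - f x)"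
proof -
  note sh = L2_shift(1)[OF f, of z] L2_shift(2)[OF f, of z]
  show "cmod (autocorr f z) \<le> (l2 f)\<^sup>2"
    using L2_cauchy_schwarz(2)[OF f L2_cnj[OF sh(1)]] by (simp add: autocorr_def l2_cnj sh(2) power2_eq_square)
  have "autocorr f 0 = (LINT x|lborel. of_real ((cmod (f x))\<^sup>2))"
    unfolding autocorr_def complex_norm_square by simp
  then show "autocorr f 0 = of_real ((l2 f)\<^sup>2)"
    unfolding l2_sq integral_complex_of_real .
  have "autocorr f z - autocorr f 0 = (LINT x|lborel. f x * cnj (f (x - z) - f x))"
    by (simp add: autocorr_def right_diff_distrib L2_mult_integrable f L2_cnj sh)
  then show "cmod (autocorr f z - autocorr f 0) \<le> l2 f * l2 (\<lambda>x. f (x - z) - f x)"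
    using L2_cauchy_schwarz(2)[OF f L2_cnj[OF L2_diff[OF sh(1) f]]] by (simp only: l2_cnj)
qed

lemma gauss_scaled_integrable:
  assumes "0 < k" shows "integrable lborel (\<lambda>x::'a::euclidean_space. gauss (x /\<^sub>R k))"
  using integrable_lborel_shift_scale[of "inverse k" gauss "0::'a"] gauss_integrable assms by simp

text \<open>A regularized Plancherel identity. The Gaussian weight allows the multiplication formula
  to move the transform from the autocorrelation to the Gaussian; the substitution
  \<open>w = k *\<^sub>R z\<close> then removes \<open>k\<close> from the Gaussian.\<close>

lemma plancherel_L1_gauss:
  fixes f :: "real ^ 'n \<Rightarrow> complex"
  assumes f: "f \<in> L2" and f1: "integrable lborel f" and k: "0 < k"
  shows "of_real (LINT \<xi>|lborel. (cmod (fourier_L1 f \<xi>))\<^sup>2 * gauss (\<xi> /\<^sub>R k))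
    = of_real ((2 * pi) powr (- real CARD('n) / 2)) * (LINT w|lborel. autocorr f (w /\<^sub>R k) * of_real (gauss w))"
proof -
  let ?c = "complex_of_real ((2 * pi) powr (- real CARD('n) / 2))"
  have [measurable]: "f \<in> borel_measurable borel" "autocorr f \<in> borel_measurable borel"
    using f1 autocorr_integrable[OF f1] by simp_all
  have "of_real (LINT \<xi>|lborel. (cmod (fourier_L1 f \<xi>))\<^sup>2 * gauss (\<xi> /\<^sub>R k))
    = (LINT \<xi>|lborel. of_real ((cmod (fourier_L1 f \<xi>))\<^sup>2) * complex_of_real (gauss (\<xi> /\<^sub>R k)))"
    unfolding of_real_mult[symmetric] integral_complex_of_real ..
  also have "\<dots> = ?c * (LINT \<xi>|lborel. fourier_L1 (autocorr f) \<xi> * of_real (gauss (\<xi> /\<^sub>R k)))"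
    unfolding fourier_autocorr[OF f1, symmetric] mult.assoc by (rule integral_mult_right_zero)
  also have "(LINT \<xi>|lborel. fourier_L1 (autocorr f) \<xi> * of_real (gauss (\<xi> /\<^sub>R k)))
      = (LINT z|lborel. autocorr f z * fourier_L1 (\<lambda>\<xi>. of_real (gauss (\<xi> /\<^sub>R k))) z)"
    by (rule fourier_L1_multiplication[OF autocorr_integrable[OF f1]])
      (intro integrable_of_real gauss_scaled_integrable k)
  also have "\<dots> = (LINT z|lborel. autocorr f z * of_real (k ^ CARD('n) * gauss (k *\<^sub>R z)))"
    unfolding fourier_L1_gauss_scaled[OF k] ..
  also have "\<dots> = \<bar>inverse k\<bar> ^ DIM(real ^ 'n) *\<^sub>R (LINT w|lborel. autocorr f (0 + inverse k *\<^sub>R w) * of_real (k ^ CARD('n) * gauss (k *\<^sub>R (0 + inverse k *\<^sub>R w))))"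
    by (rule integral_lborel_shift_scale) (use k in simp_all)
  also have "\<dots> = (LINT w|lborel. autocorr f (w /\<^sub>R k) * of_real (gauss w))"
  proof -
    have "(LINT w|lborel. autocorr f (0 + inverse k *\<^sub>R w) * of_real (k ^ CARD('n) * gauss (k *\<^sub>R (0 + inverse k *\<^sub>R w))))
      = of_real (k ^ CARD('n)) * (LINT w|lborel. autocorr f (w /\<^sub>R k) * of_real (gauss w))"
      using k by (simp add: mult.left_commute)
    then show ?thesis
      using k by (simp add: scaleR_conv_of_real flip: power_mult_distrib mult.assoc)
  qed
  finally show ?thesis .
qed

text \<open>In the regularized identity let \<open>k\<close> tend to infinity. The right side
  converges to the squared norm of \<open>f\<close> by continuity of the autocorrelation at 0. The
  left side increases, so monotone convergence gives square integrability of the transform, not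
  known beforehand, together with the equality of norms.\<close>

lemma
  fixes f :: "real ^ 'n \<Rightarrow> complex"
  assumes f: "f \<in> L2" and f1: "integrable lborel f"
  shows fourier_L1_L2: "fourier_L1 f \<in> L2" and plancherel_L1: "l2 (fourier_L1 f) = l2 f"
proof -
  let ?c = "(2 * pi) powr (- real CARD('n) / 2)"
  have [measurable]: "f \<in> borel_measurable borel" "autocorr f \<in> borel_measurable borel"
    using f1 autocorr_integrable[OF f1] by simp_all
  define a where "a n = (\<lambda>\<xi>::real ^ 'n. (cmod (fourier_L1 f \<xi>))\<^sup>2 * gauss (\<xi> /\<^sub>R real (Suc n)))" for n
  have lim_w: "(\<lambda>n. autocorr f (w /\<^sub>R real (Suc n))) \<longlonglongrightarrow> of_real ((l2 f)\<^sup>2)" for w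
  proof -
    have z: "(\<lambda>n. w /\<^sub>R real (Suc n)) \<longlonglongrightarrow> 0"
      using tendsto_scaleR[OF LIMSEQ_inverse_real_of_nat tendsto_const[of w]] by simp
    have "(\<lambda>n. autocorr f (w /\<^sub>R real (Suc n)) - autocorr f 0) \<longlonglongrightarrow> 0"
    proof (rule Lim_null_comparison[OF always_eventually[OF allI]])
      have "(\<lambda>n. l2 (\<lambda>x. f (x - w /\<^sub>R real (Suc n)) - f x)) \<longlonglongrightarrow> 0"
        using L2_shift_continuous[OF f] z unfolding shift_continuous_def by blast
      then show "(\<lambda>n. l2 f * l2 (\<lambda>x. f (x - w /\<^sub>R real (Suc n)) - f x)) \<longlonglongrightarrow> 0"
        by (rule tendsto_mult_right_zero)
    qed (rule autocorr_bounds(3)[OF f])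
    then show ?thesis
      unfolding autocorr_bounds(2)[OF f] by (simp add: LIM_zero_iff)
  qed
  have "(\<lambda>n. LINT w|lborel. autocorr f (w /\<^sub>R real (Suc n)) * of_real (gauss w))
      \<longlonglongrightarrow> (LINT w::real ^ 'n|lborel. of_real ((l2 f)\<^sup>2) * of_real (gauss w))"
  proof (rule integral_dominated_convergence)
    show "integrable lborel (\<lambda>w::real ^ 'n. (l2 f)\<^sup>2 * gauss w)"
      by (intro integrable_mult_right gauss_integrable)
    show "AE w in lborel. (\<lambda>n. autocorr f (w /\<^sub>R real (Suc n)) * of_real (gauss w)) \<longlonglongrightarrow> of_real ((l2 f)\<^sup>2) * of_real (gauss w)"
      by (intro AE_I2 tendsto_mult lim_w tendsto_const)
    show "AE w in lborel. norm (autocorr f (w /\<^sub>R real (Suc n)) * of_real (gauss w)) \<le> (l2 f)\<^sup>2 * gauss w" for n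
      by (intro AE_I2) (simp add: norm_mult mult_right_mono autocorr_bounds(1)[OF f] del: of_nat_Suc)
  qed measurable
  then have "(\<lambda>n. of_real ?c * (LINT w|lborel. autocorr f (w /\<^sub>R real (Suc n)) * of_real (gauss w)))
      \<longlonglongrightarrow> of_real ?c * (LINT w::real ^ 'n|lborel. of_real ((l2 f)\<^sup>2) * of_real (gauss w))"
    by (rule tendsto_mult_left)
  also have "of_real ?c * (LINT w::real ^ 'n|lborel. of_real ((l2 f)\<^sup>2) * of_real (gauss w)) = complex_of_real ((l2 f)\<^sup>2)"
  proof -
    have "(LINT w::real ^ 'n|lborel. of_real ((l2 f)\<^sup>2) * complex_of_real (gauss w)) = of_real ((l2 f)\<^sup>2 * sqrt (2 * pi) ^ CARD('n))"
      unfolding of_real_mult[symmetric] integral_complex_of_real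
      by (simp add: gauss_integral del: of_real_mult)
    also have "of_real ?c * \<dots> = of_real ((?c * sqrt (2 * pi) ^ CARD('n)) * (l2 f)\<^sup>2)"
      by (simp only: of_real_mult mult_ac)
    finally show ?thesis by (simp only: fourier_const mult_1)
  qed
  finally have "(\<lambda>n. complex_of_real (LINT \<xi>|lborel. a n \<xi>)) \<longlonglongrightarrow> of_real ((l2 f)\<^sup>2)"
    unfolding a_def by (subst plancherel_L1_gauss[OF f f1]) simp_all
  then have a_lim: "(\<lambda>n. LINT \<xi>|lborel. a n \<xi>) \<longlonglongrightarrow> (l2 f)\<^sup>2"
    by (simp only: tendsto_of_real_iff)
  have a_int: "integrable lborel (a n)" for n
  proof (rule Bochner_Integration.integrable_bound)
    \<comment> \<open>The transform of an integrable function is bounded, so each Gaussian-weighted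
      square is integrable.\<close>
    define M where "M = ?c * (LINT x|lborel. cmod (f x))"
    show "integrable lborel (\<lambda>\<xi>::real ^ 'n. M\<^sup>2 * gauss (\<xi> /\<^sub>R real (Suc n)))"
      by (intro integrable_mult_right gauss_scaled_integrable) simp
    have "(cmod (fourier_L1 f \<xi>))\<^sup>2 \<le> M\<^sup>2" for \<xi>
      unfolding M_def by (intro power_mono fourier_L1_bound) simp
    then show "AE \<xi> in lborel. norm (a n \<xi>) \<le> norm (M\<^sup>2 * gauss (\<xi> /\<^sub>R real (Suc n)))"
      by (intro AE_I2) (simp add: a_def mult_right_mono del: of_nat_Suc)
  qed (simp add: a_def)
  have a_mono: "mono (\<lambda>n. a n \<xi>)" for \<xi>
  proof (rule monoI)
    fix m n :: nat assume "m \<le> n"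
    then have "norm (\<xi> /\<^sub>R real (Suc n)) \<le> norm (\<xi> /\<^sub>R real (Suc m))"
      by (simp add: mult_right_mono frac_le inverse_eq_divide)
    then have "gauss (\<xi> /\<^sub>R real (Suc m)) \<le> gauss (\<xi> /\<^sub>R real (Suc n))"
      unfolding gauss_def by (simp add: power_mono del: norm_scaleR of_nat_Suc)
    then show "a m \<xi> \<le> a n \<xi>"
      unfolding a_def by (rule mult_left_mono) simp
  qed
  have a_ptw: "(\<lambda>n. a n \<xi>) \<longlonglongrightarrow> (cmod (fourier_L1 f \<xi>))\<^sup>2" for \<xi>
  proof -
    have "(\<lambda>n. \<xi> /\<^sub>R real (Suc n)) \<longlonglongrightarrow> 0"
      using tendsto_scaleR[OF LIMSEQ_inverse_real_of_nat tendsto_const[of \<xi>]] by simp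
    then have "(\<lambda>n. gauss (\<xi> /\<^sub>R real (Suc n))) \<longlonglongrightarrow> exp (- (norm (0 :: real ^ 'n))\<^sup>2 / 2)"
      unfolding gauss_def by (intro tendsto_intros) simp_all
    then show ?thesis
      unfolding a_def using tendsto_mult[OF tendsto_const[of "(cmod (fourier_L1 f \<xi>))\<^sup>2"]] by fastforce
  qed
  show "fourier_L1 f \<in> L2"
  proof (rule L2I)
    show "integrable lborel (\<lambda>\<xi>. (cmod (fourier_L1 f \<xi>))\<^sup>2)"
      by (rule integrable_monotone_convergence[OF a_int _ _ a_lim]) (auto simp: a_mono a_ptw)
  qed measurable
  have "(LINT \<xi>|lborel. (cmod (fourier_L1 f \<xi>))\<^sup>2) = (l2 f)\<^sup>2"
    by (rule integral_monotone_convergence[OF a_int _ _ a_lim]) (auto simp: a_mono a_ptw)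
  then show "l2 (fourier_L1 f) = l2 f"
    by (simp add: l2_def[of "fourier_L1 f"])
qed

section \<open>The Fourier transform on \<open>L\<^sup>2\<close>\<close>

text \<open>Translates between the distance used in \<open>is_fourier_L2\<close> and
  \<open>l2\<close>; the two agree once the functions are known to be in \<open>L2\<close>.\<close>

lemma nn_integral_tendsto_l2:
  assumes "\<And>n. h n \<in> L2"
  shows "(\<lambda>n. \<integral>\<^sup>+ x. ennreal ((cmod (h n x))\<^sup>2) \<partial>lborel) \<longlonglongrightarrow> 0 \<longleftrightarrow> (\<lambda>n::nat. l2 (h n)) \<longlonglongrightarrow> 0"
proof -
  have "(\<lambda>n. \<integral>\<^sup>+ x. ennreal ((cmod (h n x))\<^sup>2) \<partial>lborel) \<longlonglongrightarrow> 0 \<longleftrightarrow> (\<lambda>n. ennreal ((l2 (h n))\<^sup>2)) \<longlonglongrightarrow> ennreal 0"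
    by (simp add: nn_integral_l2 assms)
  also have "\<dots> \<longleftrightarrow> (\<lambda>n. (l2 (h n))\<^sup>2) \<longlonglongrightarrow> 0"
    by (rule tendsto_ennreal_iff) auto
  also have "\<dots> \<longleftrightarrow> (\<lambda>n. l2 (h n)) \<longlonglongrightarrow> 0"
    using l2_tendsto_0I[of h] tendsto_power[of "\<lambda>n. l2 (h n)" 0 sequentially 2] by auto
  finally show ?thesis .
qed

lemma l2_fourier_L1_diff:
  assumes f: "f \<in> L2" "integrable lborel f" and g: "g \<in> L2" "integrable lborel g"
  shows "l2 (\<lambda>\<xi>. fourier_L1 f \<xi> - fourier_L1 g \<xi>) = l2 (\<lambda>x. f x - g x)"
proof -
  have "(\<lambda>\<xi>. fourier_L1 f \<xi> - fourier_L1 g \<xi>) = fourier_L1 (\<lambda>x. f x - g x)"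
    using f g by (simp add: fourier_L1_diff fun_eq_iff)
  then show ?thesis
    using plancherel_L1[OF L2_diff[OF f(1) g(1)]] f g by simp
qed

lemma L2_cauchyI:
  fixes s :: "nat \<Rightarrow> 'a::euclidean_space \<Rightarrow> complex"
  assumes s: "\<And>n. s n \<in> L2" and f: "f \<in> L2" and lim: "(\<lambda>n. l2 (\<lambda>x. s n x - f x)) \<longlonglongrightarrow> 0" and e: "0 < e"
  shows "\<exists>n0. \<forall>m\<ge>n0. \<forall>n\<ge>n0. l2 (\<lambda>x. s m x - s n x) < e"
proof -
  obtain n0 where n0: "\<And>n. n \<ge> n0 \<Longrightarrow> l2 (\<lambda>x. s n x - f x) < e / 2"
    using LIMSEQ_D[OF lim, of "e / 2"] e by auto
  have "l2 (\<lambda>x. s m x - s n x) < e" if "m \<ge> n0" "n \<ge> n0" for m n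
    using l2_diff_triangle[OF s f s, of m n] n0[OF that(1)] n0[OF that(2)] l2_minus_commute[OF f s[of n]]
    by simp
  then show ?thesis by blast
qed

text \<open>By Plancherel the transforms of the truncations form a Cauchy sequence, as the
  truncations do.\<close>

lemma fourier_L2_exists:
  fixes f :: "real ^ 'n \<Rightarrow> complex"
  assumes f: "f \<in> L2"
  shows "\<exists>g. is_fourier_L2 f g"
proof -
  let ?t = "\<lambda>(n::nat) x. indicator (cball 0 (real n)) x * f x"
  note t = L2_truncation[OF f]
  have "\<exists>g\<in>L2. (\<lambda>n. l2 (\<lambda>\<xi>. fourier_L1 (?t n) \<xi> - g \<xi>)) \<longlonglongrightarrow> 0"
  proof (rule L2_complete)
    show "fourier_L1 (?t n) \<in> L2" for n by (rule fourier_L1_L2[OF t(1,2)])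
    show "\<exists>n0. \<forall>m\<ge>n0. \<forall>n\<ge>n0. l2 (\<lambda>\<xi>. fourier_L1 (?t m) \<xi> - fourier_L1 (?t n) \<xi>) < e" if "e > 0" for e
      unfolding l2_fourier_L1_diff[OF t(1,2) t(1,2)] by (rule L2_cauchyI[OF t(1) f t(3) that])
  qed
  then obtain g where g: "g \<in> L2" and lim: "(\<lambda>n. l2 (\<lambda>\<xi>. fourier_L1 (?t n) \<xi> - g \<xi>)) \<longlonglongrightarrow> 0"
    by blast
  have "is_fourier_L2 f g"
    unfolding is_fourier_L2_def using g lim
    by (subst nn_integral_tendsto_l2) (auto intro: L2_diff fourier_L1_L2[OF t(1,2)])
  then show ?thesis by blast
qed

lemma
  fixes f :: "real ^ 'n \<Rightarrow> complex"
  assumes f: "f \<in> L2"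
  shows fourier_L2_L2: "fourier_L2 f \<in> L2"
    and fourier_L2_truncation: "(\<lambda>n::nat. l2 (\<lambda>\<xi>. fourier_L1 (\<lambda>x. indicator (cball 0 (real n)) x * f x) \<xi> - fourier_L2 f \<xi>)) \<longlonglongrightarrow> 0"
proof -
  note t = L2_truncation[OF f]
  have "is_fourier_L2 f (fourier_L2 f)"
    unfolding fourier_L2_def by (rule someI_ex[OF fourier_L2_exists[OF f]])
  then have L: "fourier_L2 f \<in> L2" and lim: "(\<lambda>n::nat. \<integral>\<^sup>+ \<xi>. ennreal ((cmod (fourier_L1 (\<lambda>x. indicator (cball 0 (real n)) x * f x) \<xi> - fourier_L2 f \<xi>))\<^sup>2) \<partial>lborel)
       \<longlonglongrightarrow> 0"
    by (auto simp: is_fourier_L2_def)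
  show "fourier_L2 f \<in> L2" by fact
  show "(\<lambda>n::nat. l2 (\<lambda>\<xi>. fourier_L1 (\<lambda>x. indicator (cball 0 (real n)) x * f x) \<xi> - fourier_L2 f \<xi>)) \<longlonglongrightarrow> 0"
    by (rule nn_integral_tendsto_l2[THEN iffD1, OF _ lim]) (intro L2_diff fourier_L1_L2[OF t(1,2)] L)
qed

lemma l2_tendsto_trans:
  assumes u: "\<And>n. u n \<in> L2" and v: "\<And>n. v n \<in> L2" and f: "f \<in> L2"
    and uv: "(\<lambda>n. l2 (\<lambda>x. u n x - v n x)) \<longlonglongrightarrow> 0" and vf: "(\<lambda>n. l2 (\<lambda>x. v n x - f x)) \<longlonglongrightarrow> 0"
  shows "(\<lambda>n. l2 (\<lambda>x. u n x - f x)) \<longlonglongrightarrow> 0"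
proof (rule Lim_null_comparison[OF always_eventually[OF allI]])
  show "(\<lambda>n. l2 (\<lambda>x. u n x - v n x) + l2 (\<lambda>x. v n x - f x)) \<longlonglongrightarrow> 0"
    using tendsto_add[OF uv vf] by simp
  show "norm (l2 (\<lambda>x. u n x - f x)) \<le> l2 (\<lambda>x. u n x - v n x) + l2 (\<lambda>x. v n x - f x)" for n
    using l2_diff_triangle[OF u v f, of n n] by simp
qed

text \<open>The definition refers to centered truncations only. Other approximants are needed too,
  such as translated truncations, and the isometry shows that they lead to the same limit.\<close>

lemma fourier_L2_limit:
  fixes f :: "real ^ 'n \<Rightarrow> complex"
  assumes f: "f \<in> L2" and s: "\<And>n. s n \<in> L2" "\<And>n. integrable lborel (s n)"
    and lim: "(\<lambda>n. l2 (\<lambda>x. s n x - f x)) \<longlonglongrightarrow> 0"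
  shows "(\<lambda>n. l2 (\<lambda>\<xi>. fourier_L1 (s n) \<xi> - fourier_L2 f \<xi>)) \<longlonglongrightarrow> 0"
proof -
  let ?t = "\<lambda>(n::nat) x. indicator (cball 0 (real n)) x * f x"
  note t = L2_truncation[OF f]
  show ?thesis
  proof (rule l2_tendsto_trans[OF _ _ _ _ fourier_L2_truncation[OF f]])
    have ft: "(\<lambda>n. l2 (\<lambda>x. f x - ?t n x)) \<longlonglongrightarrow> 0"
      using t(3) by (simp only: l2_minus_commute[OF f t(1)])
    have "(\<lambda>n. l2 (\<lambda>x. s n x - ?t n x)) \<longlonglongrightarrow> 0"
    proof (rule Lim_null_comparison[OF always_eventually[OF allI]])
      show "(\<lambda>n. l2 (\<lambda>x. s n x - f x) + l2 (\<lambda>x. f x - ?t n x)) \<longlonglongrightarrow> 0"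
        using tendsto_add[OF lim ft] by simp
      show "norm (l2 (\<lambda>x. s n x - ?t n x)) \<le> l2 (\<lambda>x. s n x - f x) + l2 (\<lambda>x. f x - ?t n x)" for n
        using l2_diff_triangle[OF s(1) f t(1), of n n] by simp
    qed
    then show "(\<lambda>n. l2 (\<lambda>\<xi>. fourier_L1 (s n) \<xi> - fourier_L1 (?t n) \<xi>)) \<longlonglongrightarrow> 0"
      by (simp only: l2_fourier_L1_diff[OF s t(1,2)])
  qed (intro fourier_L1_L2 s t fourier_L2_L2 f)+
qed

text \<open>The pattern for all rules below: verify the identity for integrable approximants and
  pass to the limit. The result holds almost everywhere, since \<open>fourier_L2\<close> is a chosen
  representative.\<close>

lemma fourier_L2_eqI:
  fixes f :: "real ^ 'n \<Rightarrow> complex"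
  assumes f: "f \<in> L2" and s: "\<And>n. s n \<in> L2" "\<And>n. integrable lborel (s n)"
    and lim: "(\<lambda>n. l2 (\<lambda>x. s n x - f x)) \<longlonglongrightarrow> 0"
    and g: "g \<in> L2" and limg: "(\<lambda>n. l2 (\<lambda>\<xi>. fourier_L1 (s n) \<xi> - g \<xi>)) \<longlonglongrightarrow> 0"
  shows "AE \<xi> in lborel. fourier_L2 f \<xi> = g \<xi>"
  by (rule L2_limit_AE_unique[OF fourier_L1_L2[OF s] fourier_L2_L2[OF f] g fourier_L2_limit[OF f s lim] limg])

lemma fourier_L2_L1:
  fixes f :: "real ^ 'n \<Rightarrow> complex"
  assumes f: "f \<in> L2" "integrable lborel f"
  shows "AE \<xi> in lborel. fourier_L2 f \<xi> = fourier_L1 f \<xi>"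
  by (rule fourier_L2_eqI[OF f(1) f]) (simp_all add: fourier_L1_L2 f l2_def)

lemma plancherel:
  fixes f :: "real ^ 'n \<Rightarrow> complex"
  assumes f: "f \<in> L2"
  shows "l2 (fourier_L2 f) = l2 f"
proof -
  let ?t = "\<lambda>(n::nat) x. indicator (cball 0 (real n)) x * f x"
  note t = L2_truncation[OF f]
  have norm_lim: "(\<lambda>n. l2 (s n)) \<longlonglongrightarrow> l2 g"
    if "\<And>n. s n \<in> L2" "g \<in> L2" "(\<lambda>n. l2 (\<lambda>x. s n x - g x)) \<longlonglongrightarrow> 0" for s :: "nat \<Rightarrow> real ^ 'n \<Rightarrow> complex" and g
  proof -
    have "(\<lambda>n. l2 (s n) - l2 g) \<longlonglongrightarrow> 0"
      by (rule Lim_null_comparison[OF always_eventually[OF allI] that(3)])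
        (use l2_diff_bound[OF that(1,2)] in simp)
    then show ?thesis by (simp add: LIM_zero_iff)
  qed
  have "(\<lambda>n. l2 (fourier_L1 (?t n))) \<longlonglongrightarrow> l2 (fourier_L2 f)"
    by (rule norm_lim[OF fourier_L1_L2[OF t(1,2)] fourier_L2_L2[OF f] fourier_L2_truncation[OF f]])
  then have "(\<lambda>n. l2 (?t n)) \<longlonglongrightarrow> l2 (fourier_L2 f)"
    by (simp only: plancherel_L1[OF t(1,2)])
  then show ?thesis
    using norm_lim[OF t(1) f t(3)] LIMSEQ_unique by blast
qed

lemma fourier_L2_add:
  fixes f g :: "real ^ 'n \<Rightarrow> complex"
  assumes f: "f \<in> L2" and g: "g \<in> L2"
  shows "AE \<xi> in lborel. fourier_L2 (\<lambda>x. f x + g x) \<xi> = fourier_L2 f \<xi> + fourier_L2 g \<xi>"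
proof -
  let ?t = "\<lambda>(n::nat) f x. indicator (cball 0 (real n)) x * (f x :: complex)"
  note t = L2_truncation[OF f] L2_truncation[OF g] L2_truncation[OF L2_add[OF f g]]
  note F = fourier_L2_L2[OF f] fourier_L2_L2[OF g]
  have lim: "(\<lambda>n. l2 (\<lambda>x. (u n x + v n x) - (f' x + g' x))) \<longlonglongrightarrow> 0"
    if "\<And>n. u n \<in> L2" "\<And>n. v n \<in> L2" "f' \<in> L2" "g' \<in> L2"
      "(\<lambda>n. l2 (\<lambda>x. u n x - f' x)) \<longlonglongrightarrow> 0" "(\<lambda>n. l2 (\<lambda>x. v n x - g' x)) \<longlonglongrightarrow> 0"
    for u v :: "nat \<Rightarrow> real ^ 'n \<Rightarrow> complex" and f' g'
  proof (rule Lim_null_comparison[OF always_eventually[OF allI]])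
    show "(\<lambda>n. l2 (\<lambda>x. u n x - f' x) + l2 (\<lambda>x. v n x - g' x)) \<longlonglongrightarrow> 0"
      using tendsto_add[OF that(5,6)] by simp
    show "norm (l2 (\<lambda>x. (u n x + v n x) - (f' x + g' x))) \<le> l2 (\<lambda>x. u n x - f' x) + l2 (\<lambda>x. v n x - g' x)" for n
      using l2_triangle[OF L2_diff[OF that(1)[of n] that(3)] L2_diff[OF that(2)[of n] that(4)]]
      by (simp add: algebra_simps)
  qed
  show ?thesis
  proof (rule fourier_L2_eqI[where s = "\<lambda>n x. ?t n f x + ?t n g x"])
    have "fourier_L1 (\<lambda>x. ?t n f x + ?t n g x) \<xi> = fourier_L1 (?t n f) \<xi> + fourier_L1 (?t n g) \<xi>" for n \<xi>
      by (rule fourier_L1_add[OF t(2) t(5)])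
    then show "(\<lambda>n. l2 (\<lambda>\<xi>. fourier_L1 (\<lambda>x. ?t n f x + ?t n g x) \<xi> - (fourier_L2 f \<xi> + fourier_L2 g \<xi>))) \<longlonglongrightarrow> 0"
      by (simp only:) (intro lim fourier_L1_L2 t F fourier_L2_truncation f g)
    show "(\<lambda>n. l2 (\<lambda>x. ?t n f x + ?t n g x - (f x + g x))) \<longlonglongrightarrow> 0"
      by (intro lim t f g)
  qed (intro L2_add f g F t Bochner_Integration.integrable_add)+
qed

lemma fourier_L2_cmult:
  fixes f :: "real ^ 'n \<Rightarrow> complex"
  assumes f: "f \<in> L2"
  shows "AE \<xi> in lborel. fourier_L2 (\<lambda>x. c * f x) \<xi> = c * fourier_L2 f \<xi>"
proof -
  let ?t = "\<lambda>(n::nat) x. indicator (cball 0 (real n)) x * f x"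
  note t = L2_truncation[OF f]
  have lim: "(\<lambda>n. l2 (\<lambda>x. c * u n x - c * f' x)) \<longlonglongrightarrow> 0"
    if "(\<lambda>n. l2 (\<lambda>x. u n x - f' x)) \<longlonglongrightarrow> 0" for u :: "nat \<Rightarrow> real ^ 'n \<Rightarrow> complex" and f'
    using tendsto_mult_right_zero[OF that, of "cmod c"] by (simp only: right_diff_distrib[symmetric] l2_cmult)
  show ?thesis
  proof (rule fourier_L2_eqI[where s = "\<lambda>n x. c * ?t n x"])
    show "(\<lambda>n. l2 (\<lambda>\<xi>. fourier_L1 (\<lambda>x. c * ?t n x) \<xi> - c * fourier_L2 f \<xi>)) \<longlonglongrightarrow> 0"
      unfolding fourier_L1_cmult by (intro lim fourier_L2_truncation f)
    show "(\<lambda>n. l2 (\<lambda>x. c * ?t n x - c * f x)) \<longlonglongrightarrow> 0"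
      by (intro lim t)
  qed (intro L2_cmult f fourier_L2_L2 t integrable_mult_right)+
qed

lemma fourier_L2_diff:
  fixes f g :: "real ^ 'n \<Rightarrow> complex"
  assumes f: "f \<in> L2" and g: "g \<in> L2"
  shows "AE \<xi> in lborel. fourier_L2 (\<lambda>x. f x - g x) \<xi> = fourier_L2 f \<xi> - fourier_L2 g \<xi>"
  using fourier_L2_add[OF f L2_cmult[OF g, of "-1"]] fourier_L2_cmult[OF g, of "-1"]
  by eventually_elim simp

lemma plancherel_diff:
  fixes f g :: "real ^ 'n \<Rightarrow> complex"
  assumes f: "f \<in> L2" and g: "g \<in> L2"
  shows "l2 (\<lambda>\<xi>. fourier_L2 f \<xi> - fourier_L2 g \<xi>) = l2 (\<lambda>x. f x - g x)"
proof -
  have "l2 (\<lambda>\<xi>. fourier_L2 f \<xi> - fourier_L2 g \<xi>) = l2 (fourier_L2 (\<lambda>x. f x - g x))"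
    using fourier_L2_diff[OF f g]
    by (intro l2_cong_AE L2_measurable L2_diff fourier_L2_L2 f g) auto
  then show ?thesis by (simp add: plancherel L2_diff f g)
qed

lemma fourier_L2_shift:
  fixes f :: "real ^ 'n \<Rightarrow> complex"
  assumes f: "f \<in> L2"
  shows "AE \<xi> in lborel. fourier_L2 (\<lambda>x. f (x - y)) \<xi> = cis (- (y \<bullet> \<xi>)) * fourier_L2 f \<xi>"
proof -
  let ?t = "\<lambda>(n::nat) x. indicator (cball 0 (real n)) x * f x"
  note t = L2_truncation[OF f]
  have cis_L2: "(\<lambda>\<xi>. cis (- (y \<bullet> \<xi>)) * g \<xi>) \<in> L2" if "g \<in> L2" for g :: "real ^ 'n \<Rightarrow> complex"
    by (rule L2_bounded_mult[OF that, where C = 1]) auto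
  show ?thesis
  proof (rule fourier_L2_eqI[where s = "\<lambda>n x. ?t n (x - y)"])
    show "(\<lambda>x. f (x - y)) \<in> L2" by (rule L2_shift[OF f])
    show "(\<lambda>x. ?t n (x - y)) \<in> L2" for n by (rule L2_shift(1)[OF t(1)])
    show "integrable lborel (\<lambda>x. ?t n (x - y))" for n
      using integrable_lborel_shift(3)[of "?t n" y] t(2)[of n] L2_measurable[OF t(1)] by blast
    show "(\<lambda>n. l2 (\<lambda>x. ?t n (x - y) - f (x - y))) \<longlonglongrightarrow> 0"
      using t(3) by (simp only: L2_shift(2)[OF L2_diff[OF t(1) f]])
    show "(\<lambda>\<xi>. cis (- (y \<bullet> \<xi>)) * fourier_L2 f \<xi>) \<in> L2"
      by (rule cis_L2[OF fourier_L2_L2[OF f]])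
    have eq: "fourier_L1 (\<lambda>x. ?t n (x - y)) \<xi> - cis (- (y \<bullet> \<xi>)) * fourier_L2 f \<xi>
        = cis (- (y \<bullet> \<xi>)) * (fourier_L1 (?t n) \<xi> - fourier_L2 f \<xi>)" for n \<xi>
      unfolding fourier_L1_shift[OF L2_measurable[OF t(1)]] by (rule right_diff_distrib[symmetric])
    have "l2 (\<lambda>\<xi>. cis (- (y \<bullet> \<xi>)) * g \<xi>) = l2 g" for g :: "real ^ 'n \<Rightarrow> complex"
      by (simp add: l2_def norm_mult)
    then show "(\<lambda>n. l2 (\<lambda>\<xi>. fourier_L1 (\<lambda>x. ?t n (x - y)) \<xi> - cis (- (y \<bullet> \<xi>)) * fourier_L2 f \<xi>)) \<longlonglongrightarrow> 0"
      unfolding eq using fourier_L2_truncation[OF f] by simp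
  qed
qed

lemma fourier_L2_multiplication:
  fixes f g :: "real ^ 'n \<Rightarrow> complex"
  assumes f: "f \<in> L2" and g: "g \<in> L2"
  shows "(LINT \<xi>|lborel. fourier_L2 f \<xi> * g \<xi>) = (LINT x|lborel. f x * fourier_L2 g x)"
proof -
  let ?t = "\<lambda>(n::nat) f x. indicator (cball 0 (real n)) x * (f x :: complex)"
  note tf = L2_truncation[OF f] and tg = L2_truncation[OF g]
  have "(\<lambda>n. LINT \<xi>|lborel. fourier_L1 (?t n f) \<xi> * ?t n g \<xi>) \<longlonglongrightarrow> (LINT \<xi>|lborel. fourier_L2 f \<xi> * g \<xi>)"
    by (rule L2_mult_tendsto[OF fourier_L1_L2[OF tf(1,2)] tg(1) fourier_L2_L2[OF f] g fourier_L2_truncation[OF f] tg(3)])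
  moreover have "(\<lambda>n. LINT x|lborel. ?t n f x * fourier_L1 (?t n g) x) \<longlonglongrightarrow> (LINT x|lborel. f x * fourier_L2 g x)"
    by (rule L2_mult_tendsto[OF tf(1) fourier_L1_L2[OF tg(1,2)] f fourier_L2_L2[OF g] tf(3) fourier_L2_truncation[OF g]])
  ultimately show ?thesis
    unfolding fourier_L1_multiplication[OF tf(2) tg(2)] by (rule LIMSEQ_unique)
qed

section \<open>The inverse transform\<close>

definition fourier_inv_L2 :: "(real ^ 'n \<Rightarrow> complex) \<Rightarrow> real ^ 'n \<Rightarrow> complex" where
  "fourier_inv_L2 g x = cnj (fourier_L2 (\<lambda>\<xi>. cnj (g \<xi>)) x)"

lemma fourier_inv_L2_L2: "g \<in> L2 \<Longrightarrow> fourier_inv_L2 g \<in> L2"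
  unfolding fourier_inv_L2_def[abs_def] by (intro L2_cnj fourier_L2_L2)

lemma l2_fourier_inv_L2: "g \<in> L2 \<Longrightarrow> l2 (fourier_inv_L2 g) = l2 g"
  unfolding fourier_inv_L2_def[abs_def] by (simp add: l2_cnj plancherel L2_cnj)

text \<open>By the multiplication formula \<open>fourier_inv_L2\<close> is the adjoint of the Fourier transform.
  Being an isometry itself, it is a right inverse.\<close>

lemma fourier_L2_inv:
  fixes g :: "real ^ 'n \<Rightarrow> complex"
  assumes g: "g \<in> L2"
  shows "AE \<xi> in lborel. fourier_L2 (fourier_inv_L2 g) \<xi> = g \<xi>"
proof -
  let ?h = "fourier_L2 (fourier_inv_L2 g)"
  have h: "?h \<in> L2" by (intro fourier_L2_L2 fourier_inv_L2_L2 g)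
  have "(LINT \<xi>|lborel. ?h \<xi> * cnj (g \<xi>)) = (LINT x|lborel. fourier_inv_L2 g x * fourier_L2 (\<lambda>\<xi>. cnj (g \<xi>)) x)"
    by (rule fourier_L2_multiplication[OF fourier_inv_L2_L2[OF g] L2_cnj[OF g]])
  also have "\<dots> = (LINT x|lborel. of_real ((cmod (fourier_L2 (\<lambda>\<xi>. cnj (g \<xi>)) x))\<^sup>2))"
    unfolding fourier_inv_L2_def complex_norm_square by (simp only: mult.commute)
  also have "\<dots> = of_real ((l2 (fourier_L2 (\<lambda>\<xi>. cnj (g \<xi>))))\<^sup>2)"
    unfolding l2_sq by (rule integral_complex_of_real)
  also have "l2 (fourier_L2 (\<lambda>\<xi>. cnj (g \<xi>))) = l2 g"
    by (simp add: plancherel L2_cnj g l2_cnj)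
  finally have "Re (LINT \<xi>|lborel. ?h \<xi> * cnj (g \<xi>)) = (l2 g)\<^sup>2"
    by simp
  \<comment> \<open>Both norms equal \<open>l2 g\<close> by isometry, and so does the square root of
    the inner product; the expanded square cancels to 0.\<close>
  then have "(l2 (\<lambda>\<xi>. ?h \<xi> - g \<xi>))\<^sup>2 = 0"
    using L2.N_diff_sq[OF h g]
    by (simp add: L2_N plancherel fourier_inv_L2_L2 g l2_fourier_inv_L2)
  then have "l2 (\<lambda>\<xi>. ?h \<xi> - g \<xi>) = 0" by simp
  from L2_eq_0_AE[OF L2_diff[OF h g] this] show ?thesis by simp
qed

lemma L2_zero: "(\<lambda>x. 0) \<in> L2"
  by (rule L2I) auto

text \<open>Unlike \<open>fourier_inv_L2\<close>, this is a definite integral at every point and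
  does not depend on a choice of representative of its result.\<close>

definition fourier_inv_L1 :: "(real ^ 'n \<Rightarrow> complex) \<Rightarrow> real ^ 'n \<Rightarrow> complex" where
  "fourier_inv_L1 g x = cnj (fourier_L1 (\<lambda>\<xi>. cnj (g \<xi>)) x)"

lemma
  fixes g :: "real ^ 'n \<Rightarrow> complex"
  assumes g: "g \<in> L2" "integrable lborel g"
  shows fourier_inv_L1_L2: "fourier_inv_L1 g \<in> L2"
    and l2_fourier_inv_L1: "l2 (fourier_inv_L1 g) = l2 g"
    and fourier_L2_inv_L1: "AE \<xi> in lborel. fourier_L2 (fourier_inv_L1 g) \<xi> = g \<xi>"
proof -
  have c: "(\<lambda>\<xi>. cnj (g \<xi>)) \<in> L2" "integrable lborel (\<lambda>\<xi>. cnj (g \<xi>))"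
    using g by (simp_all add: L2_cnj)
  show L: "fourier_inv_L1 g \<in> L2"
    unfolding fourier_inv_L1_def[abs_def] by (intro L2_cnj fourier_L1_L2 c)
  show "l2 (fourier_inv_L1 g) = l2 g"
    unfolding fourier_inv_L1_def[abs_def] by (simp only: l2_cnj plancherel_L1[OF c])
  have "AE x in lborel. fourier_inv_L1 g x = fourier_inv_L2 g x"
    using fourier_L2_L1[OF c] by eventually_elim (simp add: fourier_inv_L1_def fourier_inv_L2_def)
  then have "l2 (\<lambda>x. fourier_inv_L1 g x - fourier_inv_L2 g x) = l2 (\<lambda>x::real ^ 'n. 0)"
    by (intro l2_cong_AE L2_measurable L2_diff L fourier_inv_L2_L2 g L2_zero) auto
  then have "l2 (\<lambda>\<xi>. fourier_L2 (fourier_inv_L1 g) \<xi> - fourier_L2 (fourier_inv_L2 g) \<xi>) = 0"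
    using plancherel_diff[OF L fourier_inv_L2_L2[OF g(1)]] by (simp add: l2_def)
  from L2_eq_0_AE[OF L2_diff[OF fourier_L2_L2[OF L] fourier_L2_L2[OF fourier_inv_L2_L2[OF g(1)]]] this]
    fourier_L2_inv[OF g(1)]
  show "AE \<xi> in lborel. fourier_L2 (fourier_inv_L1 g) \<xi> = g \<xi>"
    by eventually_elim simp
qed

section \<open>Sobolev spaces\<close>

text \<open>The Fourier transform of the Bessel operator of order \<alpha> applied to
  \<open>f\<close>. It embeds the Sobolev space isometrically into \<open>L2\<close>.\<close>

definition bessel :: "real \<Rightarrow> (real ^ 'n \<Rightarrow> complex) \<Rightarrow> real ^ 'n \<Rightarrow> complex" where
  "bessel \<alpha> f \<xi> = of_real ((1 + (norm \<xi>)\<^sup>2) powr (\<alpha> / 2)) * fourier_L2 f \<xi>"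

lemma sobolevD:
  assumes "f \<in> sobolev K \<alpha>"
  shows "f \<in> L2" and "range f \<subseteq> K" and "bessel \<alpha> f \<in> L2"
  using assms by (auto simp: sobolev_def bessel_def[abs_def])

lemma sobolevI: "f \<in> L2 \<Longrightarrow> range f \<subseteq> K \<Longrightarrow> bessel \<alpha> f \<in> L2 \<Longrightarrow> f \<in> sobolev K \<alpha>"
  by (simp add: sobolev_def bessel_def[abs_def])

lemma sobolev_norm_eq: "sobolev_norm \<alpha> f = l2 (bessel \<alpha> f)"
proof -
  have "(cmod (bessel \<alpha> f \<xi>))\<^sup>2 = (1 + (norm \<xi>)\<^sup>2) powr \<alpha> * (cmod (fourier_L2 f \<xi>))\<^sup>2" for \<xi>
  proof -
    have "((1 + (norm \<xi>)\<^sup>2) powr (\<alpha> / 2))\<^sup>2 = (1 + (norm \<xi>)\<^sup>2) powr \<alpha>"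
      by (simp add: power2_eq_square flip: powr_add)
    then show ?thesis
      by (simp add: bessel_def norm_mult power_mult_distrib)
  qed
  then show ?thesis by (simp add: sobolev_norm_def l2_def)
qed

lemma bessel_measurable:
  assumes "f \<in> L2" shows "bessel \<alpha> f \<in> borel_measurable borel"
proof -
  have [measurable]: "fourier_L2 f \<in> borel_measurable borel"
    by (intro L2_measurable fourier_L2_L2 assms)
  show ?thesis unfolding bessel_def[abs_def] by measurable
qed

lemma
  assumes f: "f \<in> L2" and g: "g \<in> L2"
  shows bessel_add: "AE \<xi> in lborel. bessel \<alpha> (\<lambda>x. f x + g x) \<xi> = bessel \<alpha> f \<xi> + bessel \<alpha> g \<xi>"
    and bessel_diff: "AE \<xi> in lborel. bessel \<alpha> (\<lambda>x. f x - g x) \<xi> = bessel \<alpha> f \<xi> - bessel \<alpha> g \<xi>"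
    and bessel_cmult: "AE \<xi> in lborel. bessel \<alpha> (\<lambda>x. c * f x) \<xi> = c * bessel \<alpha> f \<xi>"
    and bessel_shift: "AE \<xi> in lborel. bessel \<alpha> (\<lambda>x. f (x - y)) \<xi> = cis (- (y \<bullet> \<xi>)) * bessel \<alpha> f \<xi>"
proof -
  show "AE \<xi> in lborel. bessel \<alpha> (\<lambda>x. f x + g x) \<xi> = bessel \<alpha> f \<xi> + bessel \<alpha> g \<xi>"
    using fourier_L2_add[OF f g] by eventually_elim (simp add: bessel_def ring_distribs)
  show "AE \<xi> in lborel. bessel \<alpha> (\<lambda>x. f x - g x) \<xi> = bessel \<alpha> f \<xi> - bessel \<alpha> g \<xi>"
    using fourier_L2_diff[OF f g] by eventually_elim (simp add: bessel_def ring_distribs)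
  show "AE \<xi> in lborel. bessel \<alpha> (\<lambda>x. c * f x) \<xi> = c * bessel \<alpha> f \<xi>"
    using fourier_L2_cmult[OF f, of c] by eventually_elim (simp add: bessel_def)
  show "AE \<xi> in lborel. bessel \<alpha> (\<lambda>x. f (x - y)) \<xi> = cis (- (y \<bullet> \<xi>)) * bessel \<alpha> f \<xi>"
    using fourier_L2_shift[OF f, of y] by eventually_elim (simp add: bessel_def)
qed

lemma l2_mono:
  assumes g: "g \<in> L2" and [measurable]: "f \<in> borel_measurable borel"
    and le: "\<And>x. cmod (f x) \<le> C * cmod (g x)" and C: "0 \<le> C"
  shows "f \<in> L2" and "l2 f \<le> C * l2 g"
proof -
  have sq: "(cmod (f x))\<^sup>2 \<le> C\<^sup>2 * (cmod (g x))\<^sup>2" for x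
    using power_mono[OF le[of x], of 2] by (simp add: power_mult_distrib)
  have int: "integrable lborel (\<lambda>x. C\<^sup>2 * (cmod (g x))\<^sup>2)"
    by (intro integrable_mult_right L2_integrable g)
  show f: "f \<in> L2"
  proof (rule L2I)
    show "integrable lborel (\<lambda>x. (cmod (f x))\<^sup>2)"
      by (rule Bochner_Integration.integrable_bound[OF int]) (use sq in auto)
  qed simp
  have "(l2 f)\<^sup>2 \<le> (LINT x|lborel. C\<^sup>2 * (cmod (g x))\<^sup>2)"
    unfolding l2_sq by (intro integral_mono L2_integrable f int sq)
  also have "\<dots> = (C * l2 g)\<^sup>2"
    by (simp add: l2_sq power_mult_distrib)
  finally show "l2 f \<le> C * l2 g"
    by (rule power2_le_imp_le) (simp add: C)
qed

lemma bessel_weight_ge_1: "0 < \<alpha> \<Longrightarrow> 1 \<le> (1 + (norm \<xi>)\<^sup>2) powr (\<alpha> / 2)"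
  by (intro ge_one_powr_ge_zero) auto

lemma l2_le_sobolev_norm:
  assumes "f \<in> L2" "bessel \<alpha> f \<in> L2" "0 < \<alpha>"
  shows "l2 f \<le> sobolev_norm \<alpha> f"
proof -
  have "l2 (fourier_L2 f) \<le> 1 * l2 (bessel \<alpha> f)"
  proof (rule l2_mono)
    show "cmod (fourier_L2 f \<xi>) \<le> 1 * cmod (bessel \<alpha> f \<xi>)" for \<xi>
      using mult_right_mono[OF bessel_weight_ge_1[OF assms(3), of \<xi>] norm_ge_zero[of "fourier_L2 f \<xi>"]]
      by (simp add: bessel_def norm_mult)
  qed (use assms in \<open>auto intro: L2_measurable fourier_L2_L2\<close>)
  then show ?thesis by (simp add: plancherel assms sobolev_norm_eq)
qed

definition sobolev_inner :: "real \<Rightarrow> (real ^ 'n \<Rightarrow> complex) \<Rightarrow> (real ^ 'n \<Rightarrow> complex) \<Rightarrow> real" where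
  "sobolev_inner \<alpha> f g = Re (LINT \<xi>|lborel. bessel \<alpha> f \<xi> * cnj (bessel \<alpha> g \<xi>))"

definition real_scalars :: "complex set \<Rightarrow> bool" where
  "real_scalars K \<longleftrightarrow> K = \<real> \<or> K = UNIV"

lemma sobolev_add:
  assumes K: "real_scalars K" and f: "f \<in> sobolev K \<alpha>" and g: "g \<in> sobolev K \<alpha>"
  shows "(\<lambda>x. f x + g x) \<in> sobolev K \<alpha>"
proof (rule sobolevI)
  note fD = sobolevD[OF f] and gD = sobolevD[OF g]
  show fg: "(\<lambda>x. f x + g x) \<in> L2" by (intro L2_add fD gD)
  show "range (\<lambda>x. f x + g x) \<subseteq> K"
    using K fD(2) gD(2) by (auto simp: real_scalars_def intro!: Reals_add)
  show "bessel \<alpha> (\<lambda>x. f x + g x) \<in> L2"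
  proof (rule L2_cong_AE[OF L2_add[OF fD(3) gD(3)] bessel_measurable[OF fg]])
    show "AE \<xi> in lborel. bessel \<alpha> f \<xi> + bessel \<alpha> g \<xi> = bessel \<alpha> (\<lambda>x. f x + g x) \<xi>"
      using bessel_add[OF fD(1) gD(1), where \<alpha> = \<alpha>] by eventually_elim simp
  qed
qed

lemma sobolev_scale:
  assumes K: "real_scalars K" and f: "f \<in> sobolev K \<alpha>"
  shows "(\<lambda>x. of_real c * f x) \<in> sobolev K \<alpha>"
proof (rule sobolevI)
  note fD = sobolevD[OF f]
  show cf: "(\<lambda>x. of_real c * f x) \<in> L2" by (intro L2_cmult fD)
  show "range (\<lambda>x. of_real c * f x) \<subseteq> K"
    using K fD(2) by (auto simp: real_scalars_def intro!: Reals_mult)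
  show "bessel \<alpha> (\<lambda>x. of_real c * f x) \<in> L2"
  proof (rule L2_cong_AE[OF L2_cmult[OF fD(3)] bessel_measurable[OF cf]])
    show "AE \<xi> in lborel. of_real c * bessel \<alpha> f \<xi> = bessel \<alpha> (\<lambda>x. of_real c * f x) \<xi>"
      using bessel_cmult[OF fD(1) fD(1), where \<alpha> = \<alpha> and c = "of_real c"] by eventually_elim simp
  qed
qed

lemma sobolev_diff:
  assumes K: "real_scalars K" and f: "f \<in> sobolev K \<alpha>" and g: "g \<in> sobolev K \<alpha>"
  shows "(\<lambda>x. f x - g x) \<in> sobolev K \<alpha>"
  using sobolev_add[OF K f sobolev_scale[OF K g, of "-1"]] by simp

text \<open>Translation multiplies the transform by a function of modulus 1, which commutes with the
  weight. This makes the standard norm invariant under all translations.\<close>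

lemma sobolev_shift:
  assumes f: "f \<in> sobolev K \<alpha>"
  shows "(\<lambda>x. f (x - y)) \<in> sobolev K \<alpha>" and "sobolev_norm \<alpha> (\<lambda>x. f (x - y)) = sobolev_norm \<alpha> f"
proof -
  note fD = sobolevD[OF f]
  have sf: "(\<lambda>x. f (x - y)) \<in> L2" by (intro L2_shift fD)
  have cb: "(\<lambda>\<xi>. cis (- (y \<bullet> \<xi>)) * bessel \<alpha> f \<xi>) \<in> L2"
    by (rule L2_bounded_mult[OF fD(3), where C = 1]) auto
  have ae: "AE \<xi> in lborel. cis (- (y \<bullet> \<xi>)) * bessel \<alpha> f \<xi> = bessel \<alpha> (\<lambda>x. f (x - y)) \<xi>"
    using bessel_shift[OF fD(1) fD(1), where \<alpha> = \<alpha> and y = y] by eventually_elim simp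
  show "(\<lambda>x. f (x - y)) \<in> sobolev K \<alpha>"
  proof (rule sobolevI[OF sf])
    show "range (\<lambda>x. f (x - y)) \<subseteq> K" using fD(2) by auto
    show "bessel \<alpha> (\<lambda>x. f (x - y)) \<in> L2"
      by (rule L2_cong_AE[OF cb bessel_measurable[OF sf] ae])
  qed
  have "l2 (bessel \<alpha> (\<lambda>x. f (x - y))) = l2 (\<lambda>\<xi>. cis (- (y \<bullet> \<xi>)) * bessel \<alpha> f \<xi>)"
    using ae by (intro l2_cong_AE bessel_measurable sf L2_measurable[OF cb]) auto
  then show "sobolev_norm \<alpha> (\<lambda>x. f (x - y)) = sobolev_norm \<alpha> f"
    by (simp add: sobolev_norm_eq l2_def norm_mult)
qed

lemma semi_inner_sobolev:
  assumes K: "real_scalars K"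
  shows "semi_inner (sobolev K \<alpha> :: (real ^ 'n \<Rightarrow> complex) set) (sobolev_inner \<alpha>)"
proof
  fix f g :: "real ^ 'n \<Rightarrow> complex"
  assume f: "f \<in> sobolev K \<alpha>" and g: "g \<in> sobolev K \<alpha>"
  note fD = sobolevD[OF f] and gD = sobolevD[OF g]
  show "(\<lambda>x. f x + g x) \<in> sobolev K \<alpha>" by (rule sobolev_add[OF K f g])
  show "sobolev_inner \<alpha> f g = sobolev_inner \<alpha> g f"
    unfolding sobolev_inner_def by (rule L2.sym[OF fD(3) gD(3)])
  fix c
  show "(\<lambda>x. of_real c * f x) \<in> sobolev K \<alpha>" by (rule sobolev_scale[OF K f])
  note cfD = sobolevD[OF sobolev_scale[OF K f, of c]]
  note [measurable] = L2_measurable[OF fD(3)] L2_measurable[OF gD(3)] L2_measurable[OF cfD(3)]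
  have "sobolev_inner \<alpha> (\<lambda>x. of_real c * f x) g = Re (LINT \<xi>|lborel. (of_real c * bessel \<alpha> f \<xi>) * cnj (bessel \<alpha> g \<xi>))"
    unfolding sobolev_inner_def
  proof (intro arg_cong[where f = Re] integral_cong_AE)
    show "AE \<xi> in lborel. bessel \<alpha> (\<lambda>x. of_real c * f x) \<xi> * cnj (bessel \<alpha> g \<xi>) = (of_real c * bessel \<alpha> f \<xi>) * cnj (bessel \<alpha> g \<xi>)"
      using bessel_cmult[OF fD(1) fD(1), where \<alpha> = \<alpha> and c = "of_real c"] by eventually_elim simp
  qed measurable
  then show "sobolev_inner \<alpha> (\<lambda>x. of_real c * f x) g = c * sobolev_inner \<alpha> f g"
    unfolding sobolev_inner_def[of \<alpha> f g] using L2.scale_left[OF fD(3) gD(3)] by simp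
next
  fix f g h :: "real ^ 'n \<Rightarrow> complex"
  assume f: "f \<in> sobolev K \<alpha>" and g: "g \<in> sobolev K \<alpha>" and h: "h \<in> sobolev K \<alpha>"
  note fD = sobolevD[OF f] and gD = sobolevD[OF g] and hD = sobolevD[OF h]
    and fgD = sobolevD[OF sobolev_add[OF K f g]]
  note [measurable] = L2_measurable[OF fD(3)] L2_measurable[OF gD(3)] L2_measurable[OF hD(3)] L2_measurable[OF fgD(3)]
  have "sobolev_inner \<alpha> (\<lambda>x. f x + g x) h = Re (LINT \<xi>|lborel. (bessel \<alpha> f \<xi> + bessel \<alpha> g \<xi>) * cnj (bessel \<alpha> h \<xi>))"
    unfolding sobolev_inner_def
  proof (intro arg_cong[where f = Re] integral_cong_AE)
    show "AE \<xi> in lborel. bessel \<alpha> (\<lambda>x. f x + g x) \<xi> * cnj (bessel \<alpha> h \<xi>) = (bessel \<alpha> f \<xi> + bessel \<alpha> g \<xi>) * cnj (bessel \<alpha> h \<xi>)"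
      using bessel_add[OF fD(1) gD(1), where \<alpha> = \<alpha>] by eventually_elim simp
  qed measurable
  then show "sobolev_inner \<alpha> (\<lambda>x. f x + g x) h = sobolev_inner \<alpha> f h + sobolev_inner \<alpha> g h"
    unfolding sobolev_inner_def[of \<alpha> f h] sobolev_inner_def[of \<alpha> g h]
    using L2.add_left[OF fD(3) gD(3) hD(3)] by simp
next
  fix f :: "real ^ 'n \<Rightarrow> complex"
  assume f: "f \<in> sobolev K \<alpha>"
  show "0 \<le> sobolev_inner \<alpha> f f"
    unfolding sobolev_inner_def by (rule L2.nonneg[OF sobolevD(3)[OF f]])
qed

lemma sobolev_inner_self: "sqrt (sobolev_inner \<alpha> f f) = sobolev_norm \<alpha> f"
  unfolding sobolev_norm_eq L2_N[symmetric] L2.N_def sobolev_inner_def ..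

lemma sobolev_norm_diff:
  assumes f: "f \<in> sobolev K \<alpha>" and g: "g \<in> sobolev K \<alpha>"
  shows "sobolev_norm \<alpha> (\<lambda>x. f x - g x) = l2 (\<lambda>\<xi>. bessel \<alpha> f \<xi> - bessel \<alpha> g \<xi>)"
  unfolding sobolev_norm_eq using bessel_diff[OF sobolevD(1)[OF f] sobolevD(1)[OF g]]
  by (intro l2_cong_AE bessel_measurable L2_measurable L2_diff sobolevD(1,3)[OF f] sobolevD(1,3)[OF g]) auto

text \<open>The functions and their weighted transforms both converge in \<open>L2\<close>. The two
  limits correspond because division by the weight, which is at least 1, is a contraction of
  \<open>L2\<close>.\<close>

lemma sobolev_complete:
  fixes s :: "nat \<Rightarrow> real ^ 'n \<Rightarrow> complex"
  assumes K: "real_scalars K" and \<alpha>: "0 < \<alpha>" and s: "\<And>n. s n \<in> sobolev K \<alpha>"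
    and cauchy: "\<And>e. e > 0 \<Longrightarrow> \<exists>n0. \<forall>m\<ge>n0. \<forall>n\<ge>n0. sobolev_norm \<alpha> (\<lambda>x. s m x - s n x) < e"
  shows "\<exists>w\<in>sobolev K \<alpha>. (\<lambda>n. sobolev_norm \<alpha> (\<lambda>x. s n x - w x)) \<longlonglongrightarrow> 0"
proof -
  note sD = sobolevD[OF s]
  have "\<exists>v\<in>L2. (\<lambda>n. l2 (\<lambda>x. bessel \<alpha> (s n) x - v x)) \<longlonglongrightarrow> 0"
    by (rule L2_complete[OF sD(3)]) (use cauchy in \<open>simp only: sobolev_norm_diff[OF s s]\<close>)
  then obtain v where v: "v \<in> L2" and vlim: "(\<lambda>n. l2 (\<lambda>x. bessel \<alpha> (s n) x - v x)) \<longlonglongrightarrow> 0" by blast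
  have "\<exists>u\<in>L2. (\<lambda>n. l2 (\<lambda>x. s n x - u x)) \<longlonglongrightarrow> 0"
  proof (rule L2_complete[OF sD(1)])
    fix e :: real assume "e > 0"
    then obtain n0 where n0: "\<And>m n. m \<ge> n0 \<Longrightarrow> n \<ge> n0 \<Longrightarrow> sobolev_norm \<alpha> (\<lambda>x. s m x - s n x) < e"
      using cauchy by blast
    have "l2 (\<lambda>x. s m x - s n x) \<le> sobolev_norm \<alpha> (\<lambda>x. s m x - s n x)" for m n
      using sobolevD[OF sobolev_diff[OF K s s]] by (intro l2_le_sobolev_norm \<alpha>) auto
    then show "\<exists>n0. \<forall>m\<ge>n0. \<forall>n\<ge>n0. l2 (\<lambda>x. s m x - s n x) < e"
      using n0 le_less_trans by blast
  qed
  then obtain u0 where u0: "u0 \<in> L2" and u0lim: "(\<lambda>n. l2 (\<lambda>x. s n x - u0 x)) \<longlonglongrightarrow> 0" by blast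
  \<comment> \<open>An \<open>L2\<close> limit of real functions is real only almost everywhere,
    whereas membership demands values in \<open>K\<close> everywhere; taking real parts repairs the
    representative and does not increase the distance.\<close>
  define u where "u = (if K = UNIV then u0 else (\<lambda>x. of_real (Re (u0 x))))"
  have u: "u \<in> L2"
  proof (cases "K = UNIV")
    case False
    have [measurable]: "u0 \<in> borel_measurable borel" using u0 by (rule L2_measurable)
    show ?thesis unfolding u_def
      by (simp add: False, rule l2_mono(1)[OF u0, where C = 1]) (auto simp: abs_Re_le_cmod)
  qed (simp add: u_def u0)
  have uK: "range u \<subseteq> K"
    using K by (auto simp: u_def real_scalars_def)
  have le: "l2 (\<lambda>x. s n x - u x) \<le> 1 * l2 (\<lambda>x. s n x - u0 x)" for n
  proof (rule l2_mono(2)[OF L2_diff[OF sD(1) u0] L2_measurable[OF L2_diff[OF sD(1) u]]])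
    show "cmod (s n x - u x) \<le> 1 * cmod (s n x - u0 x)" for x
    proof (cases "K = UNIV")
      case False
      then have "s n x \<in> \<real>" using sD(2)[of n] K by (auto simp: real_scalars_def)
      then have "s n x - u x = of_real (Re (s n x - u0 x))"
        using False by (simp add: u_def)
      then have "cmod (s n x - u x) = \<bar>Re (s n x - u0 x)\<bar>"
        by (simp only: norm_of_real)
      then show ?thesis using abs_Re_le_cmod[of "s n x - u0 x"] by simp
    qed (simp add: u_def)
  qed simp
  have ulim: "(\<lambda>n. l2 (\<lambda>x. s n x - u x)) \<longlonglongrightarrow> 0"
    by (rule Lim_null_comparison[OF always_eventually[OF allI] u0lim]) (use le in simp)
  let ?w = "\<lambda>\<xi>::real ^ 'n. (1 + (norm \<xi>)\<^sup>2) powr (\<alpha> / 2)"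
  have w1: "1 \<le> ?w \<xi>" for \<xi> by (rule bessel_weight_ge_1[OF \<alpha>])
  have w0: "?w \<xi> \<noteq> 0" for \<xi> :: "real ^ 'n" using w1[of \<xi>] by linarith
  define v' where "v' = (\<lambda>\<xi>. of_real (inverse (?w \<xi>)) * v \<xi>)"
  have inv: "l2 (\<lambda>\<xi>. of_real (inverse (?w \<xi>)) * g \<xi>) \<le> 1 * l2 g" "(\<lambda>\<xi>. of_real (inverse (?w \<xi>)) * g \<xi>) \<in> L2"
    if g: "g \<in> L2" for g :: "real ^ 'n \<Rightarrow> complex"
  proof -
    have b: "cmod (of_real (inverse (?w \<xi>))) \<le> 1" for \<xi> :: "real ^ 'n"
      using w1[of \<xi>] by (simp only: norm_of_real) (simp add: inverse_le_1_iff)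
    show "l2 (\<lambda>\<xi>. of_real (inverse (?w \<xi>)) * g \<xi>) \<le> 1 * l2 g" "(\<lambda>\<xi>. of_real (inverse (?w \<xi>)) * g \<xi>) \<in> L2"
      using L2_bounded_mult[OF g _ b] by simp_all
  qed
  have "AE \<xi> in lborel. fourier_L2 u \<xi> = v' \<xi>"
  proof (rule L2_limit_AE_unique)
    show "fourier_L2 (s n) \<in> L2" for n by (intro fourier_L2_L2 sD)
    show "fourier_L2 u \<in> L2" by (intro fourier_L2_L2 u)
    show "v' \<in> L2" unfolding v'_def by (rule inv(2)[OF v])
    show "(\<lambda>n. l2 (\<lambda>x. fourier_L2 (s n) x - fourier_L2 u x)) \<longlonglongrightarrow> 0"
      using ulim by (simp only: plancherel_diff[OF sD(1) u])
    show "(\<lambda>n. l2 (\<lambda>x. fourier_L2 (s n) x - v' x)) \<longlonglongrightarrow> 0"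
    proof (rule Lim_null_comparison[OF always_eventually[OF allI] vlim])
      fix n
      have "fourier_L2 (s n) \<xi> - v' \<xi> = of_real (inverse (?w \<xi>)) * (bessel \<alpha> (s n) \<xi> - v \<xi>)" for \<xi>
        using w0[of \<xi>] by (simp add: v'_def bessel_def right_diff_distrib flip: mult.assoc of_real_mult)
      then show "norm (l2 (\<lambda>x. fourier_L2 (s n) x - v' x)) \<le> l2 (\<lambda>x. bessel \<alpha> (s n) x - v x)"
        using inv(1)[OF L2_diff[OF sD(3) v]] by simp
    qed
  qed
  then have ae: "AE \<xi> in lborel. v \<xi> = bessel \<alpha> u \<xi>"
  proof eventually_elim
    case (elim \<xi>)
    then show ?case
      using w0[of \<xi>] by (simp add: bessel_def v'_def flip: mult.assoc of_real_mult)
  qed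
  have bu: "bessel \<alpha> u \<in> L2"
    by (rule L2_cong_AE[OF v bessel_measurable[OF u] ae])
  have uS: "u \<in> sobolev K \<alpha>" by (rule sobolevI[OF u uK bu])
  have "sobolev_norm \<alpha> (\<lambda>x. s n x - u x) = l2 (\<lambda>x. bessel \<alpha> (s n) x - v x)" for n
    unfolding sobolev_norm_diff[OF s uS] using ae
    by (intro l2_cong_AE L2_measurable L2_diff sD bu v) auto
  then have "(\<lambda>n. sobolev_norm \<alpha> (\<lambda>x. s n x - u x)) \<longlonglongrightarrow> 0"
    using vlim by simp
  then show ?thesis using uS by (rule bexI)
qed

section \<open>Low-pass filters\<close>

lemma fourier_inv_L1_eq:
  fixes g :: "real ^ 'n \<Rightarrow> complex"
  shows "fourier_inv_L1 g x = of_real ((2 * pi) powr (- real CARD('n) / 2)) * (LINT \<xi>|lborel. cis (x \<bullet> \<xi>) * g \<xi>)"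
proof -
  have "cnj (LINT \<xi>|lborel. cis (- (\<xi> \<bullet> x)) * cnj (g \<xi>)) = (LINT \<xi>|lborel. cnj (cis (- (\<xi> \<bullet> x)) * cnj (g \<xi>)))"
    by (rule Bochner_Integration.integral_cnj[symmetric])
  then show ?thesis
    by (simp add: fourier_inv_L1_def fourier_L1_def cis_cnj inner_commute)
qed

text \<open>The normalization of the inverse transform times the \<open>L2\<close> norm of the
  indicator of the unit ball, the constant in Bernstein's inequality.\<close>

definition ball_const :: "'n itself \<Rightarrow> real" where
  "ball_const _ = (2 * pi) powr (- real CARD('n) / 2) * sqrt (unit_ball_vol (real CARD('n)))"

lemma ball_const_nonneg: "0 \<le> ball_const TYPE('n)"
  by (simp add: ball_const_def)

text \<open>Cauchy-Schwarz against the indicator of the ball of radius \<open>R\<close>, whose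
  squared norm is its volume.\<close>

lemma L2_band_limited:
  fixes g :: "real ^ 'n \<Rightarrow> complex"
  assumes g: "g \<in> L2" and R: "0 \<le> R" and supp: "\<And>\<xi>. R \<le> norm \<xi> \<Longrightarrow> g \<xi> = 0"
  shows "integrable lborel g"
    and "(LINT \<xi>|lborel. cmod (g \<xi>)) \<le> sqrt (unit_ball_vol (real CARD('n)) * R ^ CARD('n)) * l2 g"
    and "cmod (fourier_inv_L1 g x) \<le> ball_const TYPE('n) * sqrt (R ^ CARD('n)) * l2 g"
proof -
  let ?I = "indicator (ball 0 R) :: real ^ 'n \<Rightarrow> complex"
  have fin: "emeasure lborel (ball (0::real ^ 'n) R) < \<infinity>"
    by (rule emeasure_lborel_ball_finite)
  have I: "?I \<in> L2" "(l2 ?I)\<^sup>2 = measure lborel (ball (0::real ^ 'n) R)"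
    by (rule indicator_L2; use fin in simp)+
  have "measure lborel (ball (0::real ^ 'n) R) = unit_ball_vol (real CARD('n)) * R ^ CARD('n)"
    using content_ball[OF R, of "0::real ^ 'n"] by simp
  then have l2I: "l2 ?I = sqrt (unit_ball_vol (real CARD('n)) * R ^ CARD('n))"
    using I(2) l2_nonneg[of ?I] by (metis real_sqrt_unique)
  have gI: "g = (\<lambda>\<xi>. ?I \<xi> * g \<xi>)"
    using supp by (auto simp: indicator_def fun_eq_iff)
  show "integrable lborel g"
    by (subst gI) (rule L2_mult_integrable[OF I(1) g])
  have eq: "cmod (?I \<xi>) * cmod (g \<xi>) = cmod (g \<xi>)" for \<xi>
    using supp by (auto simp: indicator_def)
  show 1: "(LINT \<xi>|lborel. cmod (g \<xi>)) \<le> sqrt (unit_ball_vol (real CARD('n)) * R ^ CARD('n)) * l2 g"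
    using L2_cauchy_schwarz(1)[OF I(1) g] by (simp only: eq l2I)
  have "cmod (fourier_inv_L1 g x) \<le> (2 * pi) powr (- real CARD('n) / 2) * (LINT \<xi>|lborel. cmod (g \<xi>))"
    using fourier_L1_bound[of "\<lambda>\<xi>. cnj (g \<xi>)" x] by (simp add: fourier_inv_L1_def)
  also have "\<dots> \<le> (2 * pi) powr (- real CARD('n) / 2) * (sqrt (unit_ball_vol (real CARD('n)) * R ^ CARD('n)) * l2 g)"
    by (intro mult_left_mono 1) simp
  finally show "cmod (fourier_inv_L1 g x) \<le> ball_const TYPE('n) * sqrt (R ^ CARD('n)) * l2 g"
    by (simp add: ball_const_def real_sqrt_mult mult_ac)
qed

text \<open>A sharp frequency cut-off. The inversion integral gives it a value at every point, so it
  can be evaluated along sequences of points.\<close>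

definition band :: "(real ^ 'n) set \<Rightarrow> (real ^ 'n \<Rightarrow> complex) \<Rightarrow> real ^ 'n \<Rightarrow> complex" where
  "band S u = fourier_inv_L1 (\<lambda>\<xi>. indicator S \<xi> * fourier_L2 u \<xi>)"

lemma
  fixes u :: "real ^ 'n \<Rightarrow> complex"
  assumes u: "u \<in> L2" and S: "S \<in> sets borel" "S \<subseteq> ball 0 R" and R: "0 \<le> R"
  shows band_cut_L2: "(\<lambda>\<xi>. indicator S \<xi> * fourier_L2 u \<xi>) \<in> L2"
    and band_cut_integrable: "integrable lborel (\<lambda>\<xi>. indicator S \<xi> * fourier_L2 u \<xi>)"
    and band_L2: "band S u \<in> L2"
    and band_l2: "l2 (band S u) = l2 (\<lambda>\<xi>. indicator S \<xi> * fourier_L2 u \<xi>)"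
    and band_fourier: "AE \<xi> in lborel. fourier_L2 (band S u) \<xi> = indicator S \<xi> * fourier_L2 u \<xi>"
    and band_bound: "cmod (band S u x) \<le> ball_const TYPE('n) * sqrt (R ^ CARD('n)) * l2 (band S u)"
    and band_l2_le: "l2 (band S u) \<le> l2 u"
proof -
  let ?g = "\<lambda>\<xi>. indicator S \<xi> * fourier_L2 u \<xi>"
  have m: "(indicator S :: real ^ 'n \<Rightarrow> complex) \<in> borel_measurable borel"
    by (intro borel_measurable_indicator S)
  have b: "cmod (indicator S \<xi>) \<le> 1" for \<xi> by (simp add: indicator_def)
  show g: "?g \<in> L2" by (rule L2_bounded_mult(1)[OF fourier_L2_L2[OF u] m b])
  have supp: "?g \<xi> = 0" if "R \<le> norm \<xi>" for \<xi>
    using that S(2) by (auto simp: indicator_def)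
  show g1: "integrable lborel ?g" by (rule L2_band_limited(1)[OF g R supp])
  show "band S u \<in> L2" unfolding band_def by (rule fourier_inv_L1_L2[OF g g1])
  show l2: "l2 (band S u) = l2 ?g" unfolding band_def by (rule l2_fourier_inv_L1[OF g g1])
  show "AE \<xi> in lborel. fourier_L2 (band S u) \<xi> = ?g \<xi>"
    unfolding band_def by (rule fourier_L2_inv_L1[OF g g1])
  show "cmod (band S u x) \<le> ball_const TYPE('n) * sqrt (R ^ CARD('n)) * l2 (band S u)"
    unfolding l2 unfolding band_def by (rule L2_band_limited(3)[OF g R supp])
  show "l2 (band S u) \<le> l2 u"
    unfolding l2 using L2_bounded_mult(2)[OF fourier_L2_L2[OF u] m b] by (simp add: plancherel u)
qed

text \<open>An integral does not see null sets, so rules for the transform that hold almost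
  everywhere become identities for \<open>band\<close> at every point.\<close>

lemma band_cong_AE:
  fixes u v :: "real ^ 'n \<Rightarrow> complex"
  assumes "u \<in> L2" "v \<in> L2" "S \<in> sets borel" and h [measurable]: "h \<in> borel_measurable borel"
    and "AE \<xi> in lborel. fourier_L2 u \<xi> = h \<xi>"
  shows "band S u x = fourier_inv_L1 (\<lambda>\<xi>. indicator S \<xi> * h \<xi>) x"
proof -
  have [measurable]: "fourier_L2 u \<in> borel_measurable borel" "S \<in> sets borel"
    by (intro L2_measurable fourier_L2_L2 assms)+
  show ?thesis
    unfolding band_def fourier_inv_L1_eq
    by (intro arg_cong2[where f = "(*)"] refl integral_cong_AE) (use assms(5) in auto)
qed

lemma
  fixes u v :: "real ^ 'n \<Rightarrow> complex"
  assumes u: "u \<in> L2" and v: "v \<in> L2" and S: "S \<in> sets borel" "S \<subseteq> ball 0 R" and R: "0 \<le> R"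
  shows band_add: "band S (\<lambda>x. u x + v x) x = band S u x + band S v x"
    and band_cmult: "band S (\<lambda>x. c * u x) x = c * band S u x"
    and band_shift: "band S (\<lambda>x. u (x - y)) x = band S u (x - y)"
proof -
  note F = L2_measurable[OF fourier_L2_L2[OF u]] L2_measurable[OF fourier_L2_L2[OF v]]
  note [measurable] = F
  have int: "integrable lborel (\<lambda>\<xi>. cis (x \<bullet> \<xi>) * (indicator S \<xi> * fourier_L2 u \<xi>))" if "u \<in> L2" for u x
    using fourier_integrable[OF band_cut_integrable[OF that S R], of "- x"] by (simp add: inner_commute)
  have "band S (\<lambda>x. u x + v x) x = fourier_inv_L1 (\<lambda>\<xi>. indicator S \<xi> * (fourier_L2 u \<xi> + fourier_L2 v \<xi>)) x"
    by (rule band_cong_AE[OF L2_add[OF u v] u S(1) _ fourier_L2_add[OF u v]]) measurable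
  then show "band S (\<lambda>x. u x + v x) x = band S u x + band S v x"
    by (simp add: band_def fourier_inv_L1_eq ring_distribs int[OF u] int[OF v])
  have "band S (\<lambda>x. c * u x) x = fourier_inv_L1 (\<lambda>\<xi>. indicator S \<xi> * (c * fourier_L2 u \<xi>)) x"
    by (rule band_cong_AE[OF L2_cmult[OF u] u S(1) _ fourier_L2_cmult[OF u]]) measurable
  then show "band S (\<lambda>x. c * u x) x = c * band S u x"
    by (simp add: band_def fourier_inv_L1_eq mult.left_commute[of _ c])
  have "band S (\<lambda>x. u (x - y)) x = fourier_inv_L1 (\<lambda>\<xi>. indicator S \<xi> * (cis (- (y \<bullet> \<xi>)) * fourier_L2 u \<xi>)) x"
    by (rule band_cong_AE[OF L2_shift(1)[OF u] u S(1) _ fourier_L2_shift[OF u]]) measurable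
  also have "\<dots> = band S u (x - y)"
  proof -
    have "cis (x \<bullet> \<xi>) * (indicator S \<xi> * (cis (- (y \<bullet> \<xi>)) * fourier_L2 u \<xi>))
        = cis ((x - y) \<bullet> \<xi>) * (indicator S \<xi> * fourier_L2 u \<xi>)" for \<xi>
    proof -
      have "cis ((x - y) \<bullet> \<xi>) = cis (x \<bullet> \<xi>) * cis (- (y \<bullet> \<xi>))"
        by (simp add: cis_mult inner_diff_left)
      then show ?thesis by (simp only: mult_ac)
    qed
    then show ?thesis by (simp only: band_def fourier_inv_L1_eq)
  qed
  finally show "band S (\<lambda>x. u (x - y)) x = band S u (x - y)" .
qed

lemma cis_lipschitz: "cmod (cis a - cis b) \<le> \<bar>a - b\<bar>"
proof -
  have "cis a - cis b = cis b * (cis (a - b) - 1)"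
    by (simp add: right_diff_distrib cis_mult)
  then have "cmod (cis a - cis b) = cmod (cis (a - b) - 1)"
    by (simp add: norm_mult)
  also have "\<dots> \<le> \<bar>a - b\<bar>"
    using iexp_approx1[of "a - b" 0] by (simp add: cis_conv_exp)
  finally show ?thesis .
qed

text \<open>On the support of the cut-off the phases at \<open>x\<close> and \<open>y\<close> differ
  by at most \<open>R * norm (x - y)\<close>; the rest is the estimate of the integral of the
  transform by its \<open>L2\<close> norm.\<close>

lemma band_lipschitz:
  fixes u :: "real ^ 'n \<Rightarrow> complex"
  assumes u: "u \<in> L2" and S: "S \<in> sets borel" "S \<subseteq> ball 0 R" and R: "0 \<le> R"
  shows "cmod (band S u x - band S u y) \<le> R * norm (x - y) * (ball_const TYPE('n) * sqrt (R ^ CARD('n)) * l2 u)"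
proof -
  let ?g = "\<lambda>\<xi>. indicator S \<xi> * fourier_L2 u \<xi>" and ?c = "(2 * pi) powr (- real CARD('n) / 2)"
  have g: "?g \<in> L2" "integrable lborel ?g"
    by (rule band_cut_L2[OF u S R], rule band_cut_integrable[OF u S R])
  have supp: "?g \<xi> = 0" if "R \<le> norm \<xi>" for \<xi>
    using that S(2) by (auto simp: indicator_def)
  have int: "integrable lborel (\<lambda>\<xi>. cis (x \<bullet> \<xi>) * ?g \<xi>)" for x
    using fourier_integrable[OF g(2), of "- x"] by (simp add: inner_commute)
  have "band S u x - band S u y = of_real ?c * (LINT \<xi>|lborel. (cis (x \<bullet> \<xi>) - cis (y \<bullet> \<xi>)) * ?g \<xi>)"
    using int[of x] int[of y] by (simp add: band_def fourier_inv_L1_eq right_diff_distrib left_diff_distrib)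
  then have eq: "cmod (band S u x - band S u y) = ?c * cmod (LINT \<xi>|lborel. (cis (x \<bullet> \<xi>) - cis (y \<bullet> \<xi>)) * ?g \<xi>)"
    by (simp add: norm_mult)
  have I: "cmod (LINT \<xi>|lborel. (cis (x \<bullet> \<xi>) - cis (y \<bullet> \<xi>)) * ?g \<xi>) \<le> (LINT \<xi>|lborel. R * norm (x - y) * cmod (?g \<xi>))"
  proof (rule order_trans[OF integral_norm_bound integral_mono])
    show "integrable lborel (\<lambda>\<xi>. cmod ((cis (x \<bullet> \<xi>) - cis (y \<bullet> \<xi>)) * ?g \<xi>))"
      using int[of x] int[of y] by (simp add: left_diff_distrib)
    show "integrable lborel (\<lambda>\<xi>. R * norm (x - y) * cmod (?g \<xi>))"
      by (intro integrable_mult_right integrable_norm g)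
    show "cmod ((cis (x \<bullet> \<xi>) - cis (y \<bullet> \<xi>)) * ?g \<xi>) \<le> R * norm (x - y) * cmod (?g \<xi>)" for \<xi>
    proof (cases "R \<le> norm \<xi>")
      case False
      have "cmod (cis (x \<bullet> \<xi>) - cis (y \<bullet> \<xi>)) \<le> \<bar>(x - y) \<bullet> \<xi>\<bar>"
        using cis_lipschitz[of "x \<bullet> \<xi>" "y \<bullet> \<xi>"] by (simp add: inner_diff_left)
      also have "\<dots> \<le> norm (x - y) * norm \<xi>" by (rule Cauchy_Schwarz_ineq2)
      also have "\<dots> \<le> norm (x - y) * R" using False by (intro mult_left_mono) auto
      finally show ?thesis
        unfolding norm_mult[of "_ - _"] by (intro mult_right_mono) (simp_all add: mult.commute)
    qed (simp add: supp)
  qed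
  have "(LINT \<xi>|lborel. cmod (?g \<xi>)) \<le> sqrt (unit_ball_vol (real CARD('n)) * R ^ CARD('n)) * l2 ?g"
    by (rule L2_band_limited(2)[OF g(1) R supp])
  also have "\<dots> \<le> sqrt (unit_ball_vol (real CARD('n)) * R ^ CARD('n)) * l2 u"
    using band_l2_le[OF u S R] band_l2[OF u S R] R by (intro mult_left_mono) simp_all
  finally have J: "(LINT \<xi>|lborel. cmod (?g \<xi>)) \<le> sqrt (unit_ball_vol (real CARD('n)) * R ^ CARD('n)) * l2 u" .
  have "(LINT \<xi>|lborel. R * norm (x - y) * cmod (?g \<xi>)) = R * norm (x - y) * (LINT \<xi>|lborel. cmod (?g \<xi>))"
    by simp
  also have "\<dots> \<le> R * norm (x - y) * (sqrt (unit_ball_vol (real CARD('n)) * R ^ CARD('n)) * l2 u)"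
    by (intro mult_left_mono J) (use R in simp)
  finally have "?c * cmod (LINT \<xi>|lborel. (cis (x \<bullet> \<xi>) - cis (y \<bullet> \<xi>)) * ?g \<xi>)
      \<le> ?c * (R * norm (x - y) * (sqrt (unit_ball_vol (real CARD('n)) * R ^ CARD('n)) * l2 u))"
    by (intro mult_left_mono order_trans[OF I]) simp_all
  then show ?thesis
    unfolding eq by (simp add: ball_const_def real_sqrt_mult mult_ac)
qed

section \<open>The subcritical embedding by dyadic decomposition\<close>

text \<open>Convexity, with \<open>a + b\<close> written as the average of
  \<open>a / (1 - \<rho>)\<close> and \<open>b / \<rho>\<close>. If a summand vanishes,
  \<open>r powr q \<le> r\<close> for \<open>0 < r < 1\<close> suffices.\<close>

lemma powr_add_le_convex:
  fixes a b q \<rho> :: real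
  assumes q: "1 \<le> q" and \<rho>: "0 < \<rho>" "\<rho> < 1" and a: "0 \<le> a" and b: "0 \<le> b"
  shows "(a + b) powr q \<le> (1 - \<rho>) * (a / (1 - \<rho>)) powr q + \<rho> * (b / \<rho>) powr q"
proof -
  have single: "c powr q \<le> r * (c / r) powr q" if "0 < c" "0 < r" "r < 1" for c r :: real
  proof -
    have "c powr q = (r * (c / r)) powr q" using that by simp
    also have "\<dots> = r powr q * (c / r) powr q" by (rule powr_mult)
    also have "\<dots> \<le> r powr 1 * (c / r) powr q" using that q by (intro mult_right_mono powr_mono') auto
    finally show ?thesis using that by simp
  qed
  consider "a = 0" | "b = 0" | "0 < a" "0 < b" using a b by fastforce
  then show ?thesis
  proof cases
    case 1
    then show ?thesis using single[of b \<rho>] \<rho> b q by (cases "b = 0") auto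
  next
    case 2
    then show ?thesis using single[of a "1 - \<rho>"] \<rho> a q by (cases "a = 0") auto
  next
    case 3
    have "((1 - \<rho>) *\<^sub>R (a / (1 - \<rho>)) + \<rho> *\<^sub>R (b / \<rho>)) powr q \<le> (1 - \<rho>) * (a / (1 - \<rho>)) powr q + \<rho> * (b / \<rho>) powr q"
      using convex_onD[OF powr_convex[OF q], of \<rho> "a / (1 - \<rho>)" "b / \<rho>"] 3 \<rho> by simp
    then show ?thesis using \<rho> by simp
  qed
qed

lemma powr_mult_square: "0 \<le> a \<Longrightarrow> 2 < q \<Longrightarrow> a powr (q - 2) * a\<^sup>2 = a powr q" for a q :: real
  using powr_add[of a "q - 2" 2] by (cases "a = 0") (simp_all add: powr_numeral)

text \<open>Interpolation between the supremum and the \<open>L2\<close> norm: \<open>q - 2\<close>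
  factors are bounded by \<open>M\<close> and two are integrated.\<close>

lemma nn_integral_powr_le_l2:
  assumes f: "f \<in> L2" and q: "2 < q" and bd: "\<And>x. cmod (f x) \<le> M"
  shows "(\<integral>\<^sup>+x. ennreal (cmod (f x) powr q) \<partial>lborel) \<le> ennreal (M powr (q - 2) * (l2 f)\<^sup>2)"
proof -
  note [measurable] = L2_measurable[OF f]
  have "cmod (f x) powr q \<le> M powr (q - 2) * (cmod (f x))\<^sup>2" for x
    unfolding powr_mult_square[OF norm_ge_zero q, symmetric]
    using q by (intro mult_right_mono powr_mono2 bd) auto
  then have "(\<integral>\<^sup>+x. ennreal (cmod (f x) powr q) \<partial>lborel) \<le> (\<integral>\<^sup>+x. ennreal (M powr (q - 2)) * ennreal ((cmod (f x))\<^sup>2) \<partial>lborel)"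
    by (intro nn_integral_mono) (simp flip: ennreal_mult)
  also have "\<dots> = ennreal (M powr (q - 2)) * ennreal ((l2 f)\<^sup>2)"
    by (simp add: nn_integral_cmult nn_integral_l2[OF f])
  finally show ?thesis by (simp flip: ennreal_mult)
qed

section \<open>Dyadic frequency blocks\<close>

definition low :: "nat \<Rightarrow> (real ^ 'n \<Rightarrow> complex) \<Rightarrow> real ^ 'n \<Rightarrow> complex" where
  "low j = band (ball 0 (2 ^ j))"

definition block :: "nat \<Rightarrow> (real ^ 'n \<Rightarrow> complex) \<Rightarrow> real ^ 'n \<Rightarrow> complex" where
  "block j = band (ball 0 (2 ^ Suc j) - ball 0 (2 ^ j))"

lemma
  fixes u v :: "real ^ 'n \<Rightarrow> complex"
  assumes u: "u \<in> L2"
  shows low_L2: "low j u \<in> L2"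
    and low_l2_le: "l2 (low j u) \<le> l2 u"
    and low_bound: "cmod (low j u x) \<le> ball_const TYPE('n) * sqrt ((2 ^ j) ^ CARD('n)) * l2 u"
    and low_lipschitz: "cmod (low j u x - low j u y) \<le> 2 ^ j * norm (x - y) * (ball_const TYPE('n) * sqrt ((2 ^ j) ^ CARD('n)) * l2 u)"
    and low_shift: "low j (\<lambda>x. u (x - y)) x = low j u (x - y)"
    and low_cmult: "low j (\<lambda>x. c * u x) x = c * low j u x"
    and low_add: "v \<in> L2 \<Longrightarrow> low j (\<lambda>x. u x + v x) x = low j u x + low j v x"
proof -
  have S: "ball 0 (2 ^ j) \<in> sets borel" "ball 0 (2 ^ j) \<subseteq> ball (0 :: real ^ 'n) (2 ^ j)" "(0::real) \<le> 2 ^ j"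
    by auto
  show "low j u \<in> L2" unfolding low_def by (rule band_L2[OF u S])
  show le: "l2 (low j u) \<le> l2 u" unfolding low_def by (rule band_l2_le[OF u S])
  show "cmod (low j u x) \<le> ball_const TYPE('n) * sqrt ((2 ^ j) ^ CARD('n)) * l2 u"
    by (rule order_trans[OF band_bound[OF u S, of x, folded low_def]])
      (intro mult_left_mono le mult_nonneg_nonneg ball_const_nonneg, simp)
  show "cmod (low j u x - low j u y) \<le> 2 ^ j * norm (x - y) * (ball_const TYPE('n) * sqrt ((2 ^ j) ^ CARD('n)) * l2 u)"
    unfolding low_def by (rule band_lipschitz[OF u S])
  show "low j (\<lambda>x. u (x - y)) x = low j u (x - y)"
    unfolding low_def by (rule band_shift[OF u u S])
  show "low j (\<lambda>x. c * u x) x = c * low j u x"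
    unfolding low_def by (rule band_cmult[OF u u S])
  show "low j (\<lambda>x. u x + v x) x = low j u x + low j v x" if "v \<in> L2"
    unfolding low_def by (rule band_add[OF u that S])
qed

lemma low_Suc:
  fixes u :: "real ^ 'n \<Rightarrow> complex"
  assumes u: "u \<in> L2"
  shows "low (Suc j) u x = low j u x + block j u x"
proof -
  have le: "(2::real) ^ j \<le> 2 ^ Suc j" by simp
  have int: "integrable lborel (\<lambda>\<xi>. cis (x \<bullet> \<xi>) * (indicator S \<xi> * fourier_L2 u \<xi>))"
    if "S \<in> sets borel" "S \<subseteq> ball 0 (2 ^ Suc j)" for S
    using fourier_integrable[OF band_cut_integrable[OF u that], of "- x"] by (simp add: inner_commute)
  have sub: "ball 0 (2 ^ j) \<subseteq> ball (0::real ^ 'n) (2 ^ Suc j)"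
    by (rule subset_ball) (rule le)
  have split: "indicator (ball 0 (2 ^ Suc j)) \<xi> = indicator (ball 0 (2 ^ j)) \<xi> + (indicator (ball 0 (2 ^ Suc j) - ball 0 (2 ^ j)) \<xi> :: complex)"
    for \<xi> :: "real ^ 'n"
    using sub by (auto simp: indicator_def)
  show ?thesis
    unfolding low_def block_def band_def fourier_inv_L1_eq split ring_distribs
    by (subst Bochner_Integration.integral_add) (auto intro!: int simp: ring_distribs simp del: power_Suc intro: subsetD[OF sub])
qed

text \<open>On frequencies of size at least \<open>r\<close> the Sobolev weight is at least
  \<open>r powr \<alpha>\<close>.\<close>

lemma high_l2_le:
  fixes u :: "real ^ 'n \<Rightarrow> complex"
  assumes u: "u \<in> sobolev K \<alpha>" and \<alpha>: "0 < \<alpha>" and r: "0 < r"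
    and S: "S \<in> sets borel" "S \<inter> ball 0 r = {}"
  shows "(\<lambda>\<xi>. indicator S \<xi> * fourier_L2 u \<xi>) \<in> L2"
    and "l2 (\<lambda>\<xi>. indicator S \<xi> * fourier_L2 u \<xi>) \<le> r powr (- \<alpha>) * sobolev_norm \<alpha> u"
proof -
  note uD = sobolevD[OF u]
  have [measurable]: "fourier_L2 u \<in> borel_measurable borel" "S \<in> sets borel"
    by (intro L2_measurable fourier_L2_L2 uD S)+
  have le: "cmod (indicator S \<xi> * fourier_L2 u \<xi>) \<le> r powr (- \<alpha>) * cmod (bessel \<alpha> u \<xi>)" for \<xi>
  proof (cases "\<xi> \<in> S")
    case True
    then have n: "r \<le> norm \<xi>" using S(2) by (auto simp: not_less[symmetric])
    have "r powr \<alpha> = (r\<^sup>2) powr (\<alpha> / 2)"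
      using r by (simp add: powr_powr flip: powr_numeral)
    also have "\<dots> \<le> (1 + (norm \<xi>)\<^sup>2) powr (\<alpha> / 2)"
    proof (rule powr_mono2)
      show "r\<^sup>2 \<le> 1 + (norm \<xi>)\<^sup>2"
        using power_mono[OF n less_imp_le[OF r], of 2] by simp
    qed (use \<alpha> in auto)
    finally have "r powr (- \<alpha>) * r powr \<alpha> * cmod (fourier_L2 u \<xi>) \<le> r powr (- \<alpha>) * (1 + (norm \<xi>)\<^sup>2) powr (\<alpha> / 2) * cmod (fourier_L2 u \<xi>)"
      by (intro mult_right_mono mult_left_mono) auto
    moreover have "r powr (- \<alpha>) * r powr \<alpha> = 1"
      using r by (simp flip: powr_add)
    ultimately show ?thesis
      using True by (simp add: bessel_def norm_mult mult.assoc)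
  qed simp
  show "(\<lambda>\<xi>. indicator S \<xi> * fourier_L2 u \<xi>) \<in> L2"
    by (rule l2_mono(1)[OF uD(3) _ le]) auto
  show "l2 (\<lambda>\<xi>. indicator S \<xi> * fourier_L2 u \<xi>) \<le> r powr (- \<alpha>) * sobolev_norm \<alpha> u"
    unfolding sobolev_norm_eq by (rule l2_mono(2)[OF uD(3) _ le]) auto
qed

text \<open>By Plancherel the error is the norm of the frequencies outside the ball; the rate is
  uniform on bounded sets of the Sobolev space.\<close>

lemma low_approx:
  fixes u :: "real ^ 'n \<Rightarrow> complex"
  assumes u: "u \<in> sobolev K \<alpha>" and \<alpha>: "0 < \<alpha>"
  shows "l2 (\<lambda>x. low j u x - u x) \<le> (2 ^ j) powr (- \<alpha>) * sobolev_norm \<alpha> u"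
proof -
  note uD = sobolevD[OF u]
  let ?B = "ball 0 (2 ^ j) :: (real ^ 'n) set"
  have S: "?B \<in> sets borel" "?B \<subseteq> ball (0 :: real ^ 'n) (2 ^ j)" "(0::real) \<le> 2 ^ j"
    by auto
  note h = high_l2_le[OF u \<alpha>, of "2 ^ j" "- ?B"]
  have ae: "AE \<xi> in lborel. fourier_L2 u \<xi> - fourier_L2 (low j u) \<xi> = indicator (- ?B) \<xi> * fourier_L2 u \<xi>"
    using band_fourier[OF uD(1) S] unfolding low_def by eventually_elim (auto simp: indicator_def)
  have "l2 (\<lambda>x. low j u x - u x) = l2 (\<lambda>x. u x - low j u x)"
    by (rule l2_minus_commute[OF low_L2[OF uD(1)] uD(1)])
  also have "\<dots> = l2 (\<lambda>\<xi>. fourier_L2 u \<xi> - fourier_L2 (low j u) \<xi>)"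
    by (rule plancherel_diff[OF uD(1) low_L2[OF uD(1)], symmetric])
  also have "\<dots> = l2 (\<lambda>\<xi>. indicator (- ?B) \<xi> * fourier_L2 u \<xi>)"
    using ae by (intro l2_cong_AE L2_measurable L2_diff fourier_L2_L2 uD low_L2 h) auto
  also have "\<dots> \<le> (2 ^ j) powr (- \<alpha>) * sobolev_norm \<alpha> u"
    by (rule h) auto
  finally show ?thesis .
qed

lemma sobolev_norm_nonneg [simp]: "0 \<le> sobolev_norm \<alpha> u"
  by (simp add: sobolev_norm_eq)

text \<open>The exponent for which the dyadic blocks satisfy
  \<open>\<integral>|block j u|\<^sup>q \<le> C (2 powr - decay)\<^sup>j \<parallel>u\<parallel>\<^sup>q\<close>; it is positive exactly when \<open>q\<close> is subcritical.\<close>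

definition decay :: "nat \<Rightarrow> real \<Rightarrow> real \<Rightarrow> real" where
  "decay N \<alpha> q = \<alpha> * q - real N * (q - 2) / 2"

lemma decay_pos:
  assumes "0 < \<alpha>" "2 < q" "ereal q < critical_exponent N \<alpha>"
  shows "0 < decay N \<alpha> q"
proof (cases "real N > 2 * \<alpha>")
  case True
  then have "q < 2 * real N / (real N - 2 * \<alpha>)"
    using assms(3) by (simp add: critical_exponent_def)
  then have "q * (real N - 2 * \<alpha>) < 2 * real N"
    using True by (simp add: pos_less_divide_eq)
  then show ?thesis by (simp add: decay_def field_simps)
next
  case False
  then have "real N * (q - 2) \<le> 2 * \<alpha> * (q - 2)"
    using assms(2) by (intro mult_right_mono) auto
  then have "real N * (q - 2) / 2 \<le> \<alpha> * q - 2 * \<alpha>"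
    by (simp add: field_simps)
  then show ?thesis using assms(1) by (simp add: decay_def)
qed

text \<open>The factor \<open>sqrt (2 ^ CARD('n))\<close> arises because block \<open>j\<close>
  reaches up to frequency \<open>2 * 2 ^ j\<close>; the exponent \<open>q - 2\<close> comes from
  interpolation.\<close>

definition block_const :: "'n itself \<Rightarrow> real \<Rightarrow> real" where
  "block_const n q = (ball_const n * sqrt (2 ^ CARD('n))) powr (q - 2)"

text \<open>With \<open>L = 2 ^ j\<close>, the \<open>L2\<close> norm of the block is at most
  \<open>L powr (- \<alpha>) * A\<close>, and Bernstein's inequality bounds its supremum by a
  multiple of \<open>L powr (N / 2 - \<alpha>) * A\<close>, where \<open>N\<close> is the dimension.
  Interpolating yields the exponent \<open>(N / 2 - \<alpha>) * (q - 2) - 2 * \<alpha>\<close>,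
  which is \<open>- decay\<close>.\<close>

lemma block_Lq:
  fixes u :: "real ^ 'n \<Rightarrow> complex"
  assumes u: "u \<in> sobolev K \<alpha>" and \<alpha>: "0 < \<alpha>" and q: "2 < q"
  shows "(\<integral>\<^sup>+x. ennreal (cmod (block j u x) powr q) \<partial>lborel)
    \<le> ennreal (block_const TYPE('n) q * (2 powr (- decay CARD('n) \<alpha> q)) ^ j * sobolev_norm \<alpha> u powr q)"
proof -
  note uD = sobolevD[OF u]
  define A where "A = sobolev_norm \<alpha> u"
  have A: "0 \<le> A" by (simp add: A_def)
  define L :: real where "L = 2 ^ j"
  have L: "0 < L" by (simp add: L_def)
  let ?S = "ball 0 (2 ^ Suc j) - ball 0 (2 ^ j) :: (real ^ 'n) set"
  have S: "?S \<in> sets borel" "?S \<subseteq> ball 0 (2 ^ Suc j)" "(0::real) \<le> 2 ^ Suc j" by auto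
  have le: "l2 (block j u) \<le> L powr (- \<alpha>) * A"
    unfolding block_def band_l2[OF uD(1) S] L_def A_def by (rule high_l2_le(2)[OF u \<alpha> _ S(1)]) auto
  define D where "D = ball_const TYPE('n) * sqrt (2 ^ CARD('n))"
  have D: "0 \<le> D" by (simp add: D_def ball_const_nonneg)
  define M where "M = D * L powr (real CARD('n) / 2 - \<alpha>) * A"
  have sq: "sqrt ((2 ^ Suc j) ^ CARD('n)) = sqrt (2 ^ CARD('n)) * L powr (real CARD('n) / 2)"
    using L by (simp add: L_def power_mult_distrib real_sqrt_mult powr_half_sqrt[symmetric] powr_powr flip: powr_realpow)
  have bd: "cmod (block j u x) \<le> M" for x
  proof -
    have "cmod (block j u x) \<le> ball_const TYPE('n) * sqrt ((2 ^ Suc j) ^ CARD('n)) * l2 (block j u)"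
      unfolding block_def by (rule band_bound[OF uD(1) S])
    also have "\<dots> \<le> ball_const TYPE('n) * sqrt ((2 ^ Suc j) ^ CARD('n)) * (L powr (- \<alpha>) * A)"
      by (intro mult_left_mono le mult_nonneg_nonneg ball_const_nonneg) simp
    also have "\<dots> = D * (L powr (real CARD('n) / 2) * L powr (- \<alpha>)) * A"
      unfolding sq D_def by (simp only: mult_ac)
    also have "\<dots> = M"
      by (simp add: M_def flip: powr_add)
    finally show ?thesis .
  qed
  have "(\<integral>\<^sup>+x. ennreal (cmod (block j u x) powr q) \<partial>lborel) \<le> ennreal (M powr (q - 2) * (l2 (block j u))\<^sup>2)"
    by (rule nn_integral_powr_le_l2[OF _ q bd]) (unfold block_def, rule band_L2[OF uD(1) S])
  also have "M powr (q - 2) * (l2 (block j u))\<^sup>2 \<le> M powr (q - 2) * (L powr (- \<alpha>) * A)\<^sup>2"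
    by (intro mult_left_mono power_mono le) auto
  also have "\<dots> = D powr (q - 2) * (L powr ((real CARD('n) / 2 - \<alpha>) * (q - 2)) * L powr (- 2 * \<alpha>)) * (A powr (q - 2) * A\<^sup>2)"
  proof -
    have "M powr (q - 2) = D powr (q - 2) * L powr ((real CARD('n) / 2 - \<alpha>) * (q - 2)) * A powr (q - 2)"
      unfolding M_def using D A by (simp add: powr_mult powr_powr)
    moreover have "(L powr (- \<alpha>) * A)\<^sup>2 = L powr (- 2 * \<alpha>) * A\<^sup>2"
      by (simp add: power2_eq_square flip: powr_add)
    ultimately show ?thesis by (simp only: mult_ac)
  qed
  also have "L powr ((real CARD('n) / 2 - \<alpha>) * (q - 2)) * L powr (- 2 * \<alpha>) = L powr (- decay CARD('n) \<alpha> q)"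
  proof -
    have "(real CARD('n) / 2 - \<alpha>) * (q - 2) + - 2 * \<alpha> = - decay CARD('n) \<alpha> q"
      by (simp add: decay_def field_simps)
    then show ?thesis by (simp only: powr_add[symmetric])
  qed
  also have "\<dots> = (2 powr (- decay CARD('n) \<alpha> q)) ^ j"
    by (simp add: L_def powr_powr mult.commute flip: powr_realpow)
  also have "A powr (q - 2) * A\<^sup>2 = A powr q"
    by (rule powr_mult_square[OF A q])
  finally show ?thesis
    by (simp add: block_const_def D_def A_def ennreal_leI)
qed

text \<open>With \<open>\<rho> = 2 powr (- decay / q)\<close> the norms of the blocks decay like
  powers of \<open>\<rho>\<close>. The factor is the \<open>q\<close>-th power of the sum
  \<open>1 / (1 - \<rho>)\<close> of the geometric series, as the triangle inequality for the
  \<open>L^q\<close> norm would give.\<close>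

definition tail_const :: "'n itself \<Rightarrow> real \<Rightarrow> real \<Rightarrow> real" where
  "tail_const n \<alpha> q = (1 - 2 powr (- decay CARD('n) \<alpha> q / q)) powr (- q) * block_const n q"

text \<open>The weights \<open>1 - \<rho>\<close> and \<open>\<rho>\<close> with \<open>\<rho> = 2 powr (- decay / q)\<close> reproduce the geometric
  bound in the recursion on the number of blocks.\<close>

lemma low_diff_Lq:
  fixes u :: "real ^ 'n \<Rightarrow> complex"
  assumes u: "u \<in> sobolev K \<alpha>" and \<alpha>: "0 < \<alpha>" and q: "2 < q" and dec: "0 < decay CARD('n) \<alpha> q"
  shows "(\<integral>\<^sup>+x. ennreal (cmod (low (J + k) u x - low J u x) powr q) \<partial>lborel)
    \<le> ennreal (tail_const TYPE('n) \<alpha> q * (2 powr (- decay CARD('n) \<alpha> q)) ^ J * sobolev_norm \<alpha> u powr q)"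
proof (induction k arbitrary: J)
  case 0
  then show ?case by simp
next
  case (Suc k)
  note uD = sobolevD[OF u]
  define \<sigma> where "\<sigma> = 2 powr (- decay CARD('n) \<alpha> q)"
  define \<rho> where "\<rho> = 2 powr (- decay CARD('n) \<alpha> q / q)"
  define A where "A = sobolev_norm \<alpha> u powr q"
  define E where "E = block_const TYPE('n) q"
  define C where "C = tail_const TYPE('n) \<alpha> q"
  have \<sigma>: "0 < \<sigma>" by (simp add: \<sigma>_def)
  have A: "0 \<le> A" by (simp add: A_def)
  have E: "0 \<le> E" by (simp add: E_def block_const_def)
  have C: "C = (1 - \<rho>) powr (- q) * E" by (simp add: C_def tail_const_def \<rho>_def E_def)
  have \<rho>: "0 < \<rho>" "\<rho> < 1"
    using dec q by (simp_all add: \<rho>_def powr_less_one)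
  have \<sigma>\<rho>: "\<sigma> = \<rho> powr q"
    using q by (simp add: \<sigma>_def \<rho>_def powr_powr)
  have C0: "0 \<le> C" by (simp add: C E)
  have [measurable]: "low i u \<in> borel_measurable borel" for i
    by (intro L2_measurable low_L2 uD)
  have [measurable]: "block J u \<in> borel_measurable borel"
  proof -
    have "block J u = (\<lambda>x. low (Suc J) u x - low J u x)"
      using low_Suc[OF uD(1)] by (simp add: fun_eq_iff)
    then show ?thesis by simp
  qed
  let ?f = "\<lambda>x. cmod (block J u x)" and ?g = "\<lambda>x. cmod (low (Suc J + k) u x - low (Suc J) u x)"
  have scale: "r * (c / r) powr q = r powr (1 - q) * c powr q" if "0 < r" "0 \<le> c" for r c :: real
    using that by (simp add: powr_divide powr_diff)
  \<comment> \<open>The lowest block is split off and the induction hypothesis applied from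
    \<open>Suc J\<close> on, which is why \<open>J\<close> varies in the induction.\<close>
  have "(\<integral>\<^sup>+x. ennreal (cmod (low (J + Suc k) u x - low J u x) powr q) \<partial>lborel)
      \<le> (\<integral>\<^sup>+x. ennreal ((1 - \<rho>) powr (1 - q)) * ennreal (?f x powr q) + ennreal (\<rho> powr (1 - q)) * ennreal (?g x powr q) \<partial>lborel)"
  proof (rule nn_integral_mono)
    fix x
    have "cmod (low (J + Suc k) u x - low J u x) = cmod (block J u x + (low (Suc J + k) u x - low (Suc J) u x))"
      by (simp add: low_Suc[OF uD(1), of J])
    also have "\<dots> \<le> ?f x + ?g x" by (rule norm_triangle_ineq)
    finally have "cmod (low (J + Suc k) u x - low J u x) powr q \<le> (?f x + ?g x) powr q"
      using q by (intro powr_mono2) auto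
    also have "\<dots> \<le> (1 - \<rho>) * (?f x / (1 - \<rho>)) powr q + \<rho> * (?g x / \<rho>) powr q"
      using q \<rho> by (intro powr_add_le_convex) auto
    also have "\<dots> = (1 - \<rho>) powr (1 - q) * ?f x powr q + \<rho> powr (1 - q) * ?g x powr q"
      using \<rho> by (simp only: scale norm_ge_zero diff_gt_0_iff_gt)
    finally show "ennreal (cmod (low (J + Suc k) u x - low J u x) powr q)
      \<le> ennreal ((1 - \<rho>) powr (1 - q)) * ennreal (?f x powr q) + ennreal (\<rho> powr (1 - q)) * ennreal (?g x powr q)"
      by (simp add: ennreal_leI flip: ennreal_mult ennreal_plus)
  qed
  also have "\<dots> = ennreal ((1 - \<rho>) powr (1 - q)) * (\<integral>\<^sup>+x. ennreal (?f x powr q) \<partial>lborel)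
      + ennreal (\<rho> powr (1 - q)) * (\<integral>\<^sup>+x. ennreal (?g x powr q) \<partial>lborel)"
    by (subst nn_integral_add) (auto simp: nn_integral_cmult)
  also have "\<dots> \<le> ennreal ((1 - \<rho>) powr (1 - q)) * ennreal (E * \<sigma> ^ J * A)
      + ennreal (\<rho> powr (1 - q)) * ennreal (C * \<sigma> ^ Suc J * A)"
    using block_Lq[OF u \<alpha> q, of J] Suc.IH[of "Suc J"]
    unfolding \<sigma>_def[symmetric] A_def[symmetric] E_def[symmetric] C_def[symmetric]
    by (intro add_mono mult_left_mono) auto
  also have "\<dots> = ennreal ((1 - \<rho>) powr (1 - q) * (E * \<sigma> ^ J * A) + \<rho> powr (1 - q) * (C * \<sigma> ^ Suc J * A))"
    using E C0 A \<sigma> by (simp flip: ennreal_mult ennreal_plus)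
  \<comment> \<open>The block contributes the share \<open>1 - \<rho>\<close> of the bound and the
    remaining sum the share \<open>\<rho>\<close>, so \<open>C\<close> reproduces itself.\<close>
  also have "(1 - \<rho>) powr (1 - q) * (E * \<sigma> ^ J * A) + \<rho> powr (1 - q) * (C * \<sigma> ^ Suc J * A) = C * \<sigma> ^ J * A"
  proof -
    have "(1 - \<rho>) powr (1 - q) * E = (1 - \<rho>) * C"
      using \<rho> by (simp add: C powr_diff powr_minus field_simps)
    moreover have "\<rho> powr (1 - q) * \<sigma> = \<rho>"
      using \<rho> by (simp add: \<sigma>\<rho> flip: powr_add)
    moreover have "(1 - \<rho>) powr (1 - q) * (E * \<sigma> ^ J * A) + \<rho> powr (1 - q) * (C * \<sigma> ^ Suc J * A)
        = ((1 - \<rho>) powr (1 - q) * E + \<rho> powr (1 - q) * \<sigma> * C) * \<sigma> ^ J * A"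
      by (simp add: algebra_simps)
    ultimately have "(1 - \<rho>) powr (1 - q) * (E * \<sigma> ^ J * A) + \<rho> powr (1 - q) * (C * \<sigma> ^ Suc J * A)
        = ((1 - \<rho>) * C + \<rho> * C) * \<sigma> ^ J * A"
      by simp
    then show ?thesis by (simp add: algebra_simps)
  qed
  finally show ?case
    by (simp add: C_def \<sigma>_def A_def)
qed

text \<open>The bound for finitely many blocks does not depend on their number. A subsequence of the
  low-frequency parts converges to \<open>u\<close> almost everywhere, and Fatou's lemma passes to
  the full tail.\<close>

lemma low_tail_Lq:
  fixes u :: "real ^ 'n \<Rightarrow> complex"
  assumes u: "u \<in> sobolev K \<alpha>" and \<alpha>: "0 < \<alpha>" and q: "2 < q" and dec: "0 < decay CARD('n) \<alpha> q"
  shows "(\<integral>\<^sup>+x. ennreal (cmod (u x - low J u x) powr q) \<partial>lborel)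
    \<le> ennreal (tail_const TYPE('n) \<alpha> q * (2 powr (- decay CARD('n) \<alpha> q)) ^ J * sobolev_norm \<alpha> u powr q)"
    (is "_ \<le> ennreal ?b")
proof -
  note uD = sobolevD[OF u]
  have [measurable]: "u \<in> borel_measurable borel" "low i u \<in> borel_measurable borel" for i
    by (intro L2_measurable low_L2 uD)+
  have "(\<lambda>j. l2 (\<lambda>x. low j u x - u x)) \<longlonglongrightarrow> 0"
  proof (rule Lim_null_comparison[OF always_eventually[OF allI]])
    have "(\<lambda>j. (2 powr (- \<alpha>)) ^ j * sobolev_norm \<alpha> u) \<longlonglongrightarrow> 0"
      using \<alpha> by (intro tendsto_mult_left_zero LIMSEQ_realpow_zero) (auto simp: powr_less_one)
    moreover have "(2 ^ j) powr (- \<alpha>) = (2 powr (- \<alpha>)) ^ j" for j :: nat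
      by (simp add: powr_powr mult.commute flip: powr_realpow)
    ultimately show "(\<lambda>j. (2 ^ j) powr (- \<alpha>) * sobolev_norm \<alpha> u) \<longlonglongrightarrow> 0" by simp
    show "norm (l2 (\<lambda>x. low j u x - u x)) \<le> (2 ^ j) powr (- \<alpha>) * sobolev_norm \<alpha> u" for j
      using low_approx[OF u \<alpha>, of j] by simp
  qed
  from L2_tendsto_AE_subseq[OF low_L2[OF uD(1)] uD(1) this]
  obtain r :: "nat \<Rightarrow> nat" where r: "strict_mono r" and ae: "AE x in lborel. (\<lambda>n. low (r n) u x) \<longlonglongrightarrow> u x"
    by blast
  have "(\<integral>\<^sup>+x. ennreal (cmod (u x - low J u x) powr q) \<partial>lborel)
      = (\<integral>\<^sup>+x. liminf (\<lambda>n. ennreal (cmod (low (r n) u x - low J u x) powr q)) \<partial>lborel)"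
  proof (rule nn_integral_cong_AE)
    show "AE x in lborel. ennreal (cmod (u x - low J u x) powr q) = liminf (\<lambda>n. ennreal (cmod (low (r n) u x - low J u x) powr q))"
      using ae
    proof eventually_elim
      case (elim x)
      have "(\<lambda>n. cmod (low (r n) u x - low J u x) powr q) \<longlonglongrightarrow> cmod (u x - low J u x) powr q"
        using q by (intro tendsto_powr' tendsto_intros elim) auto
      then have "(\<lambda>n. ennreal (cmod (low (r n) u x - low J u x) powr q)) \<longlonglongrightarrow> ennreal (cmod (u x - low J u x) powr q)"
        by (rule tendsto_ennrealI)
      then show ?case by (intro lim_imp_Liminf[symmetric]) auto
    qed
  qed
  also have "\<dots> \<le> liminf (\<lambda>n. \<integral>\<^sup>+x. ennreal (cmod (low (r n) u x - low J u x) powr q) \<partial>lborel)"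
    by (rule nn_integral_liminf) auto
  also have "\<dots> \<le> limsup (\<lambda>n. \<integral>\<^sup>+x. ennreal (cmod (low (r n) u x - low J u x) powr q) \<partial>lborel)"
    by (rule Liminf_le_Limsup) simp
  also have "\<dots> \<le> ennreal ?b"
  proof (rule Limsup_bounded)
    show "\<forall>\<^sub>F n in sequentially. (\<integral>\<^sup>+x. ennreal (cmod (low (r n) u x - low J u x) powr q) \<partial>lborel) \<le> ennreal ?b"
      using eventually_ge_at_top[of J]
    proof eventually_elim
      case (elim n)
      then have "J \<le> r n" using strict_mono_imp_increasing[OF r, of n] by simp
      then have "r n = J + (r n - J)" by simp
      then show ?case using low_diff_Lq[OF u \<alpha> q dec, of J "r n - J"] by simp
    qed
  qed
  finally show ?thesis .
qed

section \<open>Embedding and nonvanishing\<close>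

lemma powr_add_le_two:
  fixes a b q :: real
  assumes "1 \<le> q" "0 \<le> a" "0 \<le> b"
  shows "(a + b) powr q \<le> 2 powr q * (a powr q + b powr q)"
proof -
  have "(a + b) powr q \<le> (2 * max a b) powr q"
    using assms by (intro powr_mono2) auto
  also have "\<dots> = 2 powr q * max a b powr q"
    by (rule powr_mult)
  also have "\<dots> \<le> 2 powr q * (a powr q + b powr q)"
    by (intro mult_left_mono) (auto simp: max_def)
  finally show ?thesis .
qed

lemma nn_integral_powr_split:
  fixes u v :: "'a::euclidean_space \<Rightarrow> complex"
  assumes [measurable]: "u \<in> borel_measurable borel" "v \<in> borel_measurable borel" and q: "1 \<le> q"
  shows "(\<integral>\<^sup>+x. ennreal (cmod (u x) powr q) \<partial>lborel)
    \<le> ennreal (2 powr q) * ((\<integral>\<^sup>+x. ennreal (cmod (u x - v x) powr q) \<partial>lborel) + (\<integral>\<^sup>+x. ennreal (cmod (v x) powr q) \<partial>lborel))"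
proof -
  have "(\<integral>\<^sup>+x. ennreal (cmod (u x) powr q) \<partial>lborel)
      \<le> (\<integral>\<^sup>+x. ennreal (2 powr q) * (ennreal (cmod (u x - v x) powr q) + ennreal (cmod (v x) powr q)) \<partial>lborel)"
  proof (rule nn_integral_mono)
    fix x
    have "cmod (u x) \<le> cmod (u x - v x) + cmod (v x)"
      using norm_triangle_ineq[of "u x - v x" "v x"] by simp
    then have "cmod (u x) powr q \<le> (cmod (u x - v x) + cmod (v x)) powr q"
      using q by (intro powr_mono2) auto
    also have "\<dots> \<le> 2 powr q * (cmod (u x - v x) powr q + cmod (v x) powr q)"
      by (rule powr_add_le_two[OF q]) auto
    finally show "ennreal (cmod (u x) powr q) \<le> ennreal (2 powr q) * (ennreal (cmod (u x - v x) powr q) + ennreal (cmod (v x) powr q))"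
      by (simp add: ennreal_leI flip: ennreal_mult ennreal_plus)
  qed
  also have "\<dots> = ennreal (2 powr q) * ((\<integral>\<^sup>+x. ennreal (cmod (u x - v x) powr q) \<partial>lborel) + (\<integral>\<^sup>+x. ennreal (cmod (v x) powr q) \<partial>lborel))"
    by (simp add: nn_integral_cmult nn_integral_add)
  finally show ?thesis .
qed

theorem sobolev_embedding:
  fixes \<alpha> q :: real
  assumes \<alpha>: "0 < \<alpha>" and q: "2 < q" and dec: "0 < decay CARD('n) \<alpha> q"
  shows "\<exists>C>0. \<forall>u\<in>sobolev K \<alpha> :: (real ^ 'n \<Rightarrow> complex) set.
    (\<integral>\<^sup>+x. ennreal (cmod (u x) powr q) \<partial>lborel) \<le> ennreal (C * sobolev_norm \<alpha> u powr q)"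
proof -
  define C1 where "C1 = tail_const TYPE('n) \<alpha> q"
  define C2 where "C2 = ball_const TYPE('n) powr (q - 2)"
  have C: "0 \<le> C1" "0 \<le> C2"
    by (simp_all add: C1_def C2_def tail_const_def block_const_def)
  \<comment> \<open>\<open>C2\<close> handles the frequencies below 1 and \<open>C1\<close> the tail
    above them; the summand 1 makes the constant strictly positive.\<close>
  have "(\<integral>\<^sup>+x. ennreal (cmod (u x) powr q) \<partial>lborel) \<le> ennreal ((2 powr q * (C1 + C2) + 1) * sobolev_norm \<alpha> u powr q)"
    if u: "u \<in> sobolev K \<alpha>" for u :: "real ^ 'n \<Rightarrow> complex"
  proof -
    note uD = sobolevD[OF u]
    define A where "A = sobolev_norm \<alpha> u"
    have A: "0 \<le> A" by (simp add: A_def)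
    have l2A: "l2 u \<le> A" unfolding A_def by (rule l2_le_sobolev_norm[OF uD(1,3) \<alpha>])
    have bd: "cmod (low 0 u x) \<le> ball_const TYPE('n) * A" for x
      using low_bound[OF uD(1), of 0 x] mult_left_mono[OF l2A ball_const_nonneg[where ?'n = 'n]] by simp
    have "(\<integral>\<^sup>+x. ennreal (cmod (low 0 u x) powr q) \<partial>lborel) \<le> ennreal ((ball_const TYPE('n) * A) powr (q - 2) * (l2 (low 0 u))\<^sup>2)"
      by (rule nn_integral_powr_le_l2[OF low_L2[OF uD(1)] q bd])
    also have "(ball_const TYPE('n) * A) powr (q - 2) * (l2 (low 0 u))\<^sup>2 \<le> (ball_const TYPE('n) * A) powr (q - 2) * A\<^sup>2"
      using low_l2_le[OF uD(1), of 0] l2A by (intro mult_left_mono power_mono) auto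
    also have "\<dots> = C2 * (A powr (q - 2) * A\<^sup>2)"
      by (simp add: C2_def powr_mult)
    also have "\<dots> = C2 * A powr q"
      by (simp only: powr_mult_square[OF A q])
    finally have 2: "(\<integral>\<^sup>+x. ennreal (cmod (low 0 u x) powr q) \<partial>lborel) \<le> ennreal (C2 * A powr q)"
      by (simp add: ennreal_leI)
    have 1: "(\<integral>\<^sup>+x. ennreal (cmod (u x - low 0 u x) powr q) \<partial>lborel) \<le> ennreal (C1 * A powr q)"
      using low_tail_Lq[OF u \<alpha> q dec, of 0] by (simp add: C1_def A_def)
    have "(\<integral>\<^sup>+x. ennreal (cmod (u x) powr q) \<partial>lborel) \<le> ennreal (2 powr q) * (ennreal (C1 * A powr q) + ennreal (C2 * A powr q))"
      using q by (intro order_trans[OF nn_integral_powr_split[OF L2_measurable[OF uD(1)] L2_measurable[OF low_L2[OF uD(1), of 0]]]]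
        mult_left_mono add_mono 1 2) auto
    also have "\<dots> = ennreal (2 powr q * (C1 + C2) * A powr q)"
      using C by (simp add: algebra_simps flip: ennreal_mult ennreal_plus)
    also have "\<dots> \<le> ennreal ((2 powr q * (C1 + C2) + 1) * A powr q)"
      by (intro ennreal_leI mult_right_mono) auto
    finally show ?thesis by (simp add: A_def)
  qed
  moreover have "0 < 2 powr q * (C1 + C2) + 1"
    using C by (simp add: add_nonneg_pos)
  ultimately show ?thesis by blast
qed

text \<open>\<open>J\<close> is chosen so that the tail contributes less than \<open>c / 2\<close>,
  then \<open>\<eta>\<close> so that a low-frequency part bounded by \<open>\<eta>\<close> would
  also contribute less than \<open>c / 2\<close>. Both depend only on the bounds \<open>M\<close>
  and \<open>c\<close>, hence serve a whole minimizing sequence.\<close>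

lemma nonvanishing:
  fixes \<alpha> q M c :: real
  assumes \<alpha>: "0 < \<alpha>" and q: "2 < q" and dec: "0 < decay CARD('n) \<alpha> q" and M: "0 \<le> M" and c: "0 < c"
  shows "\<exists>J \<eta>. 0 < \<eta> \<and> (\<forall>u\<in>sobolev K \<alpha> :: (real ^ 'n \<Rightarrow> complex) set. sobolev_norm \<alpha> u \<le> M \<longrightarrow>
    ennreal c \<le> (\<integral>\<^sup>+x. ennreal (cmod (u x) powr q) \<partial>lborel) \<longrightarrow> (\<exists>x. \<eta> \<le> cmod (low J u x)))"
proof -
  define \<sigma> where "\<sigma> = 2 powr (- decay CARD('n) \<alpha> q)"
  define C where "C = tail_const TYPE('n) \<alpha> q"
  have \<sigma>: "0 < \<sigma>" "\<sigma> < 1"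
    using dec by (simp_all add: \<sigma>_def powr_less_one)
  have C: "0 \<le> C"
    by (simp add: C_def tail_const_def block_const_def)
  have "(\<lambda>J. 2 powr q * (C * \<sigma> ^ J * M powr q)) \<longlonglongrightarrow> 2 powr q * (C * 0 * M powr q)"
    by (intro tendsto_intros LIMSEQ_realpow_zero) (use \<sigma> in auto)
  then have "\<forall>\<^sub>F J in sequentially. 2 powr q * (C * \<sigma> ^ J * M powr q) < c / 2"
    by (rule order_tendstoD(2)) (use c in simp)
  then obtain J where J: "2 powr q * (C * \<sigma> ^ J * M powr q) < c / 2"
    by (auto simp: eventually_sequentially)
  \<comment> \<open>Since \<open>q > 2\<close>, the power \<open>\<eta> powr (q - 2)\<close>
    vanishes as \<open>\<eta>\<close> tends to 0 from the right.\<close>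
  have "((\<lambda>\<eta>. 2 powr q * (\<eta> powr (q - 2) * M\<^sup>2)) \<longlongrightarrow> 2 powr q * (0 powr (q - 2) * M\<^sup>2)) (at_right 0)"
    using q by (intro tendsto_intros tendsto_powr') (auto simp: eventually_at_right_less eventually_mono[OF eventually_at_right_less[of 0]])
  then have "\<forall>\<^sub>F \<eta> in at_right 0. 2 powr q * (\<eta> powr (q - 2) * M\<^sup>2) < c / 2"
    by (rule order_tendstoD(2)) (use c q in simp)
  then have "\<forall>\<^sub>F \<eta> in at_right (0::real). 0 < \<eta> \<and> 2 powr q * (\<eta> powr (q - 2) * M\<^sup>2) < c / 2"
    using eventually_at_right_less[of "0::real"] by eventually_elim simp
  then obtain \<eta> where \<eta>: "0 < \<eta>" "2 powr q * (\<eta> powr (q - 2) * M\<^sup>2) < c / 2"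
    using eventually_happens'[OF trivial_limit_at_right_real] by blast
  have "\<exists>x. \<eta> \<le> cmod (low J u x)"
    if u: "u \<in> sobolev K \<alpha>" and uM: "sobolev_norm \<alpha> u \<le> M" and lower: "ennreal c \<le> (\<integral>\<^sup>+x. ennreal (cmod (u x) powr q) \<partial>lborel)"
    for u :: "real ^ 'n \<Rightarrow> complex"
  proof (rule ccontr)
    assume "\<nexists>x. \<eta> \<le> cmod (low J u x)"
    then have bd: "cmod (low J u x) \<le> \<eta>" for x
      by (meson not_le less_imp_le)
    note uD = sobolevD[OF u]
    have l2M: "l2 (low J u) \<le> M"
      using low_l2_le[OF uD(1), of J] l2_le_sobolev_norm[OF uD(1,3) \<alpha>] uM by linarith
    have "(\<integral>\<^sup>+x. ennreal (cmod (low J u x) powr q) \<partial>lborel) \<le> ennreal (\<eta> powr (q - 2) * (l2 (low J u))\<^sup>2)"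
      by (rule nn_integral_powr_le_l2[OF low_L2[OF uD(1)] q bd])
    also have "\<dots> \<le> ennreal (\<eta> powr (q - 2) * M\<^sup>2)"
      using l2M by (intro ennreal_leI mult_left_mono power_mono) auto
    finally have 2: "(\<integral>\<^sup>+x. ennreal (cmod (low J u x) powr q) \<partial>lborel) \<le> ennreal (\<eta> powr (q - 2) * M\<^sup>2)" .
    have "(\<integral>\<^sup>+x. ennreal (cmod (u x - low J u x) powr q) \<partial>lborel) \<le> ennreal (C * \<sigma> ^ J * sobolev_norm \<alpha> u powr q)"
      using low_tail_Lq[OF u \<alpha> q dec, of J] by (simp add: C_def \<sigma>_def)
    also have "\<dots> \<le> ennreal (C * \<sigma> ^ J * M powr q)"
      using uM C \<sigma> q by (intro ennreal_leI mult_left_mono powr_mono2) auto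
    finally have 1: "(\<integral>\<^sup>+x. ennreal (cmod (u x - low J u x) powr q) \<partial>lborel) \<le> ennreal (C * \<sigma> ^ J * M powr q)" .
    have "ennreal c \<le> ennreal (2 powr q) * (ennreal (C * \<sigma> ^ J * M powr q) + ennreal (\<eta> powr (q - 2) * M\<^sup>2))"
      using q by (intro order_trans[OF lower] order_trans[OF nn_integral_powr_split[OF L2_measurable[OF uD(1)] L2_measurable[OF low_L2[OF uD(1), of J]]]]
        mult_left_mono add_mono 1 2) auto
    also have "\<dots> = ennreal (2 powr q * (C * \<sigma> ^ J * M powr q) + 2 powr q * (\<eta> powr (q - 2) * M\<^sup>2))"
      using C \<sigma> by (simp add: distrib_left flip: ennreal_mult ennreal_plus)
    finally have "c \<le> 2 powr q * (C * \<sigma> ^ J * M powr q) + 2 powr q * (\<eta> powr (q - 2) * M\<^sup>2)"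
      using C \<sigma> by (subst (asm) ennreal_le_iff) auto
    then show False using J \<eta>(2) by linarith
  qed
  then show ?thesis using \<eta>(1) by blast
qed

section \<open>Weak compactness in Sobolev spaces\<close>

text \<open>Convergence is proved in \<open>L2\<close> with a Gaussian weight. The low-frequency
  parts are uniformly bounded, so the integrable weight permits dominated convergence; the
  high-frequency parts are uniformly small even without weight. The weight is positive, so a
  subsequence converges almost everywhere.\<close>

lemma sobolev_AE_subseq:
  fixes u :: "nat \<Rightarrow> real ^ 'n \<Rightarrow> complex"
  assumes \<alpha>: "0 < \<alpha>" and u: "\<And>k. u k \<in> sobolev K \<alpha>" and uM: "\<And>k. sobolev_norm \<alpha> (u k) \<le> M"
    and w: "w \<in> sobolev K \<alpha>" and lim: "\<And>j x. (\<lambda>k. low j (u k) x) \<longlonglongrightarrow> low j w x"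
  shows "\<exists>r. strict_mono r \<and> (AE x in lborel. (\<lambda>k. u (r k) x) \<longlonglongrightarrow> w x)"
proof -
  note uD = sobolevD[OF u] and wD = sobolevD[OF w]
  define M' where "M' = max M (sobolev_norm \<alpha> w)"
  have M'0: "0 \<le> M'" by (simp add: M'_def le_max_iff_disj)
  have M': "sobolev_norm \<alpha> (u k) \<le> M'" "sobolev_norm \<alpha> w \<le> M'" for k
    using uM[of k] by (auto simp: M'_def le_max_iff_disj)
  have [measurable]: "u k \<in> borel_measurable borel" "w \<in> borel_measurable borel"
      "low j (u k) \<in> borel_measurable borel" "low j w \<in> borel_measurable borel" for j k
    by (intro L2_measurable low_L2 uD wD)+
  have gauss_int: "integrable lborel (\<lambda>x. gauss x * (cmod (f x))\<^sup>2)" and gauss_le: "(LINT x|lborel. gauss x * (cmod (f x))\<^sup>2) \<le> (l2 f)\<^sup>2"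
    if f: "f \<in> L2" for f :: "real ^ 'n \<Rightarrow> complex"
  proof -
    have [measurable]: "f \<in> borel_measurable borel" using f by (rule L2_measurable)
    have le: "gauss x * (cmod (f x))\<^sup>2 \<le> (cmod (f x))\<^sup>2" for x
      by (rule mult_left_le_one_le) auto
    show 1: "integrable lborel (\<lambda>x. gauss x * (cmod (f x))\<^sup>2)"
      by (rule Bochner_Integration.integrable_bound[OF L2_integrable[OF f]]) (use le in auto)
    show "(LINT x|lborel. gauss x * (cmod (f x))\<^sup>2) \<le> (l2 f)\<^sup>2"
      unfolding l2_sq by (intro integral_mono 1 L2_integrable f le)
  qed
  define a where "a k = (LINT x|lborel. gauss x * (cmod (u k x - w x))\<^sup>2)" for k
  define d where "d j k = (LINT x|lborel. gauss x * (cmod (low j (u k) x - low j w x))\<^sup>2)" for j k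
  \<comment> \<open>A bound for the high-frequency parts of \<open>w\<close> and of all
    \<open>u k\<close> at once.\<close>
  define \<delta> where "\<delta> j = (2 ^ j) powr (- \<alpha>) * M'" for j :: nat
  have d_lim: "(\<lambda>k. d j k) \<longlonglongrightarrow> 0" for j
  proof -
    define E where "E = ball_const TYPE('n) * sqrt ((2 ^ j) ^ CARD('n)) * M'"
    have bd: "cmod (low j v x) \<le> E" if "v \<in> sobolev K \<alpha>" "sobolev_norm \<alpha> v \<le> M'" for v :: "real ^ 'n \<Rightarrow> complex" and x
    proof -
      have "cmod (low j v x) \<le> ball_const TYPE('n) * sqrt ((2 ^ j) ^ CARD('n)) * l2 v"
        by (rule low_bound[OF sobolevD(1)[OF that(1)]])
      also have "\<dots> \<le> E"
        unfolding E_def using l2_le_sobolev_norm[OF sobolevD(1,3)[OF that(1)] \<alpha>] that(2)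
        by (intro mult_left_mono mult_nonneg_nonneg ball_const_nonneg) auto
      finally show ?thesis .
    qed
    have "(\<lambda>k. d j k) \<longlonglongrightarrow> (LINT x::real ^ 'n|lborel. 0 :: real)"
      unfolding d_def
    proof (rule integral_dominated_convergence)
      show "integrable lborel (\<lambda>x::real ^ 'n. gauss x * (2 * E)\<^sup>2)"
        by (intro integrable_mult_left gauss_integrable)
      show "AE x in lborel. (\<lambda>k. gauss x * (cmod (low j (u k) x - low j w x))\<^sup>2) \<longlonglongrightarrow> 0"
      proof (rule AE_I2)
        fix x
        have "(\<lambda>k. gauss x * (cmod (low j (u k) x - low j w x))\<^sup>2) \<longlonglongrightarrow> gauss x * (cmod (low j w x - low j w x))\<^sup>2"
          by (intro tendsto_intros lim)
        then show "(\<lambda>k. gauss x * (cmod (low j (u k) x - low j w x))\<^sup>2) \<longlonglongrightarrow> 0" by simp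
      qed
      show "AE x in lborel. norm (gauss x * (cmod (low j (u k) x - low j w x))\<^sup>2) \<le> gauss x * (2 * E)\<^sup>2" for k
      proof (rule AE_I2)
        fix x
        have "cmod (low j (u k) x - low j w x) \<le> 2 * E"
          using norm_triangle_ineq4[of "low j (u k) x" "low j w x"] bd[OF u M'(1), of k x] bd[OF w M'(2), of x] by simp
        then have "(cmod (low j (u k) x - low j w x))\<^sup>2 \<le> (2 * E)\<^sup>2"
          by (intro power_mono) auto
        then show "norm (gauss x * (cmod (low j (u k) x - low j w x))\<^sup>2) \<le> gauss x * (2 * E)\<^sup>2"
          by (simp add: mult_left_mono)
      qed
    qed auto
    then show ?thesis by simp
  qed
  have approx: "(l2 (\<lambda>x. v x - low j v x))\<^sup>2 \<le> (\<delta> j)\<^sup>2" if "v \<in> sobolev K \<alpha>" "sobolev_norm \<alpha> v \<le> M'" for v :: "real ^ 'n \<Rightarrow> complex" and j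
  proof -
    have "l2 (\<lambda>x. low j v x - v x) \<le> \<delta> j"
      unfolding \<delta>_def by (rule order_trans[OF low_approx[OF that(1) \<alpha>] mult_left_mono[OF that(2)]]) simp
    then show ?thesis
      using l2_minus_commute[OF sobolevD(1)[OF that(1)] low_L2[OF sobolevD(1)[OF that(1)]], of j] by (intro power_mono) auto
  qed
  \<comment> \<open>The difference is a sum of three pieces; the factors 2, 4, 4 come from applying
    \<open>cmod_add_sq_le\<close> twice.\<close>
  have a_le: "a k \<le> 2 * (\<delta> j)\<^sup>2 + 4 * d j k + 4 * (\<delta> j)\<^sup>2" for j k
  proof -
    note diffs = L2_diff[OF uD(1) low_L2[OF uD(1)], of k j k] L2_diff[OF low_L2[OF uD(1)] low_L2[OF wD(1)], of j k j]
      L2_diff[OF wD(1) low_L2[OF wD(1)], of j]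
    have "a k \<le> (LINT x|lborel. 2 * (gauss x * (cmod (u k x - low j (u k) x))\<^sup>2)
        + 4 * (gauss x * (cmod (low j (u k) x - low j w x))\<^sup>2) + 4 * (gauss x * (cmod (w x - low j w x))\<^sup>2))"
      unfolding a_def
    proof (intro integral_mono Bochner_Integration.integrable_add integrable_mult_right gauss_int diffs L2_diff uD wD)
      fix x
      have "(cmod (u k x - w x))\<^sup>2 \<le> 2 * (cmod (u k x - low j (u k) x))\<^sup>2 + 2 * (cmod (low j (u k) x - w x))\<^sup>2"
        using cmod_add_sq_le[of "u k x - low j (u k) x" "low j (u k) x - w x"] by simp
      moreover have "(cmod (low j (u k) x - w x))\<^sup>2 \<le> 2 * (cmod (low j (u k) x - low j w x))\<^sup>2 + 2 * (cmod (w x - low j w x))\<^sup>2"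
        using cmod_add_sq_le[of "low j (u k) x - low j w x" "low j w x - w x"] by (simp add: norm_minus_commute)
      ultimately have "(cmod (u k x - w x))\<^sup>2 \<le> 2 * (cmod (u k x - low j (u k) x))\<^sup>2
          + 4 * (cmod (low j (u k) x - low j w x))\<^sup>2 + 4 * (cmod (w x - low j w x))\<^sup>2"
        by linarith
      then have "gauss x * (cmod (u k x - w x))\<^sup>2 \<le> gauss x * (2 * (cmod (u k x - low j (u k) x))\<^sup>2
          + 4 * (cmod (low j (u k) x - low j w x))\<^sup>2 + 4 * (cmod (w x - low j w x))\<^sup>2)"
        by (intro mult_left_mono) auto
      then show "gauss x * (cmod (u k x - w x))\<^sup>2 \<le> 2 * (gauss x * (cmod (u k x - low j (u k) x))\<^sup>2)
          + 4 * (gauss x * (cmod (low j (u k) x - low j w x))\<^sup>2) + 4 * (gauss x * (cmod (w x - low j w x))\<^sup>2)"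
        by (simp add: algebra_simps)
    qed
    also have "\<dots> = 2 * (LINT x|lborel. gauss x * (cmod (u k x - low j (u k) x))\<^sup>2)
        + 4 * d j k + 4 * (LINT x|lborel. gauss x * (cmod (w x - low j w x))\<^sup>2)"
      unfolding d_def by (simp add: gauss_int diffs)
    also have "\<dots> \<le> 2 * (\<delta> j)\<^sup>2 + 4 * d j k + 4 * (\<delta> j)\<^sup>2"
      using gauss_le[OF diffs(1)] gauss_le[OF diffs(3)] approx[OF u M'(1), of k j] approx[OF w M'(2), of j] by linarith
    finally show ?thesis .
  qed
  have "(\<lambda>j. 6 * (\<delta> j)\<^sup>2) \<longlonglongrightarrow> 6 * (0 * M')\<^sup>2"
  proof -
    have "(\<lambda>j. (2 powr (- \<alpha>)) ^ j) \<longlonglongrightarrow> 0"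
      using \<alpha> by (intro LIMSEQ_realpow_zero) (auto simp: powr_less_one)
    moreover have "(2 ^ j) powr (- \<alpha>) = (2 powr (- \<alpha>)) ^ j" for j :: nat
      by (simp add: powr_powr mult.commute flip: powr_realpow)
    ultimately show ?thesis
      unfolding \<delta>_def by (intro tendsto_intros) simp
  qed
  then have \<delta>_lim: "(\<lambda>j. 6 * (\<delta> j)\<^sup>2) \<longlonglongrightarrow> 0" by simp
  have a0: "0 \<le> a k" for k
    unfolding a_def by (intro integral_nonneg_AE) auto
  have "a \<longlonglongrightarrow> 0"
  proof (rule LIMSEQ_I)
    fix e :: real assume e: "e > 0"
    obtain j where j: "6 * (\<delta> j)\<^sup>2 < e / 2"
      using order_tendstoD(2)[OF \<delta>_lim, of "e / 2"] e by (auto simp: eventually_sequentially)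
    have "(\<lambda>k. 4 * d j k) \<longlonglongrightarrow> 0"
      using tendsto_mult_right_zero[OF d_lim, of 4 j] by simp
    then obtain k0 where k0: "\<And>k. k \<ge> k0 \<Longrightarrow> 4 * d j k < e / 2"
      using order_tendstoD(2)[of "\<lambda>k. 4 * d j k" 0 sequentially "e / 2"] e by (auto simp: eventually_sequentially)
    have "norm (a k - 0) < e" if "k \<ge> k0" for k
      using a_le[of k j] j k0[OF that] a0[of k] by simp
    then show "\<exists>no. \<forall>k\<ge>no. norm (a k - 0) < e" by blast
  qed
  then have "(\<lambda>k. LINT x|lborel. norm (gauss x * (cmod (u k x - w x))\<^sup>2)) \<longlonglongrightarrow> 0"
    by (simp add: a_def[abs_def])
  from tendsto_L1_AE_subseq[OF gauss_int[OF L2_diff[OF uD(1) wD(1)]] this]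
  obtain r :: "nat \<Rightarrow> nat" where r: "strict_mono r" and ae: "AE x in lborel. (\<lambda>k. gauss x * (cmod (u (r k) x - w x))\<^sup>2) \<longlonglongrightarrow> 0"
    by blast
  have imp: "(\<lambda>k. u (r k) x) \<longlonglongrightarrow> w x" if "(\<lambda>k. gauss x * (cmod (u (r k) x - w x))\<^sup>2) \<longlonglongrightarrow> 0" for x
  proof -
    have "(\<lambda>k. inverse (gauss x) * (gauss x * (cmod (u (r k) x - w x))\<^sup>2)) \<longlonglongrightarrow> 0"
      by (rule tendsto_mult_right_zero[OF that])
    then have "(\<lambda>k. (cmod (u (r k) x - w x))\<^sup>2) \<longlonglongrightarrow> 0"
      using gauss_pos[of x] by (simp flip: mult.assoc del: gauss_pos)
    then have "(\<lambda>k. sqrt ((cmod (u (r k) x - w x))\<^sup>2)) \<longlonglongrightarrow> sqrt 0"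
      by (rule tendsto_real_sqrt)
    then have "(\<lambda>k. u (r k) x - w x) \<longlonglongrightarrow> 0"
      by (simp add: tendsto_norm_zero_iff)
    then show ?thesis by (simp add: LIM_zero_iff)
  qed
  have "AE x in lborel. (\<lambda>k. u (r k) x) \<longlonglongrightarrow> w x"
    by (rule eventually_mono[OF ae imp])
  with r show ?thesis by blast
qed

section \<open>Weak limits tested by point values\<close>

lemma tendsto_of_dense_lipschitz:
  fixes f :: "nat \<Rightarrow> 'a::metric_space \<Rightarrow> complex"
  assumes lip: "\<And>k x y. dist (f k x) (f k y) \<le> L * dist x y" and lipg: "\<And>x y. dist (g x) (g y) \<le> L * dist x y"
    and dense: "\<And>x e. 0 < e \<Longrightarrow> \<exists>m::nat. dist (d m) x < e"
    and lim: "\<And>m. (\<lambda>k. f k (d m)) \<longlonglongrightarrow> g (d m)"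
  shows "(\<lambda>k. f k x) \<longlonglongrightarrow> g x"
proof (rule metric_LIMSEQ_I)
  fix e :: real assume e: "0 < e"
  define L' where "L' = \<bar>L\<bar> + 1"
  have L': "0 < L'" "L \<le> L'" by (auto simp: L'_def)
  obtain m where m: "dist (d m) x < e / (3 * L')"
    using dense[of "e / (3 * L')" x] e L' by auto
  have "L * dist (d m) x \<le> L' * dist (d m) x"
    using L' by (intro mult_right_mono) auto
  also have "\<dots> < L' * (e / (3 * L'))"
    using L' m by (intro mult_strict_left_mono) auto
  finally have small: "L * dist (d m) x < e / 3"
    using L' by simp
  obtain k0 where k0: "\<And>k. k \<ge> k0 \<Longrightarrow> dist (f k (d m)) (g (d m)) < e / 3"
    using metric_LIMSEQ_D[OF lim[of m], of "e / 3"] e by auto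
  have "dist (f k x) (g x) < e" if "k \<ge> k0" for k
  proof -
    have "dist (f k x) (g x) \<le> dist (f k (d m)) (f k x) + dist (f k (d m)) (g (d m)) + dist (g (d m)) (g x)"
      using dist_triangle[of "f k x" "g x" "f k (d m)"] dist_triangle[of "f k (d m)" "g x" "g (d m)"]
      by (simp add: dist_commute)
    also have "\<dots> < e"
      using lip[of k "d m" x] lipg[of "d m" x] small k0[OF that] by simp
    finally show ?thesis .
  qed
  then show "\<exists>no. \<forall>n\<ge>no. dist (f n x) (g x) < e" by blast
qed

lemma dense_sequence: "\<exists>d :: nat \<Rightarrow> 'a::euclidean_space. \<forall>x e. 0 < e \<longrightarrow> (\<exists>m. dist (d m) x < e)"
proof -
  obtain D :: "'a set" where D: "countable D" "\<And>X. open X \<Longrightarrow> X \<noteq> {} \<Longrightarrow> \<exists>d\<in>D. d \<in> X"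
    using countable_dense_exists by metis
  have "D \<noteq> {}" using D(2)[of UNIV] by auto
  then have "range (from_nat_into D) = D"
    using D(1) by (rule range_from_nat_into)
  have "\<exists>m. dist (from_nat_into D m) x < e" if "0 < e" for x e
  proof -
    obtain y where "y \<in> D" "y \<in> ball x e"
      using D(2)[of "ball x e"] \<open>0 < e\<close> by auto
    moreover obtain m where "y = from_nat_into D m"
      using \<open>y \<in> D\<close> \<open>range (from_nat_into D) = D\<close> by (metis rangeE)
    ultimately show ?thesis by (auto simp: dist_commute)
  qed
  then show ?thesis by blast
qed

text \<open>Norm equivalence supplies completeness and bounded point evaluations for
  \<open>B\<close>. Countably many evaluations of low-frequency parts, at dense points, are handed
  to the weak compactness argument; the uniform Lipschitz bound then gives convergence at every
  point.\<close>

lemma sobolev_weak_compact: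
  fixes u :: "nat \<Rightarrow> real ^ 'n \<Rightarrow> complex"
  assumes K: "real_scalars K" and \<alpha>: "0 < \<alpha>"
    and B: "semi_inner (sobolev K \<alpha>) B"
    and c: "0 < c" "\<And>f. f \<in> sobolev K \<alpha> \<Longrightarrow> c * sobolev_norm \<alpha> f \<le> sqrt (B f f)"
    and C: "0 < C" "\<And>f. f \<in> sobolev K \<alpha> \<Longrightarrow> sqrt (B f f) \<le> C * sobolev_norm \<alpha> f"
    and u: "\<And>k. u k \<in> sobolev K \<alpha>" and uM: "\<And>k. sqrt (B (u k) (u k)) \<le> M"
  shows "\<exists>r w. strict_mono r \<and> w \<in> sobolev K \<alpha> \<and> (\<forall>j x. (\<lambda>k. low j (u (r k)) x) \<longlonglongrightarrow> low j w x) \<and>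
    (\<lambda>k. B (u (r k)) w) \<longlonglongrightarrow> B w w \<and> (AE x in lborel. (\<lambda>k. u (r k) x) \<longlonglongrightarrow> w x)"
proof -
  interpret H: semi_inner "sobolev K \<alpha> :: (real ^ 'n \<Rightarrow> complex) set" B by fact
  have N: "H.N f = sqrt (B f f)" for f by (simp add: H.N_def)
  obtain d :: "nat \<Rightarrow> real ^ 'n" where d: "\<And>x e. 0 < e \<Longrightarrow> \<exists>m. dist (d m) x < e"
    using dense_sequence by metis
  \<comment> \<open>The index encodes a level \<open>j\<close> and a number \<open>p\<close>, whose
    half selects the point and whose parity selects the real or the imaginary part.\<close>
  define l where "l i f = (let (j, p) = prod_decode i in if even p then Re (low j f (d (p div 2))) else Im (low j f (d (p div 2))))"
    for i and f :: "real ^ 'n \<Rightarrow> complex"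
  have bf: "H.bounded_functional (\<lambda>f. P (low j f x))"
    if P: "\<And>a b. P (a + b) = P a + P b" "\<And>c a. P (of_real c * a) = c * P a" "\<And>a. \<bar>P a\<bar> \<le> cmod a"
    for P :: "complex \<Rightarrow> real" and j x
    unfolding H.bounded_functional_def
  proof (intro conjI ballI allI exI)
    fix f g :: "real ^ 'n \<Rightarrow> complex" assume f: "f \<in> sobolev K \<alpha>"
    note fD = sobolevD[OF f]
    show "P (low j (\<lambda>x. of_real c * f x) x) = c * P (low j f x)" for c
      by (simp add: low_cmult fD P)
    show "P (low j (\<lambda>x. f x + g x) x) = P (low j f x) + P (low j g x)" if "g \<in> sobolev K \<alpha>"
      by (simp add: low_add fD sobolevD[OF that] P)
    have "\<bar>P (low j f x)\<bar> \<le> ball_const TYPE('n) * sqrt ((2 ^ j) ^ CARD('n)) * l2 f"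
      by (rule order_trans[OF P(3) low_bound[OF fD(1)]])
    also have "\<dots> \<le> ball_const TYPE('n) * sqrt ((2 ^ j) ^ CARD('n)) * (H.N f / c)"
    proof (intro mult_left_mono mult_nonneg_nonneg ball_const_nonneg)
      have "l2 f \<le> sobolev_norm \<alpha> f" by (rule l2_le_sobolev_norm[OF fD(1,3) \<alpha>])
      also have "\<dots> \<le> H.N f / c" using c(1) c(2)[OF f] by (simp add: N field_simps)
      finally show "l2 f \<le> H.N f / c" .
    qed simp
    finally show "\<bar>P (low j f x)\<bar> \<le> (ball_const TYPE('n) * sqrt ((2 ^ j) ^ CARD('n)) / c) * H.N f"
      by simp
  qed
  have bl: "H.bounded_functional (l i)" for i
    unfolding l_def[abs_def] Let_def
    by (cases "prod_decode i"; cases "even (snd (prod_decode i))")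
      (auto intro!: bf abs_Re_le_cmod abs_Im_le_cmod)
  have complete: "\<exists>w\<in>sobolev K \<alpha>. (\<lambda>n. H.N (\<lambda>x. s n x - w x)) \<longlonglongrightarrow> 0"
    if s: "\<And>n. s n \<in> sobolev K \<alpha>" and cauchy: "\<And>e. e > 0 \<Longrightarrow> \<exists>n0. \<forall>m\<ge>n0. \<forall>n\<ge>n0. H.N (\<lambda>x. s m x - s n x) < e"
    for s :: "nat \<Rightarrow> real ^ 'n \<Rightarrow> complex"
  proof -
    have "\<exists>n0. \<forall>m\<ge>n0. \<forall>n\<ge>n0. sobolev_norm \<alpha> (\<lambda>x. s m x - s n x) < e" if e: "e > 0" for e
    proof -
      obtain n0 where n0: "\<And>m n. m \<ge> n0 \<Longrightarrow> n \<ge> n0 \<Longrightarrow> H.N (\<lambda>x. s m x - s n x) < c * e"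
        using cauchy[of "c * e"] c(1) e by auto
      have "sobolev_norm \<alpha> (\<lambda>x. s m x - s n x) < e" if "m \<ge> n0" "n \<ge> n0" for m n
      proof -
        have "c * sobolev_norm \<alpha> (\<lambda>x. s m x - s n x) < c * e"
          using c(2)[OF H.diff_mem[OF s s]] n0[OF that] unfolding N by (rule le_less_trans)
        then show ?thesis using c(1) by simp
      qed
      then show ?thesis by blast
    qed
    from sobolev_complete[OF K \<alpha> s this]
    obtain w where w: "w \<in> sobolev K \<alpha>" and lim: "(\<lambda>n. sobolev_norm \<alpha> (\<lambda>x. s n x - w x)) \<longlonglongrightarrow> 0"
      by blast
    have "(\<lambda>n. H.N (\<lambda>x. s n x - w x)) \<longlonglongrightarrow> 0"
    proof (rule Lim_null_comparison[OF always_eventually[OF allI]])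
      show "(\<lambda>n. C * sobolev_norm \<alpha> (\<lambda>x. s n x - w x)) \<longlonglongrightarrow> 0"
        by (rule tendsto_mult_right_zero[OF lim])
      show "norm (H.N (\<lambda>x. s n x - w x)) \<le> C * sobolev_norm \<alpha> (\<lambda>x. s n x - w x)" for n
        using C(2)[OF H.diff_mem[OF s w]] H.N_nonneg[OF H.diff_mem[OF s w]] by (simp add: N)
    qed
    with w show ?thesis by blast
  qed
  obtain r w where r: "strict_mono r" and w: "w \<in> sobolev K \<alpha>"
    and lw: "\<And>i. (\<lambda>k. l i (u (r k))) \<longlonglongrightarrow> l i w" and Bw: "(\<lambda>k. B (u (r k)) w) \<longlonglongrightarrow> (H.N w)\<^sup>2"
    using H.weak_subsequence[of u M l, OF complete u uM[folded N] bl] by blast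
  define M' where "M' = max (M / c) (sobolev_norm \<alpha> w)"
  have uM': "sobolev_norm \<alpha> (u k) \<le> M / c" for k
    using c(1) order_trans[OF c(2)[OF u] uM, of k] by (simp add: field_simps)
  have low_lim: "(\<lambda>k. low j (u (r k)) x) \<longlonglongrightarrow> low j w x" for j x
  proof (rule tendsto_of_dense_lipschitz[OF _ _ d])
    define L where "L = 2 ^ j * (ball_const TYPE('n) * sqrt ((2 ^ j) ^ CARD('n)) * M')"
    have "dist (low j f x) (low j f y) \<le> L * dist x y" if f: "f \<in> sobolev K \<alpha>" "sobolev_norm \<alpha> f \<le> M'" for f :: "real ^ 'n \<Rightarrow> complex" and x y
    proof -
      have "dist (low j f x) (low j f y) \<le> 2 ^ j * norm (x - y) * (ball_const TYPE('n) * sqrt ((2 ^ j) ^ CARD('n)) * l2 f)"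
        unfolding dist_norm by (rule low_lipschitz[OF sobolevD(1)[OF f(1)]])
      also have "\<dots> \<le> 2 ^ j * norm (x - y) * (ball_const TYPE('n) * sqrt ((2 ^ j) ^ CARD('n)) * M')"
        using l2_le_sobolev_norm[OF sobolevD(1,3)[OF f(1)] \<alpha>] f(2)
        by (intro mult_left_mono mult_nonneg_nonneg ball_const_nonneg) auto
      finally show ?thesis by (simp add: L_def dist_norm mult_ac)
    qed
    then show "dist (low j (u (r k)) x) (low j (u (r k)) y) \<le> L * dist x y" "dist (low j w x) (low j w y) \<le> L * dist x y" for k x y
      using u w uM' by (auto simp: M'_def le_max_iff_disj)
    show "(\<lambda>k. low j (u (r k)) (d m)) \<longlonglongrightarrow> low j w (d m)" for m
    proof -
      have "(\<lambda>k. Re (low j (u (r k)) (d m))) \<longlonglongrightarrow> Re (low j w (d m))"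
        using lw[of "prod_encode (j, 2 * m)"] by (simp add: l_def)
      moreover have "(\<lambda>k. Im (low j (u (r k)) (d m))) \<longlonglongrightarrow> Im (low j w (d m))"
        using lw[of "prod_encode (j, Suc (2 * m))"] by (simp add: l_def)
      ultimately show ?thesis by (simp add: tendsto_complex_iff)
    qed
  qed
  obtain s where s: "strict_mono s" and ae: "AE x in lborel. (\<lambda>k. u (r (s k)) x) \<longlonglongrightarrow> w x"
    using sobolev_AE_subseq[OF \<alpha>, of "\<lambda>k. u (r k)" K "M / c" w] u uM' w low_lim by blast
  have "strict_mono (r \<circ> s)" using r s by (rule strict_mono_o)
  moreover have "(\<lambda>k. low j (u ((r \<circ> s) k)) x) \<longlonglongrightarrow> low j w x" for j x
    using LIMSEQ_subseq_LIMSEQ[OF low_lim s] by (simp add: o_def)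
  moreover have "(\<lambda>k. B (u ((r \<circ> s) k)) w) \<longlonglongrightarrow> B w w"
    using LIMSEQ_subseq_LIMSEQ[OF Bw s] by (simp add: o_def H.N_sq w)
  moreover have "AE x in lborel. (\<lambda>k. u ((r \<circ> s) k) x) \<longlonglongrightarrow> w x"
    using ae by (simp add: o_def)
  ultimately show ?thesis using w by blast
qed

section \<open>The Brezis-Lieb lemma\<close>

text \<open>If \<open>b\<close> is small relative to \<open>t\<close>, then \<open>s / t\<close> is
  near 1 and continuity of the power there gives the term with \<epsilon>. Otherwise
  \<open>s\<close> and \<open>t\<close> are both bounded by a multiple of \<open>b\<close>.\<close>

lemma powr_diff_bound:
  fixes q \<epsilon> :: real
  assumes q: "0 < q" and \<epsilon>: "0 < \<epsilon>"
  shows "\<exists>C\<ge>0. \<forall>s t b. 0 \<le> s \<longrightarrow> 0 \<le> t \<longrightarrow> \<bar>s - t\<bar> \<le> b \<longrightarrow> \<bar>s powr q - t powr q\<bar> \<le> \<epsilon> * t powr q + C * b powr q"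
proof -
  have "isCont (\<lambda>x::real. x powr q) 1"
    by (intro continuous_intros) auto
  then obtain \<eta>' where \<eta>': "0 < \<eta>'" "\<And>x. \<bar>x - 1\<bar> < \<eta>' \<Longrightarrow> \<bar>x powr q - 1\<bar> < \<epsilon>"
    using \<epsilon> unfolding continuous_at_eps_delta by (auto simp: dist_real_def)
  define \<eta> where "\<eta> = \<eta>' / 2"
  have \<eta>: "0 < \<eta>" "\<And>x. \<bar>x - 1\<bar> \<le> \<eta> \<Longrightarrow> \<bar>x powr q - 1\<bar> \<le> \<epsilon>"
    using \<eta>' by (auto simp: \<eta>_def intro!: less_imp_le[OF \<eta>'(2)])
  have "\<bar>s powr q - t powr q\<bar> \<le> \<epsilon> * t powr q + (1 / \<eta> + 1) powr q * b powr q"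
    if s: "0 \<le> s" and t: "0 \<le> t" and st: "\<bar>s - t\<bar> \<le> b" for s t b
  proof (cases "b \<le> \<eta> * t \<and> 0 < t")
    case True
    have "\<bar>s / t - 1\<bar> = \<bar>s - t\<bar> / t"
    proof -
      have "s / t - 1 = (s - t) / t" using True by (simp add: diff_divide_distrib)
      then show ?thesis using True by (simp add: abs_divide)
    qed
    also have "\<dots> \<le> \<eta>"
      using True st by (simp add: divide_le_eq)
    finally have "\<bar>(s / t) powr q - 1\<bar> \<le> \<epsilon>" by (rule \<eta>(2))
    then have "\<bar>(s / t) powr q - 1\<bar> * t powr q \<le> \<epsilon> * t powr q"
      by (intro mult_right_mono) auto
    moreover have "\<bar>(s / t) powr q - 1\<bar> * t powr q = \<bar>s powr q - t powr q\<bar>"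
    proof -
      have "s powr q = (s / t) powr q * t powr q"
        using True s by (simp flip: powr_mult)
      then have "s powr q - t powr q = ((s / t) powr q - 1) * t powr q"
        by (simp add: left_diff_distrib)
      then show ?thesis by (simp add: abs_mult)
    qed
    moreover have "0 \<le> (1 / \<eta> + 1) powr q * b powr q" by simp
    ultimately show ?thesis by linarith
  next
    case False
    have b: "0 \<le> b" using st by linarith
    have tb: "t \<le> b / \<eta>"
      using False t b \<eta>(1) by (cases "t = 0") (auto simp: field_simps)
    have "s \<le> (1 / \<eta> + 1) * b" "t \<le> (1 / \<eta> + 1) * b"
      using tb st b by (auto simp: field_simps abs_le_iff)
    then have "s powr q \<le> ((1 / \<eta> + 1) * b) powr q" "t powr q \<le> ((1 / \<eta> + 1) * b) powr q"
      using s t q by (auto intro!: powr_mono2)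
    then have "\<bar>s powr q - t powr q\<bar> \<le> ((1 / \<eta> + 1) * b) powr q"
      by (simp add: abs_le_iff add_increasing2 diff_le_eq)
    also have "\<dots> = (1 / \<eta> + 1) powr q * b powr q"
      by (rule powr_mult)
    finally show ?thesis
      using \<epsilon> by (simp add: add_increasing)
  qed
  moreover have "0 \<le> (1 / \<eta> + 1) powr q" by simp
  ultimately show ?thesis by blast
qed

text \<open>The part of \<open>\<bar>h k x\<bar>\<close> exceeding \<epsilon> times
  \<open>cmod (f k x - g x) powr q\<close> is dominated by a multiple of
  \<open>cmod (g x) powr q\<close> and vanishes in the limit; the remainder is uniformly small by
  the bound \<open>M\<close>. The weights vary with \<open>k\<close> because \<open>b\<close> is
  translated along with the minimizing sequence.\<close>

lemma brezis_lieb: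
  fixes f :: "nat \<Rightarrow> 'a::euclidean_space \<Rightarrow> complex" and g :: "'a \<Rightarrow> complex" and b :: "nat \<Rightarrow> 'a \<Rightarrow> real"
  assumes q: "0 < q" and [measurable]: "\<And>k. f k \<in> borel_measurable borel" "g \<in> borel_measurable borel"
      "\<And>k. b k \<in> borel_measurable borel" "\<beta> \<in> borel_measurable borel"
    and int_f: "\<And>k. integrable lborel (\<lambda>x. cmod (f k x) powr q)"
    and int_g: "integrable lborel (\<lambda>x. cmod (g x) powr q)"
    and int_d: "\<And>k. integrable lborel (\<lambda>x. cmod (f k x - g x) powr q)"
    and bd: "\<And>k. (LINT x|lborel. cmod (f k x - g x) powr q) \<le> M"
    and ae: "AE x in lborel. (\<lambda>k. f k x) \<longlonglongrightarrow> g x"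
    and b: "\<And>k x. 0 \<le> b k x" "\<And>k x. b k x \<le> D" and b_lim: "\<And>x. (\<lambda>k. b k x) \<longlonglongrightarrow> \<beta> x"
  shows "(\<lambda>k. (LINT x|lborel. b k x * cmod (f k x) powr q) - (LINT x|lborel. b k x * cmod (f k x - g x) powr q))
    \<longlonglongrightarrow> (LINT x|lborel. \<beta> x * cmod (g x) powr q)"
proof -
  have D: "0 \<le> D" using b order_trans by blast
  have M: "0 \<le> M" by (rule order_trans[OF _ bd[of 0]]) (intro integral_nonneg_AE, simp)
  have int_b: "integrable lborel (\<lambda>x. b k x * h x)" if h: "integrable lborel h" for h :: "'a \<Rightarrow> real" and k
  proof (rule Bochner_Integration.integrable_bound)
    have [measurable]: "h \<in> borel_measurable borel" using h by simp
    show "integrable lborel (\<lambda>x. D * h x)" by (intro integrable_mult_right h)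
    show "AE x in lborel. norm (b k x * h x) \<le> norm (D * h x)"
      using b D by (intro AE_I2) (auto simp: abs_mult intro!: mult_right_mono)
    show "(\<lambda>x. b k x * h x) \<in> borel_measurable lborel" by simp
  qed
  define h where "h k x = cmod (f k x) powr q - cmod (f k x - g x) powr q - cmod (g x) powr q" for k x
  have int_h: "integrable lborel (h k)" for k
    unfolding h_def by (intro Bochner_Integration.integrable_diff int_f int_g int_d)
  have [measurable]: "h k \<in> borel_measurable borel" for k
    using int_h[of k] by simp
  have h_lim: "(\<lambda>k. LINT x|lborel. b k x * h k x) \<longlonglongrightarrow> 0"
  proof (rule LIMSEQ_I)
    fix e :: real assume e: "0 < e"
    \<comment> \<open>Makes the remainder \<open>D * \<epsilon> * M\<close> at most
      \<open>e / 2\<close>; the summand 1 prevents division by 0.\<close>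
    define \<epsilon> where "\<epsilon> = e / (2 * (D * M + 1))"
    have DM: "0 < D * M + 1" using D M by (simp add: add_nonneg_pos)
    have \<epsilon>: "0 < \<epsilon>" using e DM by (simp add: \<epsilon>_def)
    obtain C where C: "0 \<le> C" "\<And>s t b. 0 \<le> s \<Longrightarrow> 0 \<le> t \<Longrightarrow> \<bar>s - t\<bar> \<le> b \<Longrightarrow> \<bar>s powr q - t powr q\<bar> \<le> \<epsilon> * t powr q + C * b powr q"
      using powr_diff_bound[OF q \<epsilon>] by blast
    define W where "W k x = max 0 (\<bar>h k x\<bar> - \<epsilon> * cmod (f k x - g x) powr q)" for k x
    have [measurable]: "W k \<in> borel_measurable borel" for k
      unfolding W_def by measurable
    have W_le: "W k x \<le> (C + 1) * cmod (g x) powr q" for k x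
    proof -
      have "\<bar>cmod (f k x) - cmod (f k x - g x)\<bar> \<le> cmod (g x)"
        using norm_triangle_ineq3[of "f k x" "f k x - g x"] by simp
      from C(2)[OF _ _ this]
      have "\<bar>cmod (f k x) powr q - cmod (f k x - g x) powr q\<bar> \<le> \<epsilon> * cmod (f k x - g x) powr q + C * cmod (g x) powr q"
        by simp
      then have "\<bar>h k x\<bar> \<le> \<epsilon> * cmod (f k x - g x) powr q + C * cmod (g x) powr q + cmod (g x) powr q"
        unfolding h_def by (smt (verit) powr_ge_zero)
      then show ?thesis using C(1) by (simp add: W_def algebra_simps)
    qed
    have W0: "0 \<le> W k x" for k x by (simp add: W_def)
    have int_W: "integrable lborel (W k)" for k
      by (rule Bochner_Integration.integrable_bound[OF integrable_mult_right[OF int_g, of "C + 1"]])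
        (use W_le W0 C in \<open>auto\<close>)
    have "(\<lambda>k. LINT x|lborel. W k x) \<longlonglongrightarrow> (LINT x::'a|lborel. 0 :: real)"
    proof (rule integral_dominated_convergence)
      show "integrable lborel (\<lambda>x. (C + 1) * cmod (g x) powr q)" by (intro integrable_mult_right int_g)
      show "AE x in lborel. norm (W k x) \<le> (C + 1) * cmod (g x) powr q" for k
        using W_le W0 by simp
      show "AE x in lborel. (\<lambda>k. W k x) \<longlonglongrightarrow> 0"
        using ae
      proof eventually_elim
        case (elim x)
        have "(\<lambda>k. W k x) \<longlonglongrightarrow> max 0 (\<bar>cmod (g x) powr q - cmod (g x - g x) powr q - cmod (g x) powr q\<bar> - \<epsilon> * cmod (g x - g x) powr q)"
          unfolding W_def h_def using q by (intro tendsto_intros tendsto_powr' elim) auto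
        then show ?case by simp
      qed
    qed auto
    then have "(\<lambda>k. D * (LINT x|lborel. W k x)) \<longlonglongrightarrow> 0"
      using tendsto_mult_right_zero[of "\<lambda>k. LINT x|lborel. W k x" sequentially D] by simp
    then obtain k0 where k0: "\<And>k. k \<ge> k0 \<Longrightarrow> D * (LINT x|lborel. W k x) < e / 2"
      using order_tendstoD(2)[of _ 0 sequentially "e / 2"] e by (auto simp: eventually_sequentially)
    have "norm ((LINT x|lborel. b k x * h k x) - 0) < e" if "k \<ge> k0" for k
    proof -
      have "norm (LINT x|lborel. b k x * h k x) \<le> (LINT x|lborel. norm (b k x * h k x))"
        by (rule integral_norm_bound)
      also have "\<dots> \<le> (LINT x|lborel. D * W k x + D * \<epsilon> * cmod (f k x - g x) powr q)"
      proof (rule integral_mono)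
        show "integrable lborel (\<lambda>x. norm (b k x * h k x))" by (intro integrable_norm int_b int_h)
        show "integrable lborel (\<lambda>x. D * W k x + D * \<epsilon> * cmod (f k x - g x) powr q)"
          by (intro Bochner_Integration.integrable_add integrable_mult_right int_W int_d)
        fix x
        have "norm (b k x * h k x) = b k x * \<bar>h k x\<bar>" using b(1) by (simp add: abs_mult)
        also have "\<dots> \<le> D * \<bar>h k x\<bar>" by (intro mult_right_mono b) auto
        also have "\<dots> \<le> D * (W k x + \<epsilon> * cmod (f k x - g x) powr q)"
          using D by (intro mult_left_mono) (auto simp: W_def)
        finally show "norm (b k x * h k x) \<le> D * W k x + D * \<epsilon> * cmod (f k x - g x) powr q"
          by (simp add: algebra_simps)
      qed
      also have "\<dots> = D * (LINT x|lborel. W k x) + D * \<epsilon> * (LINT x|lborel. cmod (f k x - g x) powr q)"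
        using int_W int_d by simp
      also have "\<dots> \<le> D * (LINT x|lborel. W k x) + D * \<epsilon> * M"
        using D \<epsilon> by (intro add_left_mono mult_left_mono bd) auto
      also have "\<dots> < e / 2 + e / 2"
      proof (rule add_less_le_mono[OF k0[OF that]])
        have "D * \<epsilon> * M = (D * M) * \<epsilon>" by simp
        also have "\<dots> \<le> (D * M + 1) * \<epsilon>" using \<epsilon> by (intro mult_right_mono) auto
        also have "\<dots> = e / 2"
        proof -
          have "P * (e / (2 * P)) = e / 2" if "0 < P" for P using that by simp
          from this[OF DM] show ?thesis by (simp only: \<epsilon>_def)
        qed
        finally show "D * \<epsilon> * M \<le> e / 2" .
      qed
      finally show ?thesis by simp
    qed
    then show "\<exists>no. \<forall>k\<ge>no. norm ((LINT x|lborel. b k x * h k x) - 0) < e" by blast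
  qed
  have "(\<lambda>k. LINT x|lborel. b k x * cmod (g x) powr q) \<longlonglongrightarrow> (LINT x|lborel. \<beta> x * cmod (g x) powr q)"
  proof (rule integral_dominated_convergence)
    show "integrable lborel (\<lambda>x. D * cmod (g x) powr q)" by (intro integrable_mult_right int_g)
    show "AE x in lborel. (\<lambda>k. b k x * cmod (g x) powr q) \<longlonglongrightarrow> \<beta> x * cmod (g x) powr q"
      by (intro AE_I2 tendsto_intros b_lim)
    show "AE x in lborel. norm (b k x * cmod (g x) powr q) \<le> D * cmod (g x) powr q" for k
      using b by (intro AE_I2) (auto simp: abs_mult intro!: mult_right_mono)
  qed auto
  from tendsto_add[OF h_lim this]
  have "(\<lambda>k. (LINT x|lborel. b k x * h k x) + (LINT x|lborel. b k x * cmod (g x) powr q)) \<longlonglongrightarrow> (LINT x|lborel. \<beta> x * cmod (g x) powr q)"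
    by simp
  moreover have "(LINT x|lborel. b k x * h k x) + (LINT x|lborel. b k x * cmod (g x) powr q)
      = (LINT x|lborel. b k x * cmod (f k x) powr q) - (LINT x|lborel. b k x * cmod (f k x - g x) powr q)" for k
    unfolding h_def
    by (simp add: right_diff_distrib int_b int_f int_g int_d)
  ultimately show ?thesis by simp
qed

section \<open>Gaussians belong to every Sobolev space\<close>

text \<open>The inequality \<open>ln y \<le> y - 1\<close> at
  \<open>y = (1 + s) / (2 * \<alpha>)\<close>, multiplied by \<alpha>; the scaling of
  \<open>y\<close> is chosen to produce the exponent \<open>s / 2\<close>.\<close>

lemma powr_le_exp:
  fixes \<alpha> s :: real
  assumes \<alpha>: "0 < \<alpha>" and s: "0 \<le> s"
  shows "(1 + s) powr \<alpha> \<le> exp (1 / 2 + \<alpha> * ln (2 * \<alpha>)) * exp (s / 2)"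
proof -
  have "ln ((1 + s) / (2 * \<alpha>)) \<le> (1 + s) / (2 * \<alpha>) - 1"
    using \<alpha> s by (intro ln_le_minus_one) auto
  then have "\<alpha> * (ln (1 + s) - ln (2 * \<alpha>)) \<le> \<alpha> * ((1 + s) / (2 * \<alpha>))"
    using \<alpha> s by (intro mult_left_mono) (auto simp: ln_div)
  then have "\<alpha> * ln (1 + s) \<le> (1 / 2 + \<alpha> * ln (2 * \<alpha>)) + s / 2"
    using \<alpha> by (simp add: algebra_simps add_divide_distrib)
  then show ?thesis
    using s by (simp add: powr_def flip: exp_add)
qed

text \<open>Ensures that the constraint set is not empty. The Gaussian is its own transform, and its
  square absorbs the growth \<open>exp (s / 2)\<close> of the weight with one Gaussian left
  over.\<close>

lemma gauss_sobolev:
  assumes K: "real_scalars K" and \<alpha>: "0 < \<alpha>"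
  shows "(\<lambda>x :: real ^ 'n. complex_of_real (gauss x)) \<in> sobolev K \<alpha>"
proof (rule sobolevI)
  let ?u = "\<lambda>x :: real ^ 'n. complex_of_real (gauss x)"
  have sq: "(gauss x)\<^sup>2 \<le> gauss x" for x :: "real ^ 'n"
    unfolding power2_eq_square by (rule mult_left_le_one_le) auto
  show u: "?u \<in> L2"
  proof (rule L2I)
    show "integrable lborel (\<lambda>x. (cmod (?u x))\<^sup>2)"
      by (rule Bochner_Integration.integrable_bound[OF gauss_integrable]) (use sq in auto)
  qed measurable
  show "range ?u \<subseteq> K" using K by (auto simp: real_scalars_def)
  have u1: "integrable lborel ?u" by (intro integrable_of_real gauss_integrable)
  have F: "AE \<xi> in lborel. fourier_L2 ?u \<xi> = of_real (gauss \<xi>)"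
    using fourier_L2_L1[OF u u1] fourier_L1_gauss_scaled[of 1, where ?'n = 'n] by simp
  let ?v = "\<lambda>\<xi> :: real ^ 'n. of_real ((1 + (norm \<xi>)\<^sup>2) powr (\<alpha> / 2)) * complex_of_real (gauss \<xi>)"
  have v: "?v \<in> L2"
  proof (rule L2I)
    define C where "C = exp (1 / 2 + \<alpha> * ln (2 * \<alpha>))"
    have "(cmod (?v \<xi>))\<^sup>2 \<le> C * gauss \<xi>" for \<xi>
    proof -
      have "(cmod (?v \<xi>))\<^sup>2 = (1 + (norm \<xi>)\<^sup>2) powr \<alpha> * (gauss \<xi>)\<^sup>2"
        by (simp add: norm_mult power_mult_distrib power2_eq_square[of "_ powr _"] flip: powr_add)
      also have "\<dots> \<le> C * exp ((norm \<xi>)\<^sup>2 / 2) * (gauss \<xi>)\<^sup>2"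
        unfolding C_def by (intro mult_right_mono powr_le_exp \<alpha>) auto
      also have "\<dots> = C * gauss \<xi>"
        by (simp add: gauss_def power2_eq_square[of "exp _"] flip: exp_add)
      finally show ?thesis .
    qed
    then show "integrable lborel (\<lambda>\<xi>. (cmod (?v \<xi>))\<^sup>2)"
      by (intro Bochner_Integration.integrable_bound[OF integrable_mult_right[OF gauss_integrable, of C]])
        (auto simp: C_def)
  qed measurable
  show "bessel \<alpha> ?u \<in> L2"
  proof (rule L2_cong_AE[OF v bessel_measurable[OF u]])
    show "AE \<xi> in lborel. ?v \<xi> = bessel \<alpha> ?u \<xi>"
      using F by eventually_elim (simp add: bessel_def)
  qed
qed

section \<open>Existence of a minimizer\<close>

lemma integer_lattice_uminus: "y \<in> integer_lattice \<Longrightarrow> - y \<in> integer_lattice"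
  by (simp add: integer_lattice_def)

lemma integer_lattice_closed: "closed (integer_lattice :: (real ^ 'n) set)"
proof -
  have eq: "integer_lattice = (\<Inter>i. (\<lambda>y :: real ^ 'n. y $ i) -` \<int>)"
    by (auto simp: integer_lattice_def)
  show ?thesis
    unfolding eq by (intro closed_INT ballI closed_vimage closed_Ints continuous_intros)
qed

lemma integer_lattice_decompose:
  fixes x :: "real ^ 'n"
  shows "\<exists>y z. x = z + y \<and> y \<in> integer_lattice \<and> norm z \<le> real CARD('n)"
proof -
  define y :: "real ^ 'n" where "y = (\<chi> i. of_int \<lfloor>x $ i\<rfloor>)"
  have "norm (x - y) \<le> (\<Sum>i\<in>UNIV. \<bar>(x - y) $ i\<bar>)"
    by (rule norm_le_l1_cart)
  also have "\<dots> \<le> (\<Sum>i\<in>(UNIV :: 'n set). 1)"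
  proof (rule sum_mono)
    fix i
    show "\<bar>(x - y) $ i\<bar> \<le> 1"
      using of_int_floor_le[of "x $ i"] real_of_int_floor_add_one_ge[of "x $ i"] by (simp add: y_def abs_le_iff; linarith)
  qed
  finally have "norm (x - y) \<le> real CARD('n)" by simp
  moreover have "y \<in> integer_lattice" by (simp add: y_def integer_lattice_def)
  ultimately show ?thesis by (intro exI[of _ y] exI[of _ "x - y"]) simp
qed

text \<open>The quantity \<open>t k = inverse (1 + norm (y (r1 k)))\<close> compactifies the range
  of the norms: limit 0 means escape to infinity, any other limit means boundedness. In the bounded
  case the limit stays in the lattice, which is closed.\<close>

lemma translation_subseq:
  fixes y z :: "nat \<Rightarrow> real ^ 'n"
  assumes z: "\<And>k. norm (z k) \<le> R" and y: "\<And>k. y k \<in> integer_lattice"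
  shows "\<exists>r z0. strict_mono r \<and> (\<lambda>k. z (r k)) \<longlonglongrightarrow> z0 \<and>
    ((\<exists>y0\<in>integer_lattice. (\<lambda>k. y (r k)) \<longlonglongrightarrow> y0) \<or> filterlim (\<lambda>k. y (r k)) at_infinity sequentially)"
proof -
  have bounded_subseq: "\<exists>r l. strict_mono r \<and> (\<lambda>k. f (r k)) \<longlonglongrightarrow> l" if "\<And>k. norm (f k) \<le> S"
    for f :: "nat \<Rightarrow> 'b::euclidean_space" and S
  proof -
    have "bounded (range f)" using that by (auto simp: bounded_iff)
    then show ?thesis using bounded_imp_convergent_subsequence[of f] by (auto simp: o_def)
  qed
  obtain r1 z0 where r1: "strict_mono r1" and z0: "(\<lambda>k. z (r1 k)) \<longlonglongrightarrow> z0"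
    using bounded_subseq[of z R, OF z] by blast
  define t where "t k = inverse (1 + norm (y (r1 k)))" for k
  have t: "0 < t k" "t k \<le> 1" for k
    by (simp_all add: t_def inverse_le_1_iff add_pos_nonneg)
  then have "norm (t k) \<le> 1" for k using less_imp_le[OF t(1)] by simp
  then obtain r2 t0 where r2: "strict_mono r2" and t0: "(\<lambda>k. t (r2 k)) \<longlonglongrightarrow> t0"
    using bounded_subseq[of t 1] by blast
  have z2: "(\<lambda>k. z (r1 (r2 k))) \<longlonglongrightarrow> z0"
    using LIMSEQ_subseq_LIMSEQ[OF z0 r2] by (simp add: o_def)
  have norm_y: "norm (y (r1 k)) = inverse (t k) - 1" for k
    by (simp add: t_def)
  show ?thesis
  proof (cases "t0 = 0")
    case True
    have "filterlim (\<lambda>k. inverse (t (r2 k))) at_top sequentially"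
      using t0 True t by (intro filterlim_inverse_at_top) auto
    then have "filterlim (\<lambda>k. - 1 + inverse (t (r2 k))) at_top sequentially"
      by (rule filterlim_tendsto_add_at_top[OF tendsto_const])
    then have "filterlim (\<lambda>k. norm (y (r1 (r2 k)))) at_top sequentially"
      by (simp add: norm_y)
    then have "filterlim (\<lambda>k. y (r1 (r2 k))) at_infinity sequentially"
      by (rule filterlim_norm_at_top_imp_at_infinity)
    then show ?thesis
      using strict_mono_o[OF r1 r2] z2 by (intro exI[of _ "r1 \<circ> r2"] exI[of _ z0]) (simp add: o_def)
  next
    case False
    have "(\<lambda>k. inverse (t (r2 k))) \<longlonglongrightarrow> inverse t0"
      using t0 False by (rule tendsto_inverse)
    then have "Bseq (\<lambda>k. inverse (t (r2 k)))"
      by (intro convergent_imp_Bseq) (auto simp: convergent_def)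
    then obtain S where S: "\<forall>k. norm (inverse (t (r2 k))) \<le> S"
      unfolding Bseq_def by blast
    have "norm (y (r1 (r2 k))) \<le> S" for k
      using S[rule_format, of k] abs_ge_self[of "inverse (t (r2 k))"] unfolding norm_y real_norm_def by linarith
    then obtain r3 y0 where r3: "strict_mono r3" and y0: "(\<lambda>k. y (r1 (r2 (r3 k)))) \<longlonglongrightarrow> y0"
      using bounded_subseq[of "\<lambda>k. y (r1 (r2 k))" S] by blast
    have "y0 \<in> integer_lattice"
      by (rule closed_sequentially[OF integer_lattice_closed _ y0]) (rule y)
    moreover have "(\<lambda>k. z (r1 (r2 (r3 k)))) \<longlonglongrightarrow> z0"
      using LIMSEQ_subseq_LIMSEQ[OF z2 r3] by (simp add: o_def)
    ultimately show ?thesis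
      using strict_mono_o[OF strict_mono_o[OF r1 r2] r3] y0
      by (intro exI[of _ "r1 \<circ> r2 \<circ> r3"] exI[of _ z0]) (auto simp: o_def)
  qed
qed

lemma bounded_of_limit_at_infinity:
  fixes b :: "'a::euclidean_space \<Rightarrow> real"
  assumes cont: "continuous_on UNIV b" and lim: "(b \<longlongrightarrow> l) at_infinity"
  shows "\<exists>D>0. \<forall>x. b x \<le> D"
proof -
  have "\<forall>\<^sub>F x in at_infinity. b x < l + 1"
    using order_tendstoD(2)[OF lim, of "l + 1"] by simp
  then obtain R where R: "\<And>x. R \<le> norm x \<Longrightarrow> b x < l + 1"
    by (auto simp: eventually_at_infinity)
  have "bounded (b ` cball 0 R)"
    by (intro compact_imp_bounded compact_continuous_image continuous_on_subset[OF cont]) auto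
  then obtain E where "\<forall>x\<in>cball 0 R. \<bar>b x\<bar> \<le> E"
    by (auto simp: bounded_iff)
  then have E: "\<bar>b x\<bar> \<le> E" if "norm x \<le> R" for x
    using that by simp
  have "b x \<le> \<bar>l\<bar> + \<bar>E\<bar> + 1" for x
    using R[of x] E[of x] by (cases "norm x \<le> R") auto
  then show ?thesis by (intro exI[of _ "\<bar>l\<bar> + \<bar>E\<bar> + 1"]) auto
qed

text \<open>On the unit interval \<open>s \<le> s powr p\<close>, strictly in the interior. The
  strict form forces \<open>t = 1\<close> when the translations converge; the weak form contradicts
  a strict inequality when they diverge.\<close>

lemma powr_sum_ge_1:
  fixes t p :: real
  assumes t: "0 \<le> t" "t \<le> 1" and p: "0 < p" "p < 1"
  shows "1 \<le> t powr p + (1 - t) powr p" and "0 < t \<Longrightarrow> t < 1 \<Longrightarrow> 1 < t powr p + (1 - t) powr p"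
proof -
  have le: "s \<le> s powr p" if "0 \<le> s" "s \<le> 1" for s :: real
    using that p powr_mono'[of p 1 s] by simp
  have less: "s < s powr p" if "0 < s" "s < 1" for s :: real
  proof -
    have "1 * ln s < p * ln s"
      using that p by (intro mult_strict_right_mono_neg) (auto simp: ln_less_zero)
    then have "exp (ln s) < exp (p * ln s)" by simp
    then show ?thesis using that by (simp add: powr_def)
  qed
  show "1 \<le> t powr p + (1 - t) powr p"
    using le[of t] le[of "1 - t"] t by linarith
  show "1 < t powr p + (1 - t) powr p" if "0 < t" "t < 1"
    using less[of t] le[of "1 - t"] that by linarith
qed

lemma minimizer_exists:
  fixes b :: "real ^ 'n \<Rightarrow> real" and B :: "(real ^ 'n \<Rightarrow> complex) \<Rightarrow> (real ^ 'n \<Rightarrow> complex) \<Rightarrow> real"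
  assumes K: "real_scalars K" and cont: "continuous_on UNIV b" and b_lim: "(b \<longlongrightarrow> b_inf) at_infinity"
    and b_inf: "0 < b_inf" "\<And>x. b_inf < b x"
    and \<alpha>: "0 < \<alpha>" and q: "2 < q" and crit: "ereal q < critical_exponent CARD('n) \<alpha>"
    and B: "semi_inner (sobolev K \<alpha>) B"
    and c: "0 < c" "\<And>f. f \<in> sobolev K \<alpha> \<Longrightarrow> c * sobolev_norm \<alpha> f \<le> sqrt (B f f)"
    and C: "0 < C" "\<And>f. f \<in> sobolev K \<alpha> \<Longrightarrow> sqrt (B f f) \<le> C * sobolev_norm \<alpha> f"
    and inv: "\<And>f y. f \<in> sobolev K \<alpha> \<Longrightarrow> y \<in> integer_lattice \<Longrightarrow> sqrt (B (\<lambda>x. f (x - y)) (\<lambda>x. f (x - y))) = sqrt (B f f)"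
  shows "\<exists>u\<in>constraint_set K \<alpha> q b. sqrt (B u u) = (INF v\<in>constraint_set K \<alpha> q b. sqrt (B v v))"
proof -
  let ?V = "sobolev K \<alpha> :: (real ^ 'n \<Rightarrow> complex) set"
  let ?S = "constraint_set K \<alpha> q b"
  interpret H: semi_inner ?V B by fact
  have N: "H.N f = sqrt (B f f)" for f by (simp add: H.N_def)
  have dec: "0 < decay CARD('n) \<alpha> q" by (rule decay_pos[OF \<alpha> q crit])
  obtain D where D: "0 < D" "\<And>x. b x \<le> D"
    using bounded_of_limit_at_infinity[OF cont b_lim] by blast
  have [measurable]: "b \<in> borel_measurable borel"
    by (rule borel_measurable_continuous_onI[OF cont])
  have b0: "0 < b x" for x using b_inf(1) b_inf(2)[of x] by linarith
  obtain E where E: "0 < E" "\<And>u. u \<in> ?V \<Longrightarrow> (\<integral>\<^sup>+x. ennreal (cmod (u x) powr q) \<partial>lborel) \<le> ennreal (E * sobolev_norm \<alpha> u powr q)"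
    using sobolev_embedding[OF \<alpha> q dec, of K] by blast
  have meas: "u \<in> borel_measurable borel" if "u \<in> ?V" for u
    using sobolevD(1)[OF that] by (rule L2_measurable)
  have int_q: "integrable lborel (\<lambda>x. cmod (u x) powr q)" if u: "u \<in> ?V" for u
  proof (rule integrableI_bounded)
    have [measurable]: "u \<in> borel_measurable borel" by (rule meas[OF u])
    show "(\<lambda>x. cmod (u x) powr q) \<in> borel_measurable lborel" by measurable
    show "(\<integral>\<^sup>+x. ennreal (norm (cmod (u x) powr q)) \<partial>lborel) < \<infinity>"
      using E(2)[OF u] by (simp add: order_le_less_trans[OF _ ennreal_less_top])
  qed
  have LINT_q: "(LINT x|lborel. cmod (u x) powr q) \<le> E * sobolev_norm \<alpha> u powr q" if u: "u \<in> ?V" for u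
    using E(2)[OF u] E(1) by (subst (asm) nn_integral_eq_integral[OF int_q[OF u]]) auto
  have int_b: "integrable lborel (\<lambda>x. b (x + y) * cmod (u x) powr q)" if u: "u \<in> ?V" for u y
  proof (rule Bochner_Integration.integrable_bound)
    have [measurable]: "u \<in> borel_measurable borel" by (rule meas[OF u])
    show "integrable lborel (\<lambda>x. D * cmod (u x) powr q)" by (intro integrable_mult_right int_q u)
    show "(\<lambda>x. b (x + y) * cmod (u x) powr q) \<in> borel_measurable lborel" by measurable
    show "AE x in lborel. norm (b (x + y) * cmod (u x) powr q) \<le> norm (D * cmod (u x) powr q)"
      using D b0 by (intro AE_I2) (auto simp: abs_mult abs_of_pos intro!: mult_right_mono)
  qed
  define I where "I u = (LINT x|lborel. b x * cmod (u x) powr q)" for u :: "real ^ 'n \<Rightarrow> complex"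
  have S_iff: "u \<in> ?S \<longleftrightarrow> u \<in> ?V \<and> I u = 1" for u
    using int_b[of u 0] by (auto simp: constraint_set_def has_bochner_integral_iff I_def)
  have I_nonneg: "0 \<le> I u" for u
    unfolding I_def using b0 by (intro integral_nonneg_AE AE_I2 mult_nonneg_nonneg) (auto intro: less_imp_le)
  have I_shift: "I (\<lambda>x. u (x - y)) = (LINT x|lborel. b (x + y) * cmod (u x) powr q)" if u: "u \<in> ?V" for u y
  proof -
    have [measurable]: "u \<in> borel_measurable borel" by (rule meas[OF u])
    have "(LINT x|lborel. b ((x - y) + y) * cmod (u (x - y)) powr q) = (LINT x|lborel. b (x + y) * cmod (u x) powr q)"
      by (rule integrable_lborel_shift(4)[of "\<lambda>x. b (x + y) * cmod (u x) powr q"]) measurable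
    then show ?thesis by (simp add: I_def)
  qed
  have I_le: "I u \<le> D * (LINT x|lborel. cmod (u x) powr q)" if u: "u \<in> ?V" for u
  proof -
    have "I u \<le> (LINT x|lborel. D * cmod (u x) powr q)"
      unfolding I_def using int_b[OF u, of 0] int_q[OF u] D by (intro integral_mono) (auto intro: mult_right_mono)
    then show ?thesis by simp
  qed
  define \<kappa> where "\<kappa> = (INF v\<in>?S. H.N v)"
  have bb: "bdd_below (H.N ` ?S)"
    by (rule bdd_belowI[of _ 0]) (auto simp: S_iff H.N_nonneg)
  have \<kappa>_le: "\<kappa> \<le> H.N v" if "v \<in> ?S" for v
    unfolding \<kappa>_def by (rule cINF_lower[OF bb that])
  have normalize: "(\<lambda>x. of_real (I u powr (- 1 / q)) * u x) \<in> ?S" if u: "u \<in> ?V" and pos: "0 < I u" for u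
  proof -
    let ?v = "\<lambda>x. of_real (I u powr (- 1 / q)) * u x"
    have "cmod (?v x) powr q = I u powr (- 1) * cmod (u x) powr q" for x
      using q by (simp add: norm_mult powr_mult powr_powr)
    then have "I ?v = (LINT x|lborel. I u powr (- 1) * (b x * cmod (u x) powr q))"
      unfolding I_def[of ?v] by (simp only: mult.left_commute)
    also have "\<dots> = I u powr (- 1) * I u"
      unfolding I_def[symmetric] by (simp add: I_def)
    also have "\<dots> = 1" using pos by (simp add: powr_minus)
    finally show ?thesis
      unfolding S_iff using H.scale_mem[OF u] by blast
  qed
  \<comment> \<open>The definition of \<open>\<kappa>\<close> in homogeneous form, free of the
    constraint. If \<open>I u = 0\<close>, the left side is 0 because
    \<open>0 powr (2 / q) = 0\<close>.\<close>
  have hom: "\<kappa>\<^sup>2 * I u powr (2 / q) \<le> B u u" if u: "u \<in> ?V" and \<kappa>0: "0 \<le> \<kappa>" for u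
  proof (cases "I u = 0")
    case True
    then show ?thesis using H.nonneg[OF u] q by simp
  next
    case False
    then have pos: "0 < I u" using I_nonneg[of u] by simp
    have "\<kappa> \<le> I u powr (- 1 / q) * H.N u"
      using \<kappa>_le[OF normalize[OF u pos]] H.N_scale[OF u, of "I u powr (- 1 / q)"] by simp
    then have "\<kappa> * I u powr (1 / q) \<le> I u powr (- 1 / q) * H.N u * I u powr (1 / q)"
      by (intro mult_right_mono) auto
    also have "\<dots> = H.N u * (I u powr (- 1 / q) * I u powr (1 / q))"
      by (simp only: mult_ac)
    also have "I u powr (- 1 / q) * I u powr (1 / q) = 1"
      using pos by (simp flip: powr_add)
    finally have "(\<kappa> * I u powr (1 / q))\<^sup>2 \<le> (H.N u)\<^sup>2"
      using \<kappa>0 by (intro power_mono) auto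
    moreover have "(I u powr (1 / q))\<^sup>2 = I u powr (2 / q)"
      by (simp add: power2_eq_square flip: powr_add)
    ultimately show ?thesis
      by (simp add: power_mult_distrib H.N_sq[OF u])
  qed
  have S_ne: "?S \<noteq> {}"
  proof -
    let ?g = "\<lambda>x :: real ^ 'n. complex_of_real (gauss x)"
    have g: "?g \<in> ?V" by (rule gauss_sobolev[OF K \<alpha>])
    have "I ?g \<noteq> 0"
    proof
      assume "I ?g = 0"
      then have "AE x in lborel. b x * cmod (?g x) powr q = 0"
        unfolding I_def using int_b[OF g, of 0] less_imp_le[OF b0]
        by (subst (asm) integral_nonneg_eq_0_iff_AE) auto
      moreover have "b x * cmod (?g x) powr q \<noteq> 0" for x
        using b0[of x] by (simp add: gauss_def)
      ultimately have "AE x in (lborel :: (real ^ 'n) measure). False" by simp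
      then show False by (simp add: eventually_False ae_filter_eq_bot_iff)
    qed
    then show ?thesis using normalize[OF g] I_nonneg[of ?g] by fastforce
  qed
  have \<kappa>_pos: "0 < \<kappa>"
  proof -
    \<comment> \<open>From \<open>1 = I v \<le> D * E * sobolev_norm \<alpha> v powr q\<close> on
      the constraint set, and then the norm equivalence.\<close>
    define \<kappa>0 where "\<kappa>0 = c * (1 / (D * E)) powr (1 / q)"
    have "\<kappa>0 \<le> H.N v" if v: "v \<in> ?S" for v
    proof -
      have vV: "v \<in> ?V" using v by (simp add: S_iff)
      have "1 \<le> D * (E * sobolev_norm \<alpha> v powr q)"
        using order_trans[OF I_le[OF vV] mult_left_mono[OF LINT_q[OF vV] less_imp_le[OF D(1)]]] v by (simp add: S_iff)
      then have "1 / (D * E) \<le> sobolev_norm \<alpha> v powr q"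
        using D(1) E(1) by (simp add: field_simps)
      then have "(1 / (D * E)) powr (1 / q) \<le> (sobolev_norm \<alpha> v powr q) powr (1 / q)"
        using D(1) E(1) q by (intro powr_mono2) auto
      also have "\<dots> = sobolev_norm \<alpha> v"
        using q by (simp add: powr_powr)
      finally have "\<kappa>0 \<le> c * sobolev_norm \<alpha> v"
        unfolding \<kappa>0_def using c(1) by (intro mult_left_mono) auto
      then show ?thesis using c(2)[OF vV] by (simp add: N)
    qed
    then have "\<kappa>0 \<le> \<kappa>"
      unfolding \<kappa>_def using S_ne by (intro cINF_greatest) auto
    moreover have "0 < \<kappa>0" using c(1) D(1) E(1) by (simp add: \<kappa>0_def)
    ultimately show ?thesis by linarith
  qed
  then have \<kappa>0: "0 \<le> \<kappa>" by simp
  have "\<exists>v. v \<in> ?S \<and> H.N v < \<kappa> + 1 / Suc k" for k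
    using cINF_less_iff[OF S_ne bb, of "\<kappa> + 1 / Suc k"] by (auto simp: \<kappa>_def)
  then obtain u where uS: "\<And>k. u k \<in> ?S" and u_lt: "\<And>k. H.N (u k) < \<kappa> + 1 / Suc k" by metis
  have uV: "u k \<in> ?V" and Iu: "I (u k) = 1" for k
    using uS by (simp_all add: S_iff)
  have Nu_lim: "(\<lambda>k. H.N (u k)) \<longlonglongrightarrow> \<kappa>"
  proof (rule tendsto_sandwich[OF always_eventually[OF allI] always_eventually[OF allI] tendsto_const])
    show "\<kappa> \<le> H.N (u k)" for k by (rule \<kappa>_le[OF uS])
    show "H.N (u k) \<le> \<kappa> + 1 / Suc k" for k using u_lt[of k] by simp
    show "(\<lambda>k. \<kappa> + 1 / Suc k) \<longlonglongrightarrow> \<kappa>"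
      using tendsto_add[OF tendsto_const[of \<kappa>] LIMSEQ_inverse_real_of_nat] by (simp add: inverse_eq_divide)
  qed
  have Nu_bd: "H.N (u k) \<le> \<kappa> + 1" for k
  proof -
    have "1 / real (Suc k) \<le> 1" by simp
    then show ?thesis using u_lt[of k] by linarith
  qed
  define M where "M = (\<kappa> + 1) / c"
  have M: "0 \<le> M" using \<kappa>0 c(1) by (simp add: M_def)
  have norm_bd: "sobolev_norm \<alpha> f \<le> M" if "f \<in> ?V" "H.N f \<le> \<kappa> + 1" for f
    unfolding M_def using c(1) order_trans[OF c(2)[OF that(1)] that(2)[unfolded N]] by (simp add: field_simps)
  \<comment> \<open>The constraint and \<open>b \<le> D\<close> keep the \<open>q\<close>-th power
    integrals away from 0.\<close>
  have lower: "ennreal (1 / D) \<le> (\<integral>\<^sup>+x. ennreal (cmod (u k x) powr q) \<partial>lborel)" for k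
    using I_le[OF uV[of k]] D(1) Iu[of k]
    by (subst nn_integral_eq_integral[OF int_q[OF uV]]) (auto simp: field_simps intro!: ennreal_leI)
  have "0 < 1 / D" using D(1) by simp
  from nonvanishing[OF \<alpha> q dec M this, of K]
  obtain J \<eta> where \<eta>: "0 < \<eta>" and "\<And>v. v \<in> ?V \<Longrightarrow> sobolev_norm \<alpha> v \<le> M \<Longrightarrow>
      ennreal (1 / D) \<le> (\<integral>\<^sup>+x. ennreal (cmod (v x) powr q) \<partial>lborel) \<Longrightarrow> \<exists>x. \<eta> \<le> cmod (low J v x)"
    by blast
  then have "\<exists>x. \<eta> \<le> cmod (low J (u k) x)" for k
    using uV norm_bd[OF uV Nu_bd] lower by blast
  then obtain x where x: "\<And>k. \<eta> \<le> cmod (low J (u k) (x k))" by metis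
  have "\<forall>k. \<exists>y z. x k = z + y \<and> y \<in> integer_lattice \<and> norm z \<le> real CARD('n)"
    using integer_lattice_decompose by blast
  then obtain y z where yz: "\<And>k. x k = z k + y k" and y: "\<And>k. y k \<in> integer_lattice" and z: "\<And>k. norm (z k) \<le> real CARD('n)"
    by metis
  obtain r z0 where r: "strict_mono r" and z0: "(\<lambda>k. z (r k)) \<longlonglongrightarrow> z0"
    and alt: "(\<exists>y0\<in>integer_lattice. (\<lambda>k. y (r k)) \<longlonglongrightarrow> y0) \<or> filterlim (\<lambda>k. y (r k)) at_infinity sequentially"
    using translation_subseq[of z "real CARD('n)" y, OF z y] by blast
  \<comment> \<open>Translation by \<open>- y (r k)\<close>, so that the point
    \<open>x (r k)\<close> moves to the bounded point \<open>z (r k)\<close>.\<close>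
  define v where "v k = (\<lambda>x. u (r k) (x - (- y (r k))))" for k
  have vV: "v k \<in> ?V" for k unfolding v_def by (rule sobolev_shift(1)[OF uV])
  have Nv: "H.N (v k) = H.N (u (r k))" for k
    unfolding v_def N by (rule inv[OF uV integer_lattice_uminus[OF y]])
  have low_v: "\<eta> \<le> cmod (low J (v k) (z (r k)))" for k
    using x[of "r k"] low_shift[OF sobolevD(1)[OF uV[of "r k"]], of J "- y (r k)" "z (r k)"]
    by (simp add: v_def yz)
  have v_bd: "sqrt (B (v k) (v k)) \<le> \<kappa> + 1" for k
    using Nu_bd[of "r k"] Nv[of k] by (simp add: N)
  have "\<exists>s w. strict_mono s \<and> w \<in> ?V \<and> (\<forall>j x. (\<lambda>k. low j (v (s k)) x) \<longlonglongrightarrow> low j w x) \<and>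
      (\<lambda>k. B (v (s k)) w) \<longlonglongrightarrow> B w w \<and> (AE x in lborel. (\<lambda>k. v (s k) x) \<longlonglongrightarrow> w x)"
    by (rule sobolev_weak_compact[OF K \<alpha> B c C vV v_bd])
  then obtain s w where s: "strict_mono s" and w: "w \<in> ?V"
    and low_lim: "\<And>j x. (\<lambda>k. low j (v (s k)) x) \<longlonglongrightarrow> low j w x"
    and B_lim: "(\<lambda>k. B (v (s k)) w) \<longlonglongrightarrow> B w w" and ae: "AE x in lborel. (\<lambda>k. v (s k) x) \<longlonglongrightarrow> w x"
    by blast
  \<comment> \<open>If \<open>w\<close> vanished, the low-frequency parts would tend to 0 at
    \<open>z0\<close>. By the uniform Lipschitz bound they would do so at the nearby points
    \<open>z (r (s k))\<close> as well, where they are at least \<open>\<eta>\<close>.\<close>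
  have w_ne: "\<not> (AE x in lborel. w x = 0)"
  proof
    assume "AE x in lborel. w x = 0"
    then have "l2 w = l2 (\<lambda>x :: real ^ 'n. 0)"
      by (intro l2_cong_AE meas[OF w]) auto
    then have "low J w z0 = 0"
      using low_bound[OF sobolevD(1)[OF w], of J z0] by (simp add: l2_def)
    then have "(\<lambda>k. low J (v (s k)) z0) \<longlonglongrightarrow> 0" using low_lim[of J z0] by simp
    moreover have "(\<lambda>k. low J (v (s k)) (z (r (s k))) - low J (v (s k)) z0) \<longlonglongrightarrow> 0"
    proof (rule Lim_null_comparison[OF always_eventually[OF allI]])
      define L where "L = 2 ^ J * (ball_const TYPE('n) * sqrt ((2 ^ J) ^ CARD('n)) * M)"
      have "(\<lambda>k. z (r (s k)) - z0) \<longlonglongrightarrow> 0"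
        using LIMSEQ_subseq_LIMSEQ[OF z0 s] by (simp add: o_def LIM_zero_iff)
      then show "(\<lambda>k. L * norm (z (r (s k)) - z0)) \<longlonglongrightarrow> 0"
        by (intro tendsto_mult_right_zero tendsto_norm_zero)
      fix k
      have "l2 (v (s k)) \<le> M"
        using l2_le_sobolev_norm[OF sobolevD(1,3)[OF vV] \<alpha>, of "s k"] norm_bd[OF vV, of "s k"] Nu_bd[of "r (s k)"] Nv[of "s k"] by simp
      then have "2 ^ J * norm (z (r (s k)) - z0) * (ball_const TYPE('n) * sqrt ((2 ^ J) ^ CARD('n)) * l2 (v (s k)))
          \<le> 2 ^ J * norm (z (r (s k)) - z0) * (ball_const TYPE('n) * sqrt ((2 ^ J) ^ CARD('n)) * M)"
        by (intro mult_left_mono mult_nonneg_nonneg ball_const_nonneg) auto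
      then show "norm (low J (v (s k)) (z (r (s k))) - low J (v (s k)) z0) \<le> L * norm (z (r (s k)) - z0)"
        using low_lipschitz[OF sobolevD(1)[OF vV[of "s k"]], of J "z (r (s k))" z0] by (simp add: L_def mult_ac)
    qed
    ultimately have "(\<lambda>k. (low J (v (s k)) (z (r (s k))) - low J (v (s k)) z0) + low J (v (s k)) z0) \<longlonglongrightarrow> 0 + 0"
      by (intro tendsto_add)
    then have "(\<lambda>k. cmod (low J (v (s k)) (z (r (s k))))) \<longlonglongrightarrow> 0"
      by (simp add: tendsto_norm_zero)
    then have "\<eta> \<le> 0"
      by (rule LIMSEQ_le_const) (use low_v in blast)
    then show False using \<eta> by simp
  qed
  have w_pos: "0 < (LINT x|lborel. cmod (w x) powr q)"
  proof (rule ccontr)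
    assume "\<not> ?thesis"
    moreover have "0 \<le> (LINT x|lborel. cmod (w x) powr q)" by (intro integral_nonneg_AE) auto
    ultimately have "(LINT x|lborel. cmod (w x) powr q) = 0" by simp
    then have "AE x in lborel. cmod (w x) powr q = 0"
      by (subst (asm) integral_nonneg_eq_0_iff_AE[OF int_q[OF w]]) auto
    then show False using w_ne by simp
  qed
  define Y where "Y k = y (r (s k))" for k
  have YL: "Y k \<in> integer_lattice" for k by (simp add: Y_def y)
  \<comment> \<open>Common to both alternatives: \<beta> is the limit of the translated weights,
    either a translate of \<open>b\<close> or the constant \<open>b_inf\<close>.\<close>
  have split: "t \<le> 1 \<and> \<kappa>\<^sup>2 * (1 - t) powr (2 / q) \<le> \<kappa>\<^sup>2 - B w w"
    if \<beta>_lim: "\<And>x. (\<lambda>k. b (x + Y k)) \<longlonglongrightarrow> \<beta> x" and [measurable]: "\<beta> \<in> borel_measurable borel"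
      and t: "t = (LINT x|lborel. \<beta> x * cmod (w x) powr q)" for \<beta> t
  proof -
    have [measurable]: "v k \<in> borel_measurable borel" "w \<in> borel_measurable borel" for k
      by (rule meas[OF vV], rule meas[OF w])
    note dV = H.diff_mem[OF vV w]
    define T where "T k = (LINT x|lborel. b (x + Y k) * cmod (v (s k) x - w x) powr q)" for k
    have Iv: "(LINT x|lborel. b (x + Y k) * cmod (v (s k) x) powr q) = 1" for k
      using I_shift[OF vV[of "s k"], of "Y k"] Iu[of "r (s k)"] by (simp add: v_def Y_def)
    have N_d: "H.N (\<lambda>x. v (s k) x - w x) \<le> \<kappa> + 1 + H.N w" for k
      using H.N_triangle_diff[OF vV w, of "s k"] Nv[of "s k"] Nu_bd[of "r (s k)"] by simp
    have "(\<lambda>k. (LINT x|lborel. b (x + Y k) * cmod (v (s k) x) powr q) - T k) \<longlonglongrightarrow> t"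
      unfolding t T_def
    proof (rule brezis_lieb[where D = D and M = "E * ((\<kappa> + 1 + H.N w) / c) powr q"])
      show "0 < q" using q by simp
      show "(LINT x|lborel. cmod (v (s k) x - w x) powr q) \<le> E * ((\<kappa> + 1 + H.N w) / c) powr q" for k
      proof -
        have "sobolev_norm \<alpha> (\<lambda>x. v (s k) x - w x) \<le> (\<kappa> + 1 + H.N w) / c"
          using c(1) order_trans[OF c(2)[OF dV[of "s k"]] N_d[of k, unfolded N[of "\<lambda>x. v (s k) x - w x"]]]
          by (simp add: field_simps)
        then have "E * sobolev_norm \<alpha> (\<lambda>x. v (s k) x - w x) powr q \<le> E * ((\<kappa> + 1 + H.N w) / c) powr q"
          using E(1) q by (intro mult_left_mono powr_mono2) auto
        then show ?thesis using LINT_q[OF dV[of "s k"]] by linarith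
      qed
      show "b (x + Y k) \<le> D" "0 \<le> b (x + Y k)" for x k
        using D b0 less_imp_le by auto
    qed (auto intro: int_q vV w dV ae \<beta>_lim)
    then have "(\<lambda>k. 1 - T k) \<longlonglongrightarrow> t" by (simp only: Iv)
    then have "(\<lambda>k. 1 - (1 - T k)) \<longlonglongrightarrow> 1 - t" by (intro tendsto_intros)
    then have T_lim: "T \<longlonglongrightarrow> 1 - t" by simp
    have T0: "0 \<le> T k" for k
      unfolding T_def using b0 by (intro integral_nonneg_AE AE_I2 mult_nonneg_nonneg) (auto intro: less_imp_le)
    have t1: "t \<le> 1"
      using LIMSEQ_le_const[OF T_lim, of 0] T0 by auto
    \<comment> \<open>The remainder is moved back by \<open>Y k\<close>, so that \<open>I\<close> is
      evaluated with the original \<open>b\<close>; lattice invariance keeps its norm, which is then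
      expanded around the weak limit.\<close>
    have BT: "\<kappa>\<^sup>2 * T k powr (2 / q) \<le> (H.N (u (r (s k))))\<^sup>2 - 2 * B (v (s k)) w + B w w" for k
    proof -
      let ?d = "\<lambda>x. v (s k) x - w x"
      have "\<kappa>\<^sup>2 * I (\<lambda>x. ?d (x - Y k)) powr (2 / q) \<le> B (\<lambda>x. ?d (x - Y k)) (\<lambda>x. ?d (x - Y k))"
        by (rule hom[OF sobolev_shift(1)[OF dV] \<kappa>0])
      also have "\<dots> = (H.N (\<lambda>x. ?d (x - Y k)))\<^sup>2"
        by (rule H.N_sq[OF sobolev_shift(1)[OF dV], symmetric])
      also have "H.N (\<lambda>x. ?d (x - Y k)) = H.N ?d"
        unfolding N by (rule inv[OF dV YL])
      also have "(H.N ?d)\<^sup>2 = (H.N (v (s k)))\<^sup>2 - 2 * B (v (s k)) w + (H.N w)\<^sup>2"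
        by (rule H.N_diff_sq[OF vV w])
      finally show ?thesis
        using I_shift[OF dV[of "s k"], of "Y k"] by (simp add: T_def Nv H.N_sq[OF w])
    qed
    have "(\<lambda>k. (H.N (u (r (s k))))\<^sup>2 - 2 * B (v (s k)) w + B w w) \<longlonglongrightarrow> \<kappa>\<^sup>2 - 2 * B w w + B w w"
      using LIMSEQ_subseq_LIMSEQ[OF LIMSEQ_subseq_LIMSEQ[OF Nu_lim r] s] unfolding o_def
      by (intro tendsto_intros B_lim) auto
    moreover have "(\<lambda>k. \<kappa>\<^sup>2 * T k powr (2 / q)) \<longlonglongrightarrow> \<kappa>\<^sup>2 * (1 - t) powr (2 / q)"
      using q T0 by (intro tendsto_intros tendsto_powr' T_lim) auto
    ultimately have "\<kappa>\<^sup>2 * (1 - t) powr (2 / q) \<le> \<kappa>\<^sup>2 - 2 * B w w + B w w"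
      using BT by (intro LIMSEQ_le) auto
    then show ?thesis using t1 by simp
  qed
  have p: "0 < 2 / q" "2 / q < 1" using q by auto
  have \<kappa>2: "0 < \<kappa>\<^sup>2" using \<kappa>_pos by simp
  show ?thesis
  proof (cases "\<exists>y0\<in>integer_lattice. (\<lambda>k. y (r k)) \<longlonglongrightarrow> y0")
    case True
    then obtain y0 where y0: "y0 \<in> integer_lattice" "(\<lambda>k. y (r k)) \<longlonglongrightarrow> y0" by blast
    have Y_lim: "Y \<longlonglongrightarrow> y0"
      using LIMSEQ_subseq_LIMSEQ[OF y0(2) s] by (simp add: Y_def[abs_def] o_def)
    have "(\<lambda>k. b (x + Y k)) \<longlonglongrightarrow> b (x + y0)" for x
      using continuous_on_tendsto_compose[OF cont, of "\<lambda>k. x + Y k" "x + y0" sequentially]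
        tendsto_add[OF tendsto_const Y_lim] by simp
    note sp = split[OF this _ refl]
    define w' where "w' = (\<lambda>x. w (x - y0))"
    have w'V: "w' \<in> ?V" unfolding w'_def by (rule sobolev_shift(1)[OF w])
    have Nw': "H.N w' = H.N w" unfolding w'_def N by (rule inv[OF w y0(1)])
    then have Bw': "B w' w' = B w w" using H.N_sq[OF w] H.N_sq[OF w'V] by simp
    define t where "t = I w'"
    have t_eq: "t = (LINT x|lborel. b (x + y0) * cmod (w x) powr q)"
      unfolding t_def w'_def by (rule I_shift[OF w])
    have t1: "t \<le> 1" and le: "\<kappa>\<^sup>2 * (1 - t) powr (2 / q) \<le> \<kappa>\<^sup>2 - B w w"
      using sp unfolding t_eq by simp_all
    have "b_inf * (LINT x|lborel. cmod (w x) powr q) \<le> t"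
    proof -
      have "(LINT x|lborel. b_inf * cmod (w x) powr q) \<le> t"
        unfolding t_eq using b_inf(2) less_imp_le
        by (intro integral_mono integrable_mult_right int_q int_b w mult_right_mono) auto
      then show ?thesis by simp
    qed
    \<comment> \<open>Positivity of \<open>t\<close> excludes the other endpoint at which the
      concavity inequality is an equality.\<close>
    then have t0: "0 < t" using mult_pos_pos[OF b_inf(1) w_pos] by linarith
    have "\<kappa>\<^sup>2 * t powr (2 / q) \<le> B w w"
      using hom[OF w'V \<kappa>0] by (simp add: t_def Bw')
    then have "\<kappa>\<^sup>2 * (t powr (2 / q) + (1 - t) powr (2 / q)) \<le> \<kappa>\<^sup>2 * 1"
      using le by (simp add: distrib_left)
    then have "t powr (2 / q) + (1 - t) powr (2 / q) \<le> 1"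
      using \<kappa>2 by (simp only: mult_le_cancel_left_pos)
    then have "t = 1"
      using powr_sum_ge_1(2)[OF _ t1 p] t0 t1 by (cases "t < 1") auto
    then have w'S: "w' \<in> ?S" using w'V by (simp add: S_iff t_def)
    have "(H.N w')\<^sup>2 \<le> \<kappa>\<^sup>2"
      using le \<open>t = 1\<close> by (simp add: H.N_sq[OF w'V] Bw')
    then have "H.N w' \<le> \<kappa>" using \<kappa>0 by (rule power2_le_imp_le)
    then have "H.N w' = \<kappa>" using \<kappa>_le[OF w'S] by simp
    then show ?thesis using w'S unfolding \<kappa>_def N by blast
  next
    case False
    then have "filterlim (\<lambda>k. y (r k)) at_infinity sequentially" using alt by blast
    then have Y_lim: "filterlim Y at_infinity sequentially"
      using filterlim_compose[OF _ filterlim_subseq[OF s]] by (fastforce simp: Y_def[abs_def])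
    have "(\<lambda>k. b (x + Y k)) \<longlonglongrightarrow> b_inf" for x
      by (rule filterlim_compose[OF b_lim tendsto_add_filterlim_at_infinity[OF tendsto_const Y_lim]])
    note sp = split[OF this _ refl]
    define t where "t = b_inf * (LINT x|lborel. cmod (w x) powr q)"
    have t1: "t \<le> 1" and le: "\<kappa>\<^sup>2 * (1 - t) powr (2 / q) \<le> \<kappa>\<^sup>2 - B w w"
      using sp unfolding t_def by simp_all
    have t0: "0 < t" unfolding t_def by (rule mult_pos_pos[OF b_inf(1) w_pos])
    \<comment> \<open>Here \<open>w\<close> is tested with \<open>b\<close> itself, without
      translation. Since \<open>w\<close> is nonzero on a set of positive measure,
      \<open>b > b_inf\<close> gives a strict gain.\<close>
    have "t < I w"
    proof -
      have int: "integrable lborel (\<lambda>x. (b x - b_inf) * cmod (w x) powr q)"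
        using int_b[OF w, of 0] int_q[OF w] by (simp add: left_diff_distrib)
      have eq: "I w - t = (LINT x|lborel. (b x - b_inf) * cmod (w x) powr q)"
        using int_b[OF w, of 0] int_q[OF w] by (simp add: left_diff_distrib I_def t_def)
      have nn: "0 \<le> (b x - b_inf) * cmod (w x) powr q" for x
        using b_inf(2)[of x] by simp
      have "(LINT x|lborel. (b x - b_inf) * cmod (w x) powr q) \<noteq> 0"
      proof
        assume "(LINT x|lborel. (b x - b_inf) * cmod (w x) powr q) = 0"
        then have "AE x in lborel. (b x - b_inf) * cmod (w x) powr q = 0"
          by (subst (asm) integral_nonneg_eq_0_iff_AE[OF int]) (use nn in auto)
        then have "AE x in lborel. w x = 0"
        proof eventually_elim
          case (elim x)
          then show ?case using b_inf(2)[of x] by simp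
        qed
        then show False using w_ne by simp
      qed
      moreover have "0 \<le> (LINT x|lborel. (b x - b_inf) * cmod (w x) powr q)"
        using nn by (intro integral_nonneg_AE) auto
      ultimately show ?thesis using eq by linarith
    qed
    then have "t powr (2 / q) < I w powr (2 / q)"
      using t0 p by (intro powr_less_mono2) auto
    then have "\<kappa>\<^sup>2 * t powr (2 / q) < \<kappa>\<^sup>2 * I w powr (2 / q)"
      using \<kappa>2 by (rule mult_strict_left_mono)
    then have "\<kappa>\<^sup>2 * t powr (2 / q) < B w w"
      using hom[OF w \<kappa>0] by linarith
    then have "\<kappa>\<^sup>2 * (t powr (2 / q) + (1 - t) powr (2 / q)) < \<kappa>\<^sup>2 * 1"
      using le by (simp add: distrib_left)
    then have "t powr (2 / q) + (1 - t) powr (2 / q) < 1"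
      using \<kappa>2 by (simp only: mult_less_cancel_left_pos)
    then show ?thesis
      using powr_sum_ge_1(1)[OF less_imp_le[OF t0] t1 p] by simp
  qed
qed

section \<open>From norms to real semi-inner products\<close>

lemma semi_inner_of_inner_product:
  assumes K: "real_scalars K" and ip: "inner_product_on K V ip"
    and add: "\<And>f g. f \<in> V \<Longrightarrow> g \<in> V \<Longrightarrow> (\<lambda>x. f x + g x) \<in> V"
    and scale: "\<And>f c. f \<in> V \<Longrightarrow> (\<lambda>x. complex_of_real c * f x) \<in> V"
  shows "semi_inner V (\<lambda>f g. Re (ip f g))"
proof
  have K_real: "complex_of_real c \<in> K" for c using K by (auto simp: real_scalars_def)
  fix f g assume f: "f \<in> V" and g: "g \<in> V"
  show "(\<lambda>x. f x + g x) \<in> V" by (rule add[OF f g])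
  show "(\<lambda>x. complex_of_real c * f x) \<in> V" for c by (rule scale[OF f])
  have "ip g f = cnj (ip f g)" using ip f g unfolding inner_product_on_def by blast
  then show "Re (ip f g) = Re (ip g f)" by simp
  show "Re (ip (\<lambda>x. f x + g x) h) = Re (ip f h) + Re (ip g h)" if h: "h \<in> V" for h
  proof -
    have "ip (\<lambda>x. f x + g x) h = ip f h + ip g h" using ip f g h unfolding inner_product_on_def by blast
    then show ?thesis by simp
  qed
  show "Re (ip (\<lambda>x. complex_of_real c * f x) g) = c * Re (ip f g)" for c
  proof -
    have "\<forall>c\<in>K. \<forall>f\<in>V. \<forall>g\<in>V. ip (\<lambda>x. c * f x) g = c * ip f g"
      using ip unfolding inner_product_on_def by blast
    then have "ip (\<lambda>x. complex_of_real c * f x) g = complex_of_real c * ip f g"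
      using K_real f g by blast
    then show ?thesis by simp
  qed
  show "0 \<le> Re (ip f f)" using ip f unfolding inner_product_on_def by blast
qed

theorem theorem6p5:
  fixes b :: "real ^ 'n \<Rightarrow> real"
    and b_inf \<alpha> q :: real
    and K :: "complex set"
    and nrm :: "(real ^ 'n \<Rightarrow> complex) \<Rightarrow> real"
  assumes "K = \<real> \<or> K = UNIV"
    and "continuous_on UNIV b"
    and "(b \<longlongrightarrow> b_inf) at_infinity"
    and "0 < b_inf"
    and "\<And>x. b_inf < b x"
    and "0 < \<alpha>"
    and "2 < q"
    and "ereal q < critical_exponent CARD('n) \<alpha>"
    and "nrm = sobolev_norm \<alpha> \<or>
         hilbert_norm_on K (sobolev K \<alpha>) nrm \<and>
         equivalent_norms_on (sobolev K \<alpha>) nrm (sobolev_norm \<alpha>) \<and>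
         lattice_invariant (sobolev K \<alpha>) nrm"
  shows "\<exists>u \<in> constraint_set K \<alpha> q b. nrm u = (INF v \<in> constraint_set K \<alpha> q b. nrm v)"
proof -
  have K: "real_scalars K" using assms(1) by (simp add: real_scalars_def)
  \<comment> \<open>Both alternatives for the norm are brought to one form: a semi-inner product,
    equivalence constants and invariance under the lattice. For the standard norm both constants are
    1.\<close>
  obtain B c C where B: "semi_inner (sobolev K \<alpha> :: (real ^ 'n \<Rightarrow> complex) set) B"
    and nrm: "\<And>f. f \<in> sobolev K \<alpha> \<Longrightarrow> nrm f = sqrt (B f f)"
    and c: "0 < c" "\<And>f. f \<in> sobolev K \<alpha> \<Longrightarrow> c * sobolev_norm \<alpha> f \<le> nrm f"
    and C: "0 < C" "\<And>f. f \<in> sobolev K \<alpha> \<Longrightarrow> nrm f \<le> C * sobolev_norm \<alpha> f"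
    and inv: "\<And>f y. f \<in> sobolev K \<alpha> \<Longrightarrow> y \<in> integer_lattice \<Longrightarrow> nrm (\<lambda>x. f (x - y)) = nrm f"
    using assms(9)
  proof
    assume eq: "nrm = sobolev_norm \<alpha>"
    show ?thesis
      by (rule that[OF semi_inner_sobolev[OF K], of 1 1]) (simp_all add: eq sobolev_inner_self sobolev_shift(2))
  next
    assume H: "hilbert_norm_on K (sobolev K \<alpha>) nrm \<and>
         equivalent_norms_on (sobolev K \<alpha>) nrm (sobolev_norm \<alpha>) \<and>
         lattice_invariant (sobolev K \<alpha>) nrm"
    then obtain ip where ip: "inner_product_on K (sobolev K \<alpha>) ip" and n: "\<forall>f\<in>sobolev K \<alpha>. nrm f = sqrt (Re (ip f f))"
      by (auto simp: hilbert_norm_on_def)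
    obtain c C where "0 < c" "0 < C" "\<forall>f\<in>sobolev K \<alpha>. c * sobolev_norm \<alpha> f \<le> nrm f \<and> nrm f \<le> C * sobolev_norm \<alpha> f"
      using H by (auto simp: equivalent_norms_on_def)
    then show ?thesis
      using H n
      by (intro that[OF semi_inner_of_inner_product[OF K ip sobolev_add[OF K] sobolev_scale[OF K]], of c C])
        (auto simp: lattice_invariant_def)
  qed
  have "\<exists>u\<in>constraint_set K \<alpha> q b. sqrt (B u u) = (INF v\<in>constraint_set K \<alpha> q b. sqrt (B v v))"
  proof (rule minimizer_exists[OF K assms(2-8) B c(1) _ C(1)])
    show "c * sobolev_norm \<alpha> f \<le> sqrt (B f f)" "sqrt (B f f) \<le> C * sobolev_norm \<alpha> f" if "f \<in> sobolev K \<alpha>" for f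
      using c(2)[OF that] C(2)[OF that] nrm[OF that] by simp_all
    show "sqrt (B (\<lambda>x. f (x - y)) (\<lambda>x. f (x - y))) = sqrt (B f f)" if "f \<in> sobolev K \<alpha>" "y \<in> integer_lattice" for f y
      \<comment> \<open>\<open>nrm\<close> and \<open>B\<close> are linked only on the Sobolev
        space, so the translate has to be known to lie in it.\<close>
      using inv[OF that] nrm[OF that(1)] nrm[OF sobolev_shift(1)[OF that(1), of y]] by simp
  qed
  moreover have "sqrt (B v v) = nrm v" if "v \<in> constraint_set K \<alpha> q b" for v
    using that nrm by (simp add: constraint_set_def)
  ultimately show ?thesis by simp
qed

end
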